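(* For every integer $n\ge 6$, $$\min(n)=\begin{cases}2 & \text{if } n\equiv 0 \pmod 4,\\ 4 & \text{if } n\equiv 1 \pmod 4,\\ 5 & \text{otherwise.}\end{cases}$$
   Context: For a finite group $G$ and $a,b\in G$, $a^G=\{g^{-1}ag : g\in G\}$ denotes the conjugacy class of $a$ in $G$, and $a^Gb^G=\{xy : x\in a^G,\ y\in b^G\}$. The set $a^Gb^G$ is a union of conjugacy classes of $G$; $\eta(a^Gb^G)$ denotes the number of distinct conjugacy classes of $G$ contained in it. With $A_n$ the alternating group on $n$ letters and $e$ its identity, $\min(n)$ denotes the smallest integer in the set $\{\eta(\alpha^{A_n}\beta^{A_n}) : \alpha,\beta\in A_n\setminus\{e\}\}$. *)

theory Defs
  imports "HOL-Algebra.Sym_Groups"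
begin

definition conj_class :: "('a, 'b) monoid_scheme \<Rightarrow> 'a \<Rightarrow> 'a set"
  where "conj_class G a = {inv\<^bsub>G\<^esub> g \<otimes>\<^bsub>G\<^esub> a \<otimes>\<^bsub>G\<^esub> g | g. g \<in> carrier G}"

definition conj_classes :: "('a, 'b) monoid_scheme \<Rightarrow> 'a set set"
  where "conj_classes G = conj_class G ` carrier G"

(* Meaningful only for groups with finitely many conjugacy classes, as card is 0 on infinite sets. *)
definition eta :: "('a, 'b) monoid_scheme \<Rightarrow> 'a set \<Rightarrow> nat"
  where "eta G X = card {K \<in> conj_classes G. K \<subseteq> X}"

(* The set is finite, and nonempty for n at least 3, so Min is then its least element.
   The library composes permutations from right to left; the opposite convention gives the
   same conjugacy classes and the same products of two conjugacy classes. *)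
definition min_eta :: "nat \<Rightarrow> nat"
  where "min_eta n =
    Min {eta (alt_group n)
           (conj_class (alt_group n) \<alpha> <#>\<^bsub>alt_group n\<^esub> conj_class (alt_group n) \<beta>) | \<alpha> \<beta>.
         \<alpha> \<in> carrier (alt_group n) - {\<one>\<^bsub>alt_group n\<^esub>} \<and>
         \<beta> \<in> carrier (alt_group n) - {\<one>\<^bsub>alt_group n\<^esub>}}"

end

theory Submission
  imports Defs
begin

text \<open>The classes in \<open>\<alpha>\<^sup>A \<beta>\<^sup>A\<close> are those of the products \<open>\<alpha> \<beta>\<^sup>g\<close> with \<open>g\<close> even, and the numbers of points
  fixed by the first three powers of such a product are class invariants. For the lower bounds, place
  a bounded part of the cycles of \<open>\<alpha>\<inverse>\<close> and of \<open>\<beta>\<close> on the same points and rearrange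
  \<open>\<beta>\<close> there. The fixed points of \<open>\<alpha> \<beta>\<^sup>g\<close> are the points where \<open>\<beta>\<^sup>g\<close> and \<open>\<alpha>\<inverse>\<close> agree, so their number
  changes in a computable way whatever happens on the remaining points. Each rearrangement comes with
  a second one of opposite parity and with the same effect, so that a rearrangement by an even
  permutation always exists. A finite list of such configurations covers every pair of cycle types,
  as every even permutation of nine or more points contains one of twenty-three bounded pieces. For the
  upper bounds, multiply a fixed-point-free or nearly fixed-point-free involution, or a three-cycle when
  \<open>n mod 4 = 3\<close>, by a three-cycle.\<close>

text \<open>The constants 2, 4, 5 come from the upper bounds. The centraliser of an involution moves
  an ordered triple of points to any other that meets its 2-cycles and fixed points in the same way.
  Up to order a triple either contains a 2-cycle or does not, and it contains some fixed points or
  none: this gives 2 kinds without fixed points, 4 with one and 5 with two. Three fixed points would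
  add a sixth kind, so for \<open>n mod 4 = 3\<close> the square of the class of three-cycles is
  used, whose elements have the types 1, 3, 2+2, 5 and 3+3. For the lower bounds the obstacle is
  that nothing is known about the points outside the bounded part. Every configuration is such that
  these points add the same unknown constant to the counts for all its rearrangements, so
  differences are still visible. The profile is invariant under all of the symmetric group and
  cannot see that a class splits in the alternating group. This matters in degree 6 only, where some
  pairs of types are certified for four profiles; there the fifth class comes from the two classes
  of five-cycles.\<close>

definition fix_profile :: "'a set \<Rightarrow> ('a \<Rightarrow> 'a) \<Rightarrow> nat \<times> nat \<times> nat" where
  "fix_profile X f = (card {x \<in> X. f x = x}, card {x \<in> X. f (f x) = x}, card {x \<in> X. f (f (f x)) = x})"

definition twist :: "('a \<Rightarrow> 'a) \<Rightarrow> ('a \<Rightarrow> 'a) \<Rightarrow> 'a \<Rightarrow> 'a" where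
  "twist g b = g \<circ> b \<circ> inv' g"

text \<open>Here \<open>a\<close> is the inverse of the first factor of the class product;
  \<open>eta_ge_many\<close> translates back.\<close>

definition profile_at :: "'a set \<Rightarrow> ('a \<Rightarrow> 'a) \<Rightarrow> ('a \<Rightarrow> 'a) \<Rightarrow> ('a \<Rightarrow> 'a) \<Rightarrow> nat \<times> nat \<times> nat" where
  "profile_at X a b g = fix_profile X (inv' a \<circ> twist g b)"

definition many :: "nat \<Rightarrow> 'a set \<Rightarrow> ('a \<Rightarrow> 'a) \<Rightarrow> ('a \<Rightarrow> 'a) \<Rightarrow> bool" where
  "many k X a b \<longleftrightarrow> k \<le> card (profile_at X a b ` {g. g permutes X \<and> evenperm g})"

lemma twist_permutes: "g permutes X \<Longrightarrow> b permutes X \<Longrightarrow> twist g b permutes X"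
  unfolding twist_def by (intro permutes_compose permutes_inv)

lemma twist_apply: "g permutes X \<Longrightarrow> twist g b (g x) = g (b x)"
  by (simp add: twist_def permutes_inverses(2))

lemma twist_comp: "g permutes X \<Longrightarrow> h permutes X \<Longrightarrow> twist (h \<circ> g) b = twist h (twist g b)"
  unfolding twist_def using o_inv_distrib[OF permutes_bij permutes_bij, of h X g X] by (simp add: comp_assoc)

lemma card_permuted_Collect:
  assumes "g permutes X"
  shows "card {x \<in> X. Q (inv' g x)} = card {x \<in> X. Q x}"
proof -
  have "bij_betw g {x \<in> X. Q x} {x \<in> X. Q (inv' g x)}"
    by (rule bij_betwI[where g = "inv' g"])
      (use assms in \<open>auto simp: permutes_in_image permutes_inv permutes_inverses\<close>)
  then show ?thesis by (simp add: bij_betw_same_card)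
qed

lemma fix_profile_twist:
  assumes "g permutes X"
  shows "fix_profile X (twist g f) = fix_profile X f"
proof -
  have 1: "twist g f x = x \<longleftrightarrow> f (inv' g x) = inv' g x" for x
    using assms by (simp add: twist_def) (metis permutes_inverses)
  have 2: "twist g f (twist g f x) = x \<longleftrightarrow> f (f (inv' g x)) = inv' g x" for x
    using assms by (simp add: twist_def permutes_inverses) (metis permutes_inverses)
  have 3: "twist g f (twist g f (twist g f x)) = x \<longleftrightarrow> f (f (f (inv' g x))) = inv' g x" for x
    using assms by (simp add: twist_def permutes_inverses) (metis permutes_inverses)
  show ?thesis
    using card_permuted_Collect[OF assms, of "\<lambda>x. f x = x"]
      card_permuted_Collect[OF assms, of "\<lambda>x. f (f x) = x"]
      card_permuted_Collect[OF assms, of "\<lambda>x. f (f (f x)) = x"]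
    by (simp add: fix_profile_def 1 2 3)
qed

lemma fix_profile_inv:
  assumes "f permutes X"
  shows "fix_profile X (inv' f) = fix_profile X f"
proof -
  have 1: "inv' f x = x \<longleftrightarrow> f x = x" for x using assms by (metis permutes_inverses)
  have 2: "inv' f (inv' f x) = x \<longleftrightarrow> f (f x) = x" for x using assms by (metis permutes_inverses)
  have 3: "inv' f (inv' f (inv' f x)) = x \<longleftrightarrow> f (f (f x)) = x" for x using assms by (metis permutes_inverses)
  show ?thesis by (simp add: fix_profile_def 1 2 3)
qed

text \<open>Conjugation by \<open>inv' g\<close> turns the inverse of
  \<open>inv' a \<circ> twist g b\<close> into \<open>inv' b \<circ> twist (inv' g) a\<close>, and
  the profile ignores both inversion and conjugation. Through \<open>many_sym\<close> each pair of
  types has to be treated in one order only.\<close>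

lemma profile_at_swap:
  assumes "a permutes X" "b permutes X" "g permutes X"
  shows "profile_at X b a (inv' g) = profile_at X a b g"
proof -
  have "inv' b \<circ> twist (inv' g) a = twist (inv' g) (inv' (inv' a \<circ> twist g b))"
    using assms unfolding twist_def
    by (simp add: o_inv_distrib permutes_bij permutes_inv permutes_inv_inv bij_comp permutes_compose
        fun_eq_iff permutes_inverses bij_imp_bij_inv)
  then show ?thesis
    using assms by (simp add: profile_at_def fix_profile_twist fix_profile_inv permutes_inv
        permutes_compose twist_permutes)
qed

lemma many_sym:
  assumes "finite X" "a permutes X" "b permutes X" "many k X a b"
  shows "many k X b a"
proof -
  let ?G = "{g. g permutes X \<and> evenperm g}"
  have "profile_at X a b ` ?G \<subseteq> profile_at X b a ` ?G"
  proof clarsimp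
    fix g :: "'a \<Rightarrow> 'a" assume "g permutes X" "evenperm g"
    then show "profile_at X a b g \<in> profile_at X b a ` ?G"
      using profile_at_swap[OF assms(2,3), of g] assms(1)
        permutation_permutes[of g] evenperm_inv[of g]
      by (auto intro!: image_eqI[where x = "inv' g"] simp: permutes_inv)
  qed
  moreover have "finite ?G" using assms(1) by (simp add: finite_permutations)
  ultimately show ?thesis using assms(4) unfolding many_def
    by (meson card_mono finite_imageI le_trans)
qed

lemma many_mono: "many k X a b \<Longrightarrow> j \<le> k \<Longrightarrow> many j X a b"
  by (simp add: many_def)

lemma manyI:
  assumes "finite X" "distinct ws" "k \<le> length ws"
    and "\<And>w. w \<in> set ws \<Longrightarrow> \<exists>g. g permutes X \<and> evenperm g \<and> profile_at X a b g = w"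
  shows "many k X a b"
proof -
  let ?G = "{g. g permutes X \<and> evenperm g}"
  have "set ws \<subseteq> profile_at X a b ` ?G"
  proof
    fix w assume "w \<in> set ws"
    from assms(4)[OF this] show "w \<in> profile_at X a b ` ?G" by auto
  qed
  then have "card (set ws) \<le> card (profile_at X a b ` ?G)"
    by (intro card_mono) (auto simp: finite_permutations assms(1))
  then show ?thesis using assms(2,3) by (simp add: many_def distinct_card)
qed

subsection \<open>Partial cycle forms\<close>

text \<open>A form \<open>(ls, e)\<close> numbers the points of consecutive blocks of lengths \<open>ls\<close>, each a cycle of the permutation.
  The closing arc of the last block is certain for \<open>Closed\<close>, unknown for \<open>Open\<close> and known to fail for \<open>Strict\<close>.\<close>

datatype ending = Closed | Open | Strict

text \<open>The closing arc ends the segment of its block, so the last entry of the whole list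
  closes the last block. A block of length one is a loop \<open>(i, i)\<close>; a block of length 0
  would produce a meaningless arc, hence the recurring hypothesis
  \<open>0 \<notin> set ls\<close>.\<close>

primrec block_arcs :: "nat \<Rightarrow> nat list \<Rightarrow> (nat \<times> nat) list" where
  "block_arcs i [] = []"
| "block_arcs i (l # ls) = map (\<lambda>k. (k, Suc k)) [i..<i + l - 1] @ (i + l - 1, i) # block_arcs (i + l) ls"

definition arcs :: "nat list \<Rightarrow> ending \<Rightarrow> (nat \<times> nat) list" where
  "arcs ls e = (if e = Closed then block_arcs 0 ls else butlast (block_arcs 0 ls))"

text \<open>At most one pair: the end of the unfinished block together with its start, the only
  position of the form to which that end could be mapped.\<close>

definition exits :: "nat list \<Rightarrow> ending \<Rightarrow> (nat \<times> nat) list" where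
  "exits ls e = (if e = Closed then [] else [last (block_arcs 0 ls)])"

definition doubtful :: "nat list \<Rightarrow> ending \<Rightarrow> (nat \<times> nat) list" where
  "doubtful ls e = (if e = Open then exits ls e else [])"

definition form_on :: "'a set \<Rightarrow> ('a \<Rightarrow> 'a) \<Rightarrow> nat list \<Rightarrow> ending \<Rightarrow> 'a list \<Rightarrow> bool" where
  "form_on X f ls e xs \<longleftrightarrow> length xs = sum_list ls \<and> distinct xs \<and> set xs \<subseteq> X \<and>
     (\<forall>(i, j) \<in> set (arcs ls e). f (xs ! i) = xs ! j) \<and>
     (e = Strict \<longrightarrow> (\<forall>(i, j) \<in> set (exits ls e). f (xs ! i) \<noteq> xs ! j))"

definition has_form :: "'a set \<Rightarrow> ('a \<Rightarrow> 'a) \<Rightarrow> nat list \<Rightarrow> ending \<Rightarrow> bool" where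
  "has_form X f ls e \<longleftrightarrow> (\<exists>xs. form_on X f ls e xs)"

lemma block_arcs_ne: "ls \<noteq> [] \<Longrightarrow> block_arcs i ls \<noteq> []"
  by (cases ls) auto

lemma map_fst_block_arcs:
  "0 \<notin> set ls \<Longrightarrow> map fst (block_arcs i ls) = [i..<i + sum_list ls]"
proof (induction ls arbitrary: i)
  case (Cons l ls)
  then have "l > 0" by auto
  have "map fst (block_arcs i (l # ls)) = [i..<i + l - 1] @ (i + l - 1) # [i + l..<i + l + sum_list ls]"
    using Cons by (simp add: comp_def)
  also have "[i..<i + l - 1] @ (i + l - 1) # [i + l..<i + l + sum_list ls] = [i..<i+l] @ [i + l..<i + l + sum_list ls]"
    using \<open>l > 0\<close> upt_Suc_append[of i "i + l - 1"] by simp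
  also have "\<dots> = [i..<i + sum_list (l # ls)]"
    by (metis add.assoc le_add1 sum_list.Cons upt_add_eq_append)
  finally show ?case .
qed simp

lemma set_snd_block_arcs:
  "0 \<notin> set ls \<Longrightarrow> snd ` set (block_arcs i ls) = {i..<i + sum_list ls}"
proof (induction ls arbitrary: i)
  case (Cons l ls)
  then have "l > 0" by auto
  have 1: "snd ` set (map (\<lambda>k. (k, Suc k)) [i..<i + l - 1]) = {i<..<i + l}"
  proof -
    have "snd ` set (map (\<lambda>k. (k, Suc k)) [i..<i + l - 1]) = Suc ` {i..<i + l - 1}"
      by (simp add: image_image)
    also have "\<dots> = {i<..<i + l}" using \<open>l > 0\<close> by (auto simp: image_Suc_atLeastLessThan)
    finally show ?thesis .
  qed
  have "snd ` set (block_arcs i (l # ls)) =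
        snd ` set (map (\<lambda>k. (k, Suc k)) [i..<i + l - 1]) \<union> insert i (snd ` set (block_arcs (i + l) ls))"
    by (simp only: block_arcs.simps set_append image_Un list.set image_insert snd_conv)
  also have "\<dots> = {i<..<i + l} \<union> insert i {i + l..<i + l + sum_list ls}"
    using Cons 1 by simp
  also have "\<dots> = {i..<i + (l + sum_list ls)}"
  proof -
    have "insert i {i<..<i + l} = {i..<i + l}" using \<open>l > 0\<close> by auto
    moreover have "{i..<i + l} \<union> {i + l..<i + l + sum_list ls} = {i..<i + l + sum_list ls}"
      by (rule ivl_disj_un_two(3)) auto
    ultimately show ?thesis by (metis Un_insert_left Un_insert_right add.assoc)
  qed
  finally show ?case by simp
qed simp

lemma arcs_exits:
  assumes "ls \<noteq> []"
  shows "set (arcs ls e) \<union> set (exits ls e) = set (block_arcs 0 ls)"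
    and "e \<noteq> Closed \<Longrightarrow> arcs ls e @ exits ls e = block_arcs 0 ls"
proof -
  have eq: "butlast (block_arcs 0 ls) @ [last (block_arcs 0 ls)] = block_arcs 0 ls"
    using block_arcs_ne[OF assms] by simp
  show "e \<noteq> Closed \<Longrightarrow> arcs ls e @ exits ls e = block_arcs 0 ls"
    using eq by (simp add: arcs_def exits_def)
  then show "set (arcs ls e) \<union> set (exits ls e) = set (block_arcs 0 ls)"
    using set_append[of "arcs ls e" "exits ls e"] by (cases "e = Closed") (simp_all add: arcs_def exits_def)
qed

lemma block_arcs_inj:
  assumes "0 \<notin> set ls"
  shows "distinct (map fst (block_arcs i ls))" "distinct (map snd (block_arcs i ls))"
proof -
  show "distinct (map fst (block_arcs i ls))" using map_fst_block_arcs[OF assms] by simp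
  have "length (map snd (block_arcs i ls)) = sum_list ls"
    using arg_cong[OF map_fst_block_arcs[OF assms, of i], of length] by simp
  moreover have "card (set (map snd (block_arcs i ls))) = sum_list ls"
    using set_snd_block_arcs[OF assms, of i] by simp
  ultimately show "distinct (map snd (block_arcs i ls))" by (metis card_distinct)
qed

text \<open>Every position except the start of an unfinished block is the target of a known arc. By
  injectivity the end of that block either returns to its start or leaves the form, and a point
  outside can enter the form only at that start.\<close>

lemma form_on_facts:
  assumes "form_on X f ls e xs" "f permutes X" "ls \<noteq> []" "0 \<notin> set ls"
  shows arcs_ok: "\<And>i j. (i, j) \<in> set (arcs ls e) \<Longrightarrow> i < length xs \<and> j < length xs \<and> f (xs ! i) = xs ! j"
    and exits_ok: "\<And>i j. (i, j) \<in> set (exits ls e) \<Longrightarrow> i < length xs \<and> j < length xs \<and>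
            (f (xs ! i) \<notin> set xs \<or> f (xs ! i) = xs ! j \<and> (i, j) \<in> set (doubtful ls e))"
    and out_ok: "\<And>i. i < length xs \<Longrightarrow> \<exists>j. (i, j) \<in> set (arcs ls e) \<or> (i, j) \<in> set (exits ls e)"
    and in_ok: "\<And>j. j < length xs \<Longrightarrow> \<exists>i. (i, j) \<in> set (arcs ls e) \<or> (i, j) \<in> set (exits ls e)"
    and entry_ok: "\<And>x. x \<notin> set xs \<Longrightarrow> f x \<in> set xs \<Longrightarrow> \<exists>i j. (i, j) \<in> set (exits ls e) \<and> f x = xs ! j"
    and arcs_fun: "\<And>i j k. (i, j) \<in> set (arcs ls e) \<Longrightarrow> (i, k) \<in> set (arcs ls e) \<Longrightarrow> j = k"
    and exits_notin: "\<And>i j k. (i, j) \<in> set (exits ls e) \<Longrightarrow> (i, k) \<notin> set (arcs ls e)"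
    and entries_notin: "\<And>i j k. (i, j) \<in> set (exits ls e) \<Longrightarrow> (k, j) \<notin> set (arcs ls e)"
    and dist_arcs: "distinct (map fst (arcs ls e))"
proof -
  let ?p = "length xs"
  have p: "?p = sum_list ls" and xs: "distinct xs" using assms(1) by (auto simp: form_on_def)
  have fsts: "fst ` set (block_arcs 0 ls) = {0..<?p}"
    using arg_cong[OF map_fst_block_arcs[OF assms(4), of 0], of set] p by simp
  have snds: "snd ` set (block_arcs 0 ls) = {0..<?p}"
    using set_snd_block_arcs[OF assms(4), of 0] p by simp
  note U = arcs_exits(1)[OF assms(3), of e]
  note inj = block_arcs_inj[OF assms(4), of 0]
  show A: "i < ?p \<and> j < ?p \<and> f (xs ! i) = xs ! j" if "(i, j) \<in> set (arcs ls e)" for i j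
  proof -
    have "(i, j) \<in> set (block_arcs 0 ls)" using that U by blast
    then have "i \<in> {0..<?p}" "j \<in> {0..<?p}" using fsts snds by force+
    moreover have "f (xs ! i) = xs ! j" using assms(1) that unfolding form_on_def by blast
    ultimately show ?thesis by simp
  qed
  show O: "\<exists>j. (i, j) \<in> set (arcs ls e) \<or> (i, j) \<in> set (exits ls e)" if "i < ?p" for i
  proof -
    from that fsts obtain z where "z \<in> set (block_arcs 0 ls)" "fst z = i" by (metis atLeastLessThan_iff imageE zero_le)
    then have "(i, snd z) \<in> set (block_arcs 0 ls)" by auto
    then show ?thesis using U by blast
  qed
  show I: "\<exists>i. (i, j) \<in> set (arcs ls e) \<or> (i, j) \<in> set (exits ls e)" if "j < ?p" for j
  proof -
    from that snds obtain z where "z \<in> set (block_arcs 0 ls)" "snd z = j" by (metis atLeastLessThan_iff imageE zero_le)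
    then have "(fst z, j) \<in> set (block_arcs 0 ls)" by auto
    then show ?thesis using U by blast
  qed
  have B1: "j = k" if "(i, j) \<in> set (block_arcs 0 ls)" "(i, k) \<in> set (block_arcs 0 ls)" for i j k
    using inj(1) that by (meson eq_key_imp_eq_value)
  have B2: "j = k" if "(j, i) \<in> set (block_arcs 0 ls)" "(k, i) \<in> set (block_arcs 0 ls)" for i j k
    using inj(2) that by (metis (mono_tags, lifting) distinct_map fst_conv inj_onD snd_conv)
  have D: "(i, j) \<notin> set (arcs ls e)" if "(i, j) \<in> set (exits ls e)" for i j
  proof -
    from that have "e \<noteq> Closed" by (auto simp: exits_def)
    then have "distinct (arcs ls e @ exits ls e)" using arcs_exits(2)[OF assms(3), of e] inj(1)
      by (metis distinct_map)
    then show ?thesis using that by auto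
  qed
  show "j = k" if "(i, j) \<in> set (arcs ls e)" "(i, k) \<in> set (arcs ls e)" for i j k
    using B1 that U by blast
  show X1: "(i, k) \<notin> set (arcs ls e)" if "(i, j) \<in> set (exits ls e)" for i j k
    using B1 that U D by blast
  show "(k, j) \<notin> set (arcs ls e)" if "(i, j) \<in> set (exits ls e)" for i j k
    using B2 that U D by blast
  have sing: "(i', j') = (i, j)" if "(i, j) \<in> set (exits ls e)" "(i', j') \<in> set (exits ls e)" for i j i' j'
    using that by (cases "e = Closed") (simp_all add: exits_def)
  show E: "i < ?p \<and> j < ?p \<and> (f (xs ! i) \<notin> set xs \<or> f (xs ! i) = xs ! j \<and> (i, j) \<in> set (doubtful ls e))"
    if ij: "(i, j) \<in> set (exits ls e)" for i j
  proof -
    have "(i, j) \<in> set (block_arcs 0 ls)" using ij U by blast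
    then have "i \<in> {0..<?p}" "j \<in> {0..<?p}" using fsts snds by force+
    then have lt: "i < ?p" "j < ?p" by auto
    have "f (xs ! i) = xs ! j \<and> (i, j) \<in> set (doubtful ls e)" if h: "f (xs ! i) \<in> set xs"
    proof -
      obtain k where k: "k < ?p" "f (xs ! i) = xs ! k" using h by (metis in_set_conv_nth)
      obtain i' where i': "(i', k) \<in> set (arcs ls e) \<or> (i', k) \<in> set (exits ls e)" using I[OF k(1)] by blast
      have "(i', k) \<notin> set (arcs ls e)"
      proof
        assume q: "(i', k) \<in> set (arcs ls e)"
        then have "f (xs ! i') = f (xs ! i)" using A k(2) by auto
        then have "xs ! i' = xs ! i" using permutes_inj[OF assms(2)] by (auto dest: injD)
        then have "i' = i" using A[OF q] lt xs by (simp add: nth_eq_iff_index_eq)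
        then show False using X1[OF ij] q by blast
      qed
      then have "k = j" using i' sing[OF ij] by auto
      moreover have "e \<noteq> Strict" using assms(1) ij k \<open>k = j\<close> unfolding form_on_def by blast
      moreover have "e \<noteq> Closed" using ij by (auto simp: exits_def)
      ultimately show ?thesis using k ij by (cases e) (auto simp: doubtful_def)
    qed
    then show ?thesis using lt by blast
  qed
  show "\<exists>i j. (i, j) \<in> set (exits ls e) \<and> f x = xs ! j" if x: "x \<notin> set xs" "f x \<in> set xs" for x
  proof -
    obtain k where k: "k < ?p" "f x = xs ! k" using x(2) by (metis in_set_conv_nth)
    obtain i' where i': "(i', k) \<in> set (arcs ls e) \<or> (i', k) \<in> set (exits ls e)" using I[OF k(1)] by blast
    have "(i', k) \<notin> set (arcs ls e)"
    proof
      assume q: "(i', k) \<in> set (arcs ls e)"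
      then have "f (xs ! i') = f x" using A k(2) by auto
      then have "xs ! i' = x" using permutes_inj[OF assms(2)] by (auto dest: injD)
      then show False using A[OF q] x(1) by auto
    qed
    then show ?thesis using i' k by blast
  qed
  show "distinct (map fst (arcs ls e))"
    using inj(1) unfolding arcs_def by (simp add: map_butlast distinct_butlast)
qed

subsection \<open>Relabelling a list of points\<close>

definition relabel :: "nat list \<Rightarrow> (nat \<times> nat) list \<Rightarrow> (nat \<times> nat) list" where
  "relabel s = map (\<lambda>(i, j). (s ! i, s ! j))"

definition labelling :: "nat \<Rightarrow> nat list \<Rightarrow> bool" where
  "labelling p s \<longleftrightarrow> length s = p \<and> distinct s \<and> (\<forall>i \<in> set s. i < p)"

definition realises :: "'a list \<Rightarrow> nat list \<Rightarrow> ('a \<Rightarrow> 'a) \<Rightarrow> bool" where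
  "realises xs s h \<longleftrightarrow> h permutes set xs \<and> (\<forall>k < length xs. h (xs ! k) = xs ! (s ! k))"

text \<open>Exchanging two entries of \<open>s\<close> composes its realisation on the right with
  the transposition of the two corresponding points.\<close>

primrec swaps :: "nat list \<Rightarrow> (nat \<times> nat) list \<Rightarrow> nat list" where
  "swaps s [] = s"
| "swaps s (ij # r) = swaps (s[fst ij := s ! snd ij, snd ij := s ! fst ij]) r"

text \<open>The odd length makes the realisations of \<open>s\<close> and \<open>swaps s r\<close>
  differ in parity, so that one of the two can be used whatever parity is required.\<close>

definition swaps_ok :: "nat \<Rightarrow> (nat \<times> nat) list \<Rightarrow> bool" where
  "swaps_ok p r \<longleftrightarrow> odd (length r) \<and> (\<forall>(i, j) \<in> set r. i < p \<and> j < p \<and> i \<noteq> j)"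

lemma labelling_surj:
  assumes "labelling p s" shows "set s = {..<p}"
proof -
  have "card (set s) = p" using assms by (simp add: labelling_def distinct_card)
  moreover have "set s \<subseteq> {..<p}" using assms by (auto simp: labelling_def)
  ultimately show ?thesis by (metis card_lessThan card_subset_eq finite_lessThan)
qed

lemma realises_exists:
  assumes "distinct xs" "labelling (length xs) s"
  shows "\<exists>h. realises xs s h"
proof -
  define pos where "pos = inv_into {..<length xs} (\<lambda>i. xs ! i)"
  have inj: "inj_on (\<lambda>i. xs ! i) {..<length xs}" using assms(1) by (auto simp: inj_on_def nth_eq_iff_index_eq)
  have pos: "pos (xs ! k) = k" if "k < length xs" for k
    unfolding pos_def using inj that by (simp add: inv_into_f_f)
  define h where "h = (\<lambda>x. if x \<in> set xs then xs ! (s ! pos x) else x)"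
  have hk: "h (xs ! k) = xs ! (s ! k)" if "k < length xs" for k using that pos by (simp add: h_def)
  have s: "length s = length xs" "distinct s" "set s = {..<length xs}"
    using assms(2) labelling_surj[OF assms(2)] by (auto simp: labelling_def)
  have "set xs \<subseteq> h ` set xs"
  proof
    fix x assume "x \<in> set xs"
    then obtain m where m: "m < length xs" "x = xs ! m" by (metis in_set_conv_nth)
    then have "m \<in> set s" using s by simp
    then obtain k where "k < length xs" "s ! k = m" using s by (metis in_set_conv_nth)
    then show "x \<in> h ` set xs" using hk m by (metis imageI nth_mem)
  qed
  moreover have "h ` set xs \<subseteq> set xs"
  proof clarify
    fix x assume "x \<in> set xs"
    then obtain m where m: "m < length xs" "x = xs ! m" by (metis in_set_conv_nth)
    then have "s ! m < length xs" using s by (metis lessThan_iff nth_mem)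
    then show "h x \<in> set xs" using hk m by simp
  qed
  ultimately have im: "h ` set xs = set xs" by blast
  then have "inj_on h (set xs)" by (simp add: eq_card_imp_inj_on)
  then have "h permutes set xs" using im by (intro bij_imp_permutes) (auto simp: bij_betw_def h_def)
  then show ?thesis using hk unfolding realises_def by blast
qed

lemma labelling_swap:
  assumes "labelling p s" "i < p" "j < p"
  shows "labelling p (s[i := s ! j, j := s ! i])"
  using assms by (simp add: labelling_def distinct_swap set_swap)

lemma realises_swap:
  assumes "realises xs s h" "distinct xs" "length s = length xs" "i < length xs" "j < length xs" "i \<noteq> j"
  shows "realises xs (s[i := s ! j, j := s ! i]) (h \<circ> transpose (xs ! i) (xs ! j))"
proof -
  have "transpose (xs ! i) (xs ! j) permutes set xs" using assms by (simp add: permutes_swap_id)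
  moreover have "h (transpose (xs ! i) (xs ! j) (xs ! k)) = xs ! (s[i := s ! j, j := s ! i] ! k)"
    if "k < length xs" for k
    using assms that unfolding realises_def
    by (auto simp: transpose_def nth_eq_iff_index_eq nth_list_update)
  ultimately show ?thesis using assms(1) unfolding realises_def by (simp add: permutes_compose)
qed

lemma realises_swaps:
  assumes "labelling (length xs) s" "distinct xs" "realises xs s h"
    and "\<forall>(i, j) \<in> set r. i < length xs \<and> j < length xs \<and> i \<noteq> j"
  shows "labelling (length xs) (swaps s r) \<and>
    (\<exists>h'. realises xs (swaps s r) h' \<and> (evenperm h' \<longleftrightarrow> (evenperm h \<longleftrightarrow> even (length r))))"
  using assms
proof (induction r arbitrary: s h)
  case (Cons ij r)
  obtain i j where ij: "ij = (i, j)" by fastforce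
  let ?s = "s[i := s ! j, j := s ! i]" and ?h = "h \<circ> transpose (xs ! i) (xs ! j)"
  have lt: "i < length xs" "j < length xs" "i \<noteq> j" using Cons.prems(4) ij by auto
  have r: "realises xs ?s ?h"
    using Cons.prems lt by (intro realises_swap) (auto simp: labelling_def)
  have perm: "permutation h" using Cons.prems(3) by (auto simp: realises_def permutation_permutes)
  have "evenperm ?h \<longleftrightarrow> \<not> evenperm h"
    using lt Cons.prems(2) perm
    by (simp add: evenperm_comp permutation_swap_id evenperm_swap nth_eq_iff_index_eq)
  then show ?case
    using Cons.IH[OF labelling_swap[OF Cons.prems(1) lt(1,2)] Cons.prems(2) r] Cons.prems(4) ij
    by (simp del: comp_apply) blast
qed auto

lemma realises_parity:
  assumes "labelling (length xs) s" "distinct xs" "swaps_ok (length xs) r"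
  shows "\<exists>h s'. s' \<in> {s, swaps s r} \<and> realises xs s' h \<and> labelling (length xs) s' \<and> evenperm h = e"
proof -
  obtain h where h: "realises xs s h" using realises_exists assms by blast
  obtain h' where h': "realises xs (swaps s r) h'" "labelling (length xs) (swaps s r)" "evenperm h' \<noteq> evenperm h"
    using realises_swaps[OF assms(1,2) h, of r] assms(3) unfolding swaps_ok_def by blast
  show ?thesis
    by (cases "evenperm h = e") (use h h' assms(1) in blast)+
qed

text \<open>The complements have equal size, so any bijection between them completes the assignment.
  The parity of \<open>g\<close> is not controlled here.\<close>

lemma list_transport:
  assumes "finite X" "distinct xs" "distinct ys" "length xs = length ys" "set xs \<subseteq> X" "set ys \<subseteq> X"
  shows "\<exists>g. g permutes X \<and> (\<forall>k < length xs. g (ys ! k) = xs ! k)"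
proof -
  define pos where "pos = inv_into {..<length ys} (\<lambda>i. ys ! i)"
  have inj: "inj_on (\<lambda>i. ys ! i) {..<length ys}" using assms(3) by (auto simp: inj_on_def nth_eq_iff_index_eq)
  have pos: "pos (ys ! k) = k" if "k < length ys" for k
    unfolding pos_def using inj that by (simp add: inv_into_f_f)
  have "card (X - set ys) = card (X - set xs)"
    using assms by (simp add: card_Diff_subset distinct_card)
  then obtain r where r: "bij_betw r (X - set ys) (X - set xs)"
    using assms(1) finite_same_card_bij[of "X - set ys" "X - set xs"] by auto
  define g where "g = (\<lambda>x. if x \<in> set ys then xs ! pos x else if x \<in> X then r x else x)"
  have gk: "g (ys ! k) = xs ! k" if "k < length ys" for k using that pos by (simp add: g_def)
  have b1: "bij_betw g (set ys) (set xs)"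
  proof (rule bij_betw_imageI)
    show "inj_on g (set ys)"
      by (rule inj_onI) (metis assms(2,4) gk in_set_conv_nth nth_eq_iff_index_eq)
    show "g ` set ys = set xs"

    proof -
      have "map g ys = xs" using gk assms(4) by (intro nth_equalityI) auto
      then show ?thesis by (metis set_map)
    qed
  qed
  have b2: "bij_betw g (X - set ys) (X - set xs)"
    using r by (rule bij_betw_cong[THEN iffD1, rotated]) (simp add: g_def)
  have "bij_betw g (set ys \<union> (X - set ys)) (set xs \<union> (X - set xs))"
    by (rule bij_betw_combine[OF b1 b2]) auto
  moreover have "set ys \<union> (X - set ys) = X" "set xs \<union> (X - set xs) = X" using assms by auto
  ultimately have "g permutes X" by (intro bij_imp_permutes) (use assms(6) in \<open>auto simp: g_def\<close>)
  then show ?thesis using gk assms(4) by auto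
qed

lemma form_on_twist:
  assumes "form_on X b ls e ys" "g permutes X" "b permutes X" "length xs = length ys" "distinct xs" "set xs \<subseteq> X"
    "\<forall>k < length ys. g (ys ! k) = xs ! k" "ls \<noteq> []" "0 \<notin> set ls"
  shows "form_on X (twist g b) ls e xs"
proof -
  have lt: "i < length ys" "j < length ys" if "(i, j) \<in> set (arcs ls e) \<or> (i, j) \<in> set (exits ls e)" for i j
    using arcs_ok[OF assms(1,3,8,9)] exits_ok[OF assms(1,3,8,9)] that by blast+
  have tw: "twist g b (xs ! i) = g (b (ys ! i))" if "i < length ys" for i
    using twist_apply[OF assms(2), of b "ys ! i"] assms(7) that by simp
  have "twist g b (xs ! i) = xs ! j" if "(i, j) \<in> set (arcs ls e)" for i j
    using lt tw assms(7) arcs_ok[OF assms(1,3,8,9)] that by metis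
  moreover have "twist g b (xs ! i) \<noteq> xs ! j" if "(i, j) \<in> set (exits ls e)" "e = Strict" for i j
  proof -
    have "b (ys ! i) \<noteq> ys ! j" using assms(1) that unfolding form_on_def by blast
    then show ?thesis using lt tw assms(7) that permutes_inj[OF assms(2)] by (metis injD)
  qed
  ultimately show ?thesis using assms unfolding form_on_def by auto
qed

lemma realises_permutes: "realises xs s h \<Longrightarrow> set xs \<subseteq> X \<Longrightarrow> h permutes X"
  unfolding realises_def by (auto intro: permutes_subset)

lemma realises_outside: "realises xs s h \<Longrightarrow> x \<notin> set xs \<Longrightarrow> h x = x"
  unfolding realises_def by (meson permutes_not_in)

text \<open>\<open>Q i\<close> is required for both labellings of entry \<open>i\<close>, as it is
  not known in advance which of them has the right parity. It is a predicate and not a value because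
  it may involve an unknown constant or state only a lower bound.\<close>

definition separates where
  "separates X a b xs vs Q \<longleftrightarrow>
     (\<forall>i < length vs. \<forall>s' h. s' \<in> {fst (vs ! i), swaps (fst (vs ! i)) (snd (vs ! i))} \<longrightarrow>
        labelling (length xs) s' \<longrightarrow> realises xs s' h \<longrightarrow> Q i (profile_at X a b h)) \<and>
     (\<forall>i < length vs. \<forall>j < i. \<forall>w. \<not> (Q i w \<and> Q j w))"

text \<open>Some \<open>g\<close> of unknown parity carries the form of \<open>b\<close> onto the
  points \<open>xs\<close>. Of the two labellings the one whose realisation \<open>h\<close> has the
  parity of \<open>g\<close> is taken, so that \<open>h \<circ> g\<close> is even. The clause on
  fixed points outside the form serves the \<open>Stretched\<close> patterns.\<close>

lemma labelling_attained:
  assumes X: "finite X" "a permutes X" "b permutes X"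
    and ys: "form_on X b ms f ys" "ms \<noteq> []" "0 \<notin> set ms"
    and xs: "distinct xs" "set xs \<subseteq> X" "length xs = sum_list ms"
  obtains b' where "b' permutes X" "form_on X b' ms f xs"
    "(\<forall>x \<in> X - set ys. b x = x) \<Longrightarrow> (\<forall>x \<in> X - set xs. b' x = x)"
    "\<And>s r. labelling (length xs) s \<Longrightarrow> swaps_ok (length xs) r \<Longrightarrow>
       \<exists>g h s'. g permutes X \<and> evenperm g \<and> s' \<in> {s, swaps s r} \<and> labelling (length xs) s' \<and>
         realises xs s' h \<and> profile_at X a b g = profile_at X a b' h"
proof -
  have l: "length xs = length ys" "distinct ys" "set ys \<subseteq> X" using ys(1) xs(3) by (auto simp: form_on_def)
  obtain g where g: "g permutes X" "\<forall>k < length xs. g (ys ! k) = xs ! k"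
    using list_transport[OF X(1) xs(1) l(2) l(1) xs(2) l(3)] by blast
  have permg: "permutation g" using g(1) X(1) by (auto simp: permutation_permutes)
  let ?b = "twist g b"
  have fixed: "\<forall>x \<in> X - set xs. ?b x = x" if h: "\<forall>x \<in> X - set ys. b x = x"
  proof
    fix x assume x: "x \<in> X - set xs"
    define y where "y = inv' g x"
    have gy: "g y = x" "y \<in> X" using g(1) x by (auto simp: y_def permutes_inverses permutes_in_image permutes_inv)
    then have "y \<notin> set ys" using x g(2) l(1) by (metis Diff_iff in_set_conv_nth nth_mem)
    then show "?b x = x" using h gy twist_apply[OF g(1), of b y] by simp
  qed
  have gk: "\<forall>k < length ys. g (ys ! k) = xs ! k" using g(2) l(1) by simp
  have att: "\<exists>g' h s'. g' permutes X \<and> evenperm g' \<and> s' \<in> {s, swaps s r} \<and> labelling (length xs) s' \<and>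
         realises xs s' h \<and> profile_at X a b g' = profile_at X a ?b h"
    if "labelling (length xs) s" "swaps_ok (length xs) r" for s r
  proof -
    from realises_parity[OF that(1) xs(1) that(2), of "evenperm g"]
    obtain h s' where h: "s' \<in> {s, swaps s r}" "realises xs s' h"
      "labelling (length xs) s'" "evenperm h = evenperm g" by blast
    have hX: "h permutes X" using realises_permutes[OF h(2) xs(2)] .
    have "permutation h" using hX X(1) by (auto simp: permutation_permutes)
    then have "evenperm (h \<circ> g)" using h(4) permg by (simp add: evenperm_comp)
    moreover have "profile_at X a b (h \<circ> g) = profile_at X a ?b h"
      by (simp add: profile_at_def twist_comp[OF g(1) hX])
    ultimately show ?thesis using h(1-3) permutes_compose[OF g(1) hX] by blast
  qed
  show ?thesis
    by (rule that[OF twist_permutes[OF g(1) X(3)] form_on_twist[OF ys(1) g(1) X(3) l(1) xs(1,2) gk ys(2,3)] fixed att])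
qed

lemma many_by_labellings:
  assumes X: "finite X" "a permutes X" "b permutes X"
    and ys: "form_on X b ms f ys" "ms \<noteq> []" "0 \<notin> set ms"
    and xs: "distinct xs" "set xs \<subseteq> X" "length xs = sum_list ms"
    and vs: "\<forall>(s, r) \<in> set vs. labelling (length xs) s \<and> swaps_ok (length xs) r"
    and step: "\<And>b'. b' permutes X \<Longrightarrow> form_on X b' ms f xs \<Longrightarrow>
       ((\<forall>x \<in> X - set ys. b x = x) \<Longrightarrow> (\<forall>x \<in> X - set xs. b' x = x)) \<Longrightarrow>
       \<exists>Q. separates X a b' xs vs Q"
  shows "many (length vs) X a b"
proof -
  obtain b' where b': "b' permutes X" "form_on X b' ms f xs"
    "(\<forall>x \<in> X - set ys. b x = x) \<Longrightarrow> (\<forall>x \<in> X - set xs. b' x = x)"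
    "\<And>s r. labelling (length xs) s \<Longrightarrow> swaps_ok (length xs) r \<Longrightarrow>
       \<exists>g h s'. g permutes X \<and> evenperm g \<and> s' \<in> {s, swaps s r} \<and> labelling (length xs) s' \<and>
         realises xs s' h \<and> profile_at X a b g = profile_at X a b' h"
    by (rule labelling_attained[OF X ys xs]) blast
  obtain Q where "separates X a b' xs vs Q" using step[OF b'(1-3)] by blast
  then have Q: "\<And>i s' h. i < length vs \<Longrightarrow> s' \<in> {fst (vs ! i), swaps (fst (vs ! i)) (snd (vs ! i))} \<Longrightarrow>
              labelling (length xs) s' \<Longrightarrow> realises xs s' h \<Longrightarrow> Q i (profile_at X a b' h)"
      "\<And>i j w. i < length vs \<Longrightarrow> j < i \<Longrightarrow> \<not> (Q i w \<and> Q j w)"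
    unfolding separates_def by blast+
  have "\<exists>w g'. Q i w \<and> g' permutes X \<and> evenperm g' \<and> profile_at X a b g' = w" if i: "i < length vs" for i
  proof -
    have "labelling (length xs) (fst (vs ! i))" "swaps_ok (length xs) (snd (vs ! i))"
      using vs i nth_mem[OF i] by (auto simp: case_prod_beta)
    from b'(4)[OF this] show ?thesis using Q(1)[OF i] by metis
  qed
  then obtain w where w: "\<And>i. i < length vs \<Longrightarrow> Q i (w i) \<and> (\<exists>g'. g' permutes X \<and> evenperm g' \<and> profile_at X a b g' = w i)"
    by metis
  show ?thesis
  proof (rule manyI[where ws = "map w [0..<length vs]"])
    show "distinct (map w [0..<length vs])"
      unfolding distinct_map by (auto simp: inj_on_def) (metis Q(2) nat_neq_iff w)
  qed (use w X(1) in auto)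
qed

subsection \<open>Counting agreements\<close>

definition agreement :: "nat list \<Rightarrow> ending \<Rightarrow> nat list \<Rightarrow> ending \<Rightarrow> nat list \<Rightarrow> nat" where
  "agreement ls e ms f s = length (filter (\<lambda>z. z \<in> set (arcs ls e)) (relabel s (arcs ms f)))"

text \<open>Each condition excludes an agreement that hangs on an unknown image. Two exits with a
  common start might lead to the same outside point, and two with a common end might be reached from
  the same outside point. An \<open>Open\<close> block might in fact close, along an arc of the
  other permutation; a \<open>Strict\<close> block cannot, so it adds nothing to
  \<open>doubtful\<close>.\<close>

definition robust :: "nat list \<Rightarrow> ending \<Rightarrow> nat list \<Rightarrow> ending \<Rightarrow> nat list \<Rightarrow> bool" where
  "robust ls e ms f s \<longleftrightarrow>
     (\<forall>z \<in> set (exits ls e). \<forall>z' \<in> set (relabel s (exits ms f)). fst z \<noteq> fst z' \<and> snd z \<noteq> snd z') \<and>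
     (\<forall>z \<in> set (relabel s (arcs ms f)). z \<notin> set (doubtful ls e)) \<and>
     (\<forall>z \<in> set (relabel s (doubtful ms f)). z \<notin> set (arcs ls e))"

lemma relabel_mem: "(i, j) \<in> set E \<Longrightarrow> (s ! i, s ! j) \<in> set (relabel s E)"
  by (force simp: relabel_def)

text \<open>The set \<open>B\<close> depends neither on \<open>s\<close> nor on \<open>h\<close>.
  The points outside the form therefore contribute a constant, and the counts for two robust
  labellings differ exactly as their agreements do.\<close>

lemma agreement_count:
  assumes X: "finite X" "a permutes X" "b permutes X"
    and a: "form_on X a ls e xs" "ls \<noteq> []" "0 \<notin> set ls"
    and b: "form_on X b ms f xs" "ms \<noteq> []" "0 \<notin> set ms"
    and h: "realises xs s h" "labelling (length xs) s"
  defines "A \<equiv> {x \<in> X. h (b x) = a (h x)}"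
    and "B \<equiv> {x \<in> X - set xs. b x \<notin> set xs \<and> b x = a x}"
  shows "agreement ls e ms f s + card B \<le> card A"
    and "robust ls e ms f s \<Longrightarrow> card A = agreement ls e ms f s + card B"
proof -
  let ?p = "length xs"
  note fa = form_on_facts[OF a(1) X(2) a(2,3)]
  note fb = form_on_facts[OF b(1) X(3) b(2,3)]
  have xs: "distinct xs" "set xs \<subseteq> X" using a(1) by (auto simp: form_on_def)
  have sl: "s ! k < ?p" if "k < ?p" for k using h(2) that by (auto simp: labelling_def)
  have hk: "h (xs ! k) = xs ! (s ! k)" if "k < ?p" for k using h(1) that by (auto simp: realises_def)
  have nth_eq: "xs ! i = xs ! j \<longleftrightarrow> i = j" if "i < ?p" "j < ?p" for i j using that xs by (simp add: nth_eq_iff_index_eq)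
  have hout: "h x = x" if "x \<notin> set xs" for x using realises_outside[OF h(1) that] .
  have hX: "h permutes set xs" using h(1) by (simp add: realises_def)
  have hin: "h x \<in> set xs \<longleftrightarrow> x \<in> set xs" for x using permutes_in_image[OF hX] .
  let ?K = "filter (\<lambda>z. (s ! fst z, s ! snd z) \<in> set (arcs ls e)) (arcs ms f)"
  define C where "C = (\<lambda>z. xs ! fst z) ` set ?K"
  have "distinct (map fst ?K)" using fb(9) by (rule distinct_map_filter)
  then have K: "inj_on fst (set ?K)" "distinct ?K" by (simp_all only: distinct_map)
  have Klt: "fst z < ?p" if "z \<in> set ?K" for z
    using fb(1)[of "fst z" "snd z"] that by simp
  have inj: "inj_on (\<lambda>z. xs ! fst z) (set ?K)"
  proof (rule inj_onI)
    fix z w assume zw: "z \<in> set ?K" "w \<in> set ?K" "xs ! fst z = xs ! fst w"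
    then have "fst z = fst w" using nth_eq[OF Klt[OF zw(1)] Klt[OF zw(2)]] by simp
    then show "z = w" using inj_onD[OF K(1)] zw(1,2) by blast
  qed
  have cC: "card C = length ?K"
    unfolding C_def card_image[OF inj] by (rule distinct_card[OF K(2)])
  have "agreement ls e ms f s = length ?K"
    by (simp add: agreement_def relabel_def filter_map case_prod_beta comp_def)
  then have agr: "agreement ls e ms f s = card C" using cC by simp
  have Csub: "C \<subseteq> set xs" 
  proof
    fix x assume "x \<in> C"
    then obtain k k' where "(k, k') \<in> set (arcs ms f)" "x = xs ! k" by (auto simp: C_def)
    then show "x \<in> set xs" using fb(1) by simp
  qed
  have fin: "finite B" "finite C" "finite A" using X(1) by (auto simp: A_def B_def C_def)
  have disj: "B \<inter> C = {}" using Csub by (auto simp: B_def)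
  have sub: "B \<union> C \<subseteq> A"
  proof -
    have "x \<in> A" if "x \<in> B" for x using that hout by (auto simp: A_def B_def)
    moreover have "x \<in> A" if "x \<in> C" for x
    proof -
      obtain z where z: "z \<in> set ?K" "x = xs ! fst z" using \<open>x \<in> C\<close> unfolding C_def by blast
      define k k' where "k = fst z" "k' = snd z"
      then have k: "(k, k') \<in> set (arcs ms f)" "(s ! k, s ! k') \<in> set (arcs ls e)" "x = xs ! k"
        using z by auto
      have "h (b x) = xs ! (s ! k')" using fb(1)[OF k(1)] hk k(3) by simp
      moreover have "a (h x) = xs ! (s ! k')" using fb(1)[OF k(1)] hk k(3) fa(1)[OF k(2)] by simp
      ultimately show ?thesis using fb(1)[OF k(1)] k(3) xs(2) by (auto simp: A_def)
    qed
    ultimately show ?thesis by blast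
  qed
  have "card (B \<union> C) = agreement ls e ms f s + card B"
    using agr disj fin by (simp add: card_Un_disjoint)
  then show "agreement ls e ms f s + card B \<le> card A" using card_mono[OF fin(3) sub] by simp
  assume r: "robust ls e ms f s"
  have "A \<subseteq> B \<union> C"
  proof
    fix x assume x: "x \<in> A"
    show "x \<in> B \<union> C"
    proof (cases "x \<in> set xs")
      case True
      then obtain k where k: "k < ?p" "x = xs ! k" by (metis in_set_conv_nth)
      have eq: "h (b (xs ! k)) = a (xs ! (s ! k))" using x k hk by (simp add: A_def)
      consider k' where "(k, k') \<in> set (arcs ms f)" | k' where "(k, k') \<in> set (exits ms f)"
        using fb(3)[OF k(1)] by blast
      then show ?thesis
      proof cases
        case (1 k')
        have lt: "k' < ?p" "s ! k' < ?p" using fb(1)[OF 1] sl by auto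
        have e1: "a (xs ! (s ! k)) = xs ! (s ! k')" using eq fb(1)[OF 1] hk by simp
        have "(s ! k, s ! k') \<in> set (arcs ls e)"
        proof (rule ccontr)
          assume no: "(s ! k, s ! k') \<notin> set (arcs ls e)"
          obtain m where "(s ! k, m) \<in> set (arcs ls e) \<or> (s ! k, m) \<in> set (exits ls e)"
            using fa(3)[OF sl[OF k(1)]] by blast
          then show False
          proof
            assume m: "(s ! k, m) \<in> set (arcs ls e)"
            then have "m = s ! k'" using e1 fa(1)[OF m] nth_eq lt by metis
            then show False using m no by simp
          next
            assume m: "(s ! k, m) \<in> set (exits ls e)"
            have "a (xs ! (s ! k)) \<in> set xs" using e1 lt by simp
            then have "m = s ! k'" "(s ! k, m) \<in> set (doubtful ls e)"
              using fa(2)[OF m] e1 nth_eq lt by metis+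
            then show False using r relabel_mem[OF 1, of s] by (simp add: robust_def)
          qed
        qed
        then show ?thesis using 1 k(2) by (force simp: C_def)
      next
        \<comment> \<open>At the end of an unfinished block of \<open>b\<close>: by robustness
          \<open>a\<close> does not leave the form at the same place, so an agreement would force
          the block of \<open>b\<close> to close onto an arc of \<open>a\<close>.\<close>
        case (2 k')
        have "\<nexists>m. (s ! k, m) \<in> set (exits ls e)"
          using r relabel_mem[OF 2, of s] unfolding robust_def by fastforce
        then obtain m where m: "(s ! k, m) \<in> set (arcs ls e)" using fa(3)[OF sl[OF k(1)]] by blast
        have "h (b (xs ! k)) \<in> set xs" using eq fa(1)[OF m] by simp
        then have bk: "b (xs ! k) = xs ! k'" "(k, k') \<in> set (doubtful ms f)" using fb(2)[OF 2] hin by auto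
        then have "m = s ! k'" using eq hk fa(1)[OF m] fb(2)[OF 2] nth_eq sl by metis
        then show ?thesis using m r relabel_mem[OF bk(2), of s] by (simp add: robust_def)
      qed
    next
      case False
      have xX: "x \<in> X" using x by (simp add: A_def)
      have eq: "h (b x) = a x" using x hout[OF False] by (simp add: A_def)
      \<comment> \<open>If \<open>b\<close> led from outside into the form, so would
        \<open>a\<close>, and \<open>h\<close> would match the two entry points. These are ends of
        exits, which robustness keeps apart.\<close>
      have "b x \<notin> set xs"
      proof
        assume bx: "b x \<in> set xs"
        obtain i k' where k': "(i, k') \<in> set (exits ms f)" "b x = xs ! k'" using fb(5)[OF False bx] by blast
        have "a x \<in> set xs" using bx eq hin by metis
        then obtain j m where m: "(j, m) \<in> set (exits ls e)" "a x = xs ! m" using fa(5)[OF False] by blast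
        have "m = s ! k'" using eq k' m hk fb(2)[OF k'(1)] fa(2)[OF m(1)] nth_eq sl by metis
        then show False using r m(1) relabel_mem[OF k'(1), of s] unfolding robust_def by fastforce
      qed
      then show ?thesis using False xX eq hout by (simp add: B_def)
    qed
  qed
  then have "A = B \<union> C" using sub by blast
  then show "card A = agreement ls e ms f s + card B"
    using \<open>card (B \<union> C) = agreement ls e ms f s + card B\<close> by simp
qed

lemma fst_profile_at:
  assumes "a permutes X" "h permutes X"
  shows "fst (profile_at X a b h) = card {x \<in> X. h (b x) = a (h x)}"
proof -
  have "(inv' a \<circ> twist h b) x = x \<longleftrightarrow> h (b (inv' h x)) = a (h (inv' h x))" for x
    using assms by (simp add: twist_def) (metis permutes_inverses)
  then show ?thesis
    using card_permuted_Collect[OF assms(2), of "\<lambda>x. h (b x) = a (h x)"]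
    by (simp add: profile_at_def fix_profile_def)
qed

text \<open>The agreements increase along the list, so for the last entry a lower bound is enough to
  separate it from the others. That entry is exempt from robustness, and its swapped labelling may
  even agree more often.\<close>

definition pattern_ok :: "nat list \<Rightarrow> ending \<Rightarrow> nat list \<Rightarrow> ending \<Rightarrow> (nat list \<times> (nat \<times> nat) list) list \<Rightarrow> bool" where
  "pattern_ok ls e ms f vs \<longleftrightarrow> sum_list ls = sum_list ms \<and> ls \<noteq> [] \<and> ms \<noteq> [] \<and> 0 \<notin> set ls \<and> 0 \<notin> set ms \<and>
     sorted_wrt (<) (map (\<lambda>v. agreement ls e ms f (fst v)) vs) \<and>
     (\<forall>v \<in> set vs. labelling (sum_list ls) (fst v) \<and> swaps_ok (sum_list ls) (snd v)) \<and>
     (\<forall>v \<in> set (butlast vs). robust ls e ms f (fst v) \<and> robust ls e ms f (swaps (fst v) (snd v)) \<and>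
        agreement ls e ms f (swaps (fst v) (snd v)) = agreement ls e ms f (fst v)) \<and>
     (vs \<noteq> [] \<longrightarrow> agreement ls e ms f (fst (last vs)) \<le> agreement ls e ms f (swaps (fst (last vs)) (snd (last vs))))"

theorem many_by_pattern:
  assumes X: "finite X" "a permutes X" "b permutes X"
    and forms: "has_form X a ls e" "has_form X b ms f"
    and ok: "pattern_ok ls e ms f vs"
  shows "many (length vs) X a b"
proof -
  obtain xs where xs: "form_on X a ls e xs" using forms(1) by (auto simp: has_form_def)
  obtain ys where ys: "form_on X b ms f ys" using forms(2) by (auto simp: has_form_def)
  note ok = ok[unfolded pattern_ok_def]
  have l: "length xs = sum_list ls" "distinct xs" "set xs \<subseteq> X" using xs by (auto simp: form_on_def)
  have lm: "ls \<noteq> []" "0 \<notin> set ls" "ms \<noteq> []" "0 \<notin> set ms" using ok by auto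
  let ?v = "\<lambda>i. agreement ls e ms f (fst (vs ! i))"
  have inc: "?v j < ?v i" if "i < length vs" "j < i" for i j
    using ok that sorted_wrt_nth_less[of "(<)" "map (\<lambda>v. agreement ls e ms f (fst v)) vs" j i] by simp
  show ?thesis
  proof (rule many_by_labellings[OF X ys _ _ l(2,3)])
    fix b' assume b': "b' permutes X" "form_on X b' ms f xs"
    define c where "c = card {x \<in> X - set xs. b' x \<notin> set xs \<and> b' x = a x}"
    \<comment> \<open>Exact values for all entries but the last, a lower bound for the last;
      \<open>c\<close> is the unknown contribution of the points outside.\<close>
    define Q where "Q = (\<lambda>i (w :: nat \<times> nat \<times> nat). if Suc i < length vs then fst w = ?v i + c else ?v i + c \<le> fst w)"
    have "Q i (profile_at X a b' h)" if i: "i < length vs"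
      and s': "s' \<in> {fst (vs ! i), swaps (fst (vs ! i)) (snd (vs ! i))}"
      and h: "labelling (length xs) s'" "realises xs s' h" for i s' h
    proof -
      have cnt: "fst (profile_at X a b' h) = card {x \<in> X. h (b' x) = a (h x)}"
        by (rule fst_profile_at[OF X(2) realises_permutes[OF h(2) l(3)]])
      note ac = agreement_count[OF X(1,2) b'(1) xs lm(1,2) b'(2) lm(3,4) h(2,1), folded c_def]
      show ?thesis
      proof (cases "Suc i < length vs")
        case True
        then have "vs ! i \<in> set (butlast vs)" 
            using nth_mem[of i "butlast vs"] by (simp add: nth_butlast)
        then have "robust ls e ms f s'" "agreement ls e ms f s' = ?v i" using ok s' by auto
        then show ?thesis using True cnt ac(2) by (simp add: Q_def)
      next
        case False
        then have "i = length vs - 1" "vs \<noteq> []" using i by auto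
        then have "vs ! i = last vs" "vs \<noteq> []" by (simp_all add: last_conv_nth)
        then have "?v i \<le> agreement ls e ms f s'" using ok s' by auto
        then show ?thesis using False cnt ac(1) by (simp add: Q_def)
      qed
    qed
    moreover have "\<not> (Q i w \<and> Q j w)" if "i < length vs" "j < i" for i j w
      using inc[OF that] that by (auto simp: Q_def split: if_splits)
    ultimately have "separates X a b' xs vs Q" unfolding separates_def by blast
    then show "\<exists>Q. separates X a b' xs vs Q" by (rule exI[of _ Q])
  qed (use ok l in auto)
qed

subsection \<open>Computing the product on the labels\<close>

text \<open>The label \<open>sum_list ls\<close> stands for all points outside the form.\<close>

definition gamma :: "nat list \<Rightarrow> ending \<Rightarrow> nat list \<Rightarrow> nat list \<Rightarrow> nat list" where
  "gamma ls e ms s = (let m = map_of (relabel s (arcs ms Closed)); m' = map_of (map prod.swap (arcs ls e)) in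
     map (\<lambda>i. case m' (the (m i)) of Some k \<Rightarrow> k | None \<Rightarrow> sum_list ls) [0..<sum_list ls] @ [sum_list ls])"

definition label_profile :: "nat \<Rightarrow> nat list \<Rightarrow> nat \<times> nat \<times> nat" where
  "label_profile p g = (length (filter (\<lambda>i. g ! i = i) [0..<p]),
     length (filter (\<lambda>i. g ! (g ! i) = i) [0..<p]), length (filter (\<lambda>i. g ! (g ! (g ! i)) = i) [0..<p]))"

lemma card_image_labels:
  assumes "distinct xs" and "\<And>i. i < length xs \<Longrightarrow> R (xs ! i) \<longleftrightarrow> Q i"
  shows "card {x \<in> set xs. R x} = length (filter Q [0..<length xs])"
proof -
  have "{x \<in> set xs. R x} = (\<lambda>i. xs ! i) ` set (filter Q [0..<length xs])"
    using assms(2) by (auto simp: in_set_conv_nth image_iff)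
  moreover have "inj_on (\<lambda>i. xs ! i) (set (filter Q [0..<length xs]))"
    using assms(1) by (auto simp: inj_on_def nth_eq_iff_index_eq)
  ultimately have "card {x \<in> set xs. R x} = card (set (filter Q [0..<length xs]))"
    by (simp only: card_image)
  then show ?thesis using distinct_card[of "filter Q [0..<length xs]"] by simp
qed

lemma card_split:
  assumes "finite X" "P \<subseteq> X"
  shows "card {x \<in> X. R x} = card {x \<in> P. R x} + card {x \<in> X - P. R x}"
proof -
  have "{x \<in> X. R x} = {x \<in> P. R x} \<union> {x \<in> X - P. R x}" using assms(2) by blast
  moreover have "finite {x \<in> P. R x}" "finite {x \<in> X - P. R x}" using assms by (auto intro: finite_subset)
  ultimately show ?thesis by (simp add: card_Un_disjoint disjoint_iff)
qed

section \<open>Profiles of a product up to a constant from outside the form\<close>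

context
  fixes X :: "'a set" and a b :: "'a \<Rightarrow> 'a" and xs ls ms s h e
  assumes X: "finite X" "a permutes X" "b permutes X"
    and fa: "form_on X a ls e xs" "ls \<noteq> []" "0 \<notin> set ls"
    and fb: "form_on X b ms Closed xs" "ms \<noteq> []" "0 \<notin> set ms"
    and h: "realises xs s h" "labelling (length xs) s"
begin

private lemmas A = form_on_facts[OF fa(1) X(2) fa(2,3)]
private lemmas B = form_on_facts[OF fb(1) X(3) fb(2,3)]

private lemma xs: "distinct xs" "set xs \<subseteq> X" "length xs = sum_list ls" "length (gamma ls e ms s) = Suc (length xs)"
  using fa(1) by (auto simp: form_on_def gamma_def Let_def)

private lemma nth_eq: "i < length xs \<Longrightarrow> j < length xs \<Longrightarrow> xs ! i = xs ! j \<longleftrightarrow> i = j"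
  using xs(1) by (simp add: nth_eq_iff_index_eq)

private lemma hX: "h permutes set xs" "h permutes X"
  using h(1) realises_permutes[OF h(1) xs(2)] by (auto simp: realises_def)

private lemma no_exits: "exits ms Closed = []"
  by (simp add: exits_def)

private lemma twist_label:
  assumes "i < length xs"
  obtains j where "j < length xs" "the (map_of (relabel s (arcs ms Closed)) i) = j" "twist h b (xs ! i) = xs ! j"
    "(i, j) \<in> set (relabel s (arcs ms Closed))"
proof -
  have "i \<in> set s" using labelling_surj[OF h(2)] assms by simp
  then obtain k where k: "k < length xs" "s ! k = i" using h(2) by (metis in_set_conv_nth labelling_def)
  obtain k' where k': "(k, k') \<in> set (arcs ms Closed)" using B(3)[OF k(1)] no_exits by auto
  have "(i, s ! k') \<in> set (relabel s (arcs ms Closed))" using relabel_mem[OF k', of s] k(2) by simp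
  then obtain j where j: "map_of (relabel s (arcs ms Closed)) i = Some j"
    by (meson map_of_eq_None_iff not_None_eq weak_map_of_SomeI)
  then have mem: "(i, j) \<in> set (relabel s (arcs ms Closed))" by (rule map_of_SomeD)
  then obtain l l' where l: "(l, l') \<in> set (arcs ms Closed)" "s ! l = i" "s ! l' = j" by (auto simp: relabel_def)
  have lt: "l < length xs" "l' < length xs" "b (xs ! l) = xs ! l'" using B(1)[OF l(1)] by auto
  have "h (xs ! l) = xs ! i" "h (xs ! l') = xs ! j" using h(1) lt l by (auto simp: realises_def)
  then have "twist h b (xs ! i) = xs ! j" using twist_apply[OF hX(2), of b "xs ! l"] lt by simp
  moreover have "j < length xs" using h(2) l(3) lt(2) by (auto simp: labelling_def)
  ultimately show ?thesis using that j mem by simp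
qed

private lemma inv_a: "inv' a y = x \<longleftrightarrow> y = a x"
  using X(2) by (metis permutes_inverses)

text \<open>The second alternative is a point that \<open>twist h b\<close> sends to the start of
  the unfinished block of \<open>a\<close>, where the preimage under \<open>a\<close> is not in the
  list of known arcs.\<close>

private lemma gamma_label:
  assumes "i < length xs"
  shows "gamma ls e ms s ! i < length xs \<and> inv' a (twist h b (xs ! i)) = xs ! (gamma ls e ms s ! i) \<or>
    gamma ls e ms s ! i = length xs \<and> (\<exists>k j. (k, j) \<in> set (exits ls e) \<and> twist h b (xs ! i) = xs ! j)"
proof -
  obtain j where j: "j < length xs" "the (map_of (relabel s (arcs ms Closed)) i) = j" "twist h b (xs ! i) = xs ! j"
    using twist_label[OF assms] by metis
  let ?m = "map_of (map prod.swap (arcs ls e)) j"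
  have g: "gamma ls e ms s ! i = (case ?m of Some k \<Rightarrow> k | None \<Rightarrow> length xs)"
    using assms j(2) xs(3) by (simp add: gamma_def Let_def nth_append cong: option.case_cong)
  show ?thesis
  proof (cases ?m)
    case None
    have "(k, j) \<notin> set (arcs ls e)" for k
    proof
      assume "(k, j) \<in> set (arcs ls e)"
      then have "(j, k) \<in> set (map prod.swap (arcs ls e))" by force
      then show False using None by (metis map_of_eq_None_iff image_eqI fst_conv)
    qed
    then obtain k where "(k, j) \<in> set (exits ls e)" using A(4)[OF j(1)] by blast
    then show ?thesis using None g j by auto
  next
    case (Some k)
    then have "(j, k) \<in> set (map prod.swap (arcs ls e))" by (rule map_of_SomeD)
    then have "(k, j) \<in> set (arcs ls e)" by auto
    then have "k < length xs" "a (xs ! k) = xs ! j" using A(1) by auto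
    then show ?thesis using Some g j(3) inv_a[of "xs ! j" "xs ! k"] by simp
  qed
qed

private lemma b_closed: "x \<notin> set xs \<Longrightarrow> b x \<notin> set xs"
  using B(5)[of x] no_exits by auto

private lemma twist_outside: "x \<notin> set xs \<Longrightarrow> twist h b x = b x"
  using twist_apply[OF hX(2), of b x] realises_outside[OF h(1)] b_closed by metis

text \<open>With complete cycles on both sides the product preserves the points of the form, and
  outside it is \<open>inv' a \<circ> b\<close> whatever \<open>h\<close> is. All three counts split
  into a part read off the labels and a constant.\<close>

lemma exact_profile:
  assumes "e = Closed"
  defines "d \<equiv> inv' a \<circ> b"
  defines "c \<equiv> (card {x \<in> X - set xs. d x = x}, card {x \<in> X - set xs. d (d x) = x}, card {x \<in> X - set xs. d (d (d x)) = x})"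
  defines "t \<equiv> label_profile (length xs) (gamma ls e ms s)"
  shows "profile_at X a b h = (fst t + fst c, fst (snd t) + fst (snd c), snd (snd t) + snd (snd c))"
proof -
  let ?f = "inv' a \<circ> twist h b" and ?g = "gamma ls e ms s"
  have ex: "exits ls e = []" using assms(1) by (simp add: exits_def)
  have lab: "?g ! i < length xs" "?f (xs ! i) = xs ! (?g ! i)" if "i < length xs" for i
    using gamma_label[OF that] ex by auto
  have out: "?f x = d x" "d x \<notin> set xs" if "x \<notin> set xs" for x
  proof -
    show "?f x = d x" using twist_outside[OF that] by (simp add: d_def)
    show "d x \<notin> set xs"
    proof
      assume "d x \<in> set xs"
      then obtain k where k: "k < length xs" "d x = xs ! k" by (metis in_set_conv_nth)
      then have "b x = a (xs ! k)" using inv_a by (simp add: d_def)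
      moreover obtain j where "(k, j) \<in> set (arcs ls e)" using A(3)[OF k(1)] ex by auto
      ultimately show False using A(1) b_closed[OF that] by auto
    qed
  qed
  have 1: "card {x \<in> X. ?f x = x} = fst t + fst c"
    using card_split[OF X(1) xs(2), of "\<lambda>x. ?f x = x"] out
      card_image_labels[OF xs(1), of "\<lambda>x. ?f x = x" "\<lambda>i. ?g ! i = i"] lab nth_eq
    by (simp add: t_def label_profile_def c_def del: comp_apply cong: conj_cong)
  have 2: "card {x \<in> X. ?f (?f x) = x} = fst (snd t) + fst (snd c)"
    using card_split[OF X(1) xs(2), of "\<lambda>x. ?f (?f x) = x"] out
      card_image_labels[OF xs(1), of "\<lambda>x. ?f (?f x) = x" "\<lambda>i. ?g ! (?g ! i) = i"] lab nth_eq
    by (simp add: t_def label_profile_def c_def del: comp_apply cong: conj_cong)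
  have 3: "card {x \<in> X. ?f (?f (?f x)) = x} = snd (snd t) + snd (snd c)"
    using card_split[OF X(1) xs(2), of "\<lambda>x. ?f (?f (?f x)) = x"] out
      card_image_labels[OF xs(1), of "\<lambda>x. ?f (?f (?f x)) = x" "\<lambda>i. ?g ! (?g ! (?g ! i)) = i"] lab nth_eq
    by (simp add: t_def label_profile_def c_def del: comp_apply cong: conj_cong)
  show ?thesis using 1 2 3 by (simp only: profile_at_def fix_profile_def)
qed

text \<open>The rearranged \<open>b\<close> fixes the start of the unfinished block of
  \<open>a\<close>. So exactly one point of the form leaves it under the product, and a second
  application cannot bring that point back to itself. A third one might, depending on the unknown
  rest of the cycle, hence only two of the three counts are controlled.\<close>

lemma strict_profile:
  assumes e: "e = Strict" and fix_out: "\<forall>x \<in> X - set xs. b x = x"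
    and ex: "\<forall>z \<in> set (exits ls e). fst z \<noteq> snd z \<and> (snd z, snd z) \<in> set (relabel s (arcs ms Closed))"
  defines "c1 \<equiv> card {x \<in> X - set xs. inv' a x = x}"
    and "c2 \<equiv> card {x \<in> X - set xs. inv' a x \<notin> set xs \<and> inv' a (inv' a x) = x}"
  defines "t \<equiv> label_profile (length xs) (gamma ls e ms s)"
  shows "fst (profile_at X a b h) = fst t + c1" "fst (snd (profile_at X a b h)) = fst (snd t) + c2"
proof -
  let ?t = "twist h b" and ?g = "gamma ls e ms s"
  let ?f = "inv' a \<circ> ?t"
  obtain q r where qr: "set (exits ls e) = {(q, r)}" by (cases "last (block_arcs 0 ls)") (simp add: exits_def e)
  have qr': "(q, r) \<in> set (exits ls e)" "q \<noteq> r" "(r, r) \<in> set (relabel s (arcs ms Closed))" "r < length xs" "q < length xs"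
    using ex A(2)[of q r] by (auto simp: qr)
  have gp: "?g ! (length xs) = length xs" using xs(3) by (simp add: gamma_def Let_def nth_append)
  have tr: "?t (xs ! r) = xs ! r"
  proof -
    obtain l l' where l: "(l, l') \<in> set (arcs ms Closed)" "s ! l = r" "s ! l' = r"
      using qr'(3) by (auto simp: relabel_def)
    have lt: "l < length xs" "l' < length xs" "b (xs ! l) = xs ! l'" using B(1)[OF l(1)] by auto
    have "h (xs ! l) = xs ! r" "h (xs ! l') = xs ! r" using h(1) lt l by (auto simp: realises_def)
    then show ?thesis using twist_apply[OF hX(2), of b "xs ! l"] lt by simp
  qed
  have tinj: "inj ?t" using twist_permutes[OF hX(2) X(3)] by (rule permutes_inj)
  \<comment> \<open>The predecessor of the start of the block on its cycle of \<open>a\<close>. It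
    lies outside the form because the block is \<open>Strict\<close>.\<close>
  define u where "u = inv' a (xs ! r)"
  have au: "a u = xs ! r" using inv_a[of "xs ! r" u] u_def by simp
  have uX: "u \<in> X" using au X(2) xs(2) qr'(4) by (metis nth_mem permutes_in_image subset_iff)
  have uP: "u \<notin> set xs"
  proof
    assume "u \<in> set xs"
    then obtain i where i: "i < length xs" "u = xs ! i" by (metis in_set_conv_nth)
    from A(3)[OF i(1)] obtain j where "(i, j) \<in> set (arcs ls e) \<or> (i, j) \<in> set (exits ls e)" by blast
    then show False
    proof
      assume j: "(i, j) \<in> set (arcs ls e)"
      then have "j = r" using A(1)[OF j] au i nth_eq qr'(4) by simp
      then show False using j A(8)[OF qr'(1)] by blast
    next
      assume j: "(i, j) \<in> set (exits ls e)"
      show False using A(2)[OF j] au i qr'(4) by (auto simp: doubtful_def e)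
    qed
  qed
  have lab: "?g ! i < length xs \<and> ?f (xs ! i) = xs ! (?g ! i) \<or> ?g ! i = length xs \<and> i = r \<and> ?f (xs ! i) = u" if "i < length xs" for i
  proof -
    have "i = r" if "?t (xs ! i) = xs ! r" using that tr tinj nth_eq[OF \<open>i < length xs\<close> qr'(4)] by (metis injD)
    then show ?thesis using gamma_label[OF that] qr by (auto simp: u_def)
  qed
  have tout: "?t x = x" if "x \<in> X" "x \<notin> set xs" for x using twist_outside[of x] fix_out that by simp
  \<comment> \<open>Otherwise \<open>a\<close> would map the start of the block to the outside point
    \<open>u\<close>, although a known arc begins there since \<open>q \<noteq> r\<close>.\<close>
  have nu: "?f u \<noteq> xs ! r"
  proof
    assume "?f u = xs ! r"
    then have eq: "u = a (xs ! r)" using tout[OF uX uP] inv_a by simp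
    obtain m where "(r, m) \<in> set (arcs ls e)" using A(3)[OF qr'(4)] qr qr'(2) by auto
    then show False using A(1)[of r m] eq uP by auto
  qed
  have in1: "?f (xs ! i) = xs ! i \<longleftrightarrow> ?g ! i = i" if "i < length xs" for i
    using lab[OF that] nth_eq that uP by (metis nat_less_le nth_mem)
  have in2: "?f (?f (xs ! i)) = xs ! i \<longleftrightarrow> ?g ! (?g ! i) = i" if "i < length xs" for i
    using lab[OF that]
  proof
    assume k: "?g ! i < length xs \<and> ?f (xs ! i) = xs ! (?g ! i)"
    show ?thesis using lab[of "?g ! i"] k nth_eq that uP by (metis nat_less_le nth_mem)
  next
    assume k: "?g ! i = length xs \<and> i = r \<and> ?f (xs ! i) = u"
    then have "i = r" "?g ! i = length xs" "?f (xs ! i) = u" by blast+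
    then have "?f (?f (xs ! i)) = ?f u" "?g ! (?g ! i) = length xs" using gp by (simp_all only:)
    then show ?thesis using nu k that by (metis nat_less_le)
  qed
  have out1: "?f x = x \<longleftrightarrow> inv' a x = x" if "x \<in> X" "x \<notin> set xs" for x
    using tout[OF that] by simp
  \<comment> \<open>An outside point whose preimage under \<open>a\<close> lies in the form lands at
    a position other than \<open>r\<close> and then stays in the form. This is the reason for the
    first conjunct in \<open>c2\<close>.\<close>
  have out2: "?f (?f x) = x \<longleftrightarrow> inv' a x \<notin> set xs \<and> inv' a (inv' a x) = x" if x: "x \<in> X" "x \<notin> set xs" for x
  proof (cases "inv' a x \<in> set xs")
    case True
    then obtain i where i: "i < length xs" "inv' a x = xs ! i" by (metis in_set_conv_nth)
    then have ax: "a (xs ! i) = x" using inv_a by metis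
    have "i \<noteq> r"
    proof
      assume "i = r"
      then obtain m where "(i, m) \<in> set (arcs ls e)" using A(3)[OF qr'(4)] qr qr'(2) by auto
      then show False using A(1)[of i m] ax x(2) by auto
    qed
    then have "?f (?f x) \<in> set xs" using lab[OF i(1)] tout[OF x] i by auto
    then show ?thesis using True x by metis
  next
    case False
    have "inv' a x \<in> X" using X(2) x(1) by (simp add: permutes_in_image permutes_inv)
    then show ?thesis using False tout x by simp
  qed
  have "card {x \<in> X. ?f x = x} = fst t + c1"
  proof -
    have "card {x \<in> X - set xs. ?f x = x} = c1" unfolding c1_def
      by (rule arg_cong[of _ _ card]) (use out1 in blast)
    moreover have "card {x \<in> set xs. ?f x = x} = fst t"
      using card_image_labels[OF xs(1), of "\<lambda>x. ?f x = x" "\<lambda>i. ?g ! i = i"] in1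
      by (simp add: t_def label_profile_def del: comp_apply)
    ultimately show ?thesis using card_split[OF X(1) xs(2), of "\<lambda>x. ?f x = x"] by simp
  qed
  then show "fst (profile_at X a b h) = fst t + c1" by (simp add: profile_at_def fix_profile_def)
  have "card {x \<in> X. ?f (?f x) = x} = fst (snd t) + c2"
  proof -
    have "card {x \<in> X - set xs. ?f (?f x) = x} = c2" unfolding c2_def
      by (rule arg_cong[of _ _ card]) (use out2 in blast)
    moreover have "card {x \<in> set xs. ?f (?f x) = x} = fst (snd t)"
      using card_image_labels[OF xs(1), of "\<lambda>x. ?f (?f x) = x" "\<lambda>i. ?g ! (?g ! i) = i"] in2
      by (simp add: t_def label_profile_def del: comp_apply)
    ultimately show ?thesis using card_split[OF X(1) xs(2), of "\<lambda>x. ?f (?f x) = x"] by simp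
  qed
  then show "fst (snd (profile_at X a b h)) = fst (snd t) + c2" by (simp add: profile_at_def fix_profile_def)
qed

end

section \<open>Certificates checked by evaluation, and the bounds they give\<close>

definition exact_ok :: "nat list \<Rightarrow> nat list \<Rightarrow> (nat list \<times> (nat \<times> nat) list) list \<Rightarrow> bool" where
  "exact_ok ls ms vs \<longleftrightarrow> sum_list ls = sum_list ms \<and> ls \<noteq> [] \<and> ms \<noteq> [] \<and> 0 \<notin> set ls \<and> 0 \<notin> set ms \<and>
     (let p = sum_list ls; prof = (\<lambda>s. label_profile p (gamma ls Closed ms s)) in
      distinct (map (\<lambda>v. prof (fst v)) vs) \<and>
      (\<forall>v \<in> set vs. labelling p (fst v) \<and> swaps_ok p (snd v) \<and> prof (swaps (fst v) (snd v)) = prof (fst v)))"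

definition strict_ok :: "nat list \<Rightarrow> nat list \<Rightarrow> (nat list \<times> (nat \<times> nat) list) list \<Rightarrow> bool" where
  "strict_ok ls ms vs \<longleftrightarrow> sum_list ls = sum_list ms \<and> ls \<noteq> [] \<and> ms \<noteq> [] \<and> 0 \<notin> set ls \<and> 0 \<notin> set ms \<and>
     (let p = sum_list ls; prof = (\<lambda>s. let t = label_profile p (gamma ls Strict ms s) in (fst t, fst (snd t)));
          good = (\<lambda>s. \<forall>z \<in> set (exits ls Strict). fst z \<noteq> snd z \<and> (snd z, snd z) \<in> set (relabel s (arcs ms Closed))) in
      distinct (map (\<lambda>v. prof (fst v)) vs) \<and>
      (\<forall>v \<in> set vs. labelling p (fst v) \<and> swaps_ok p (snd v) \<and> good (fst v) \<and> good (swaps (fst v) (snd v)) \<and>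
         prof (swaps (fst v) (snd v)) = prof (fst v)))"

theorem many_by_exact:
  assumes X: "finite X" "a permutes X" "b permutes X"
    and forms: "has_form X a ls Closed" "has_form X b ms Closed"
    and ok: "exact_ok ls ms vs"
  shows "many (length vs) X a b"
proof -
  obtain xs where xs: "form_on X a ls Closed xs" using forms(1) by (auto simp: has_form_def)
  obtain ys where ys: "form_on X b ms Closed ys" using forms(2) by (auto simp: has_form_def)
  have l: "length xs = sum_list ls" "distinct xs" "set xs \<subseteq> X" using xs by (auto simp: form_on_def)
  define prof where "prof = (\<lambda>s. label_profile (length xs) (gamma ls Closed ms s))"
  have ok': "sum_list ls = sum_list ms" "ls \<noteq> []" "ms \<noteq> []" "0 \<notin> set ls" "0 \<notin> set ms"
    "distinct (map (\<lambda>v. prof (fst v)) vs)"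
    "\<And>v. v \<in> set vs \<Longrightarrow> labelling (length xs) (fst v) \<and> swaps_ok (length xs) (snd v) \<and> prof (swaps (fst v) (snd v)) = prof (fst v)"
    using ok unfolding exact_ok_def Let_def prof_def l(1) by blast+
  show ?thesis
  proof (rule many_by_labellings[OF X ys ok'(3,5) l(2,3)])
    show "\<forall>(s, r) \<in> set vs. labelling (length xs) s \<and> swaps_ok (length xs) r" using ok'(7) by fastforce
    fix b' assume b': "b' permutes X" "form_on X b' ms Closed xs"
    note E = exact_profile[OF X(1,2) b'(1) xs ok'(2,4) b'(2) ok'(3,5)]
    define d where "d = inv' a \<circ> b'"
    define c where "c = (card {x \<in> X - set xs. d x = x}, card {x \<in> X - set xs. d (d x) = x}, card {x \<in> X - set xs. d (d (d x)) = x})"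
    define add where "add = (\<lambda>t. (fst t + fst c, fst (snd t) + fst (snd c), snd (snd t) + snd (snd c)))"
    define Q where "Q = (\<lambda>i w. w = add (prof (fst (vs ! i))))"
    have "Q i (profile_at X a b' h)" if "i < length vs" "s' \<in> {fst (vs ! i), swaps (fst (vs ! i)) (snd (vs ! i))}"
        "labelling (length xs) s'" "realises xs s' h" for i s' h
    proof -
      have "prof s' = prof (fst (vs ! i))" using ok'(7)[OF nth_mem[OF that(1)]] that(2) by auto
      then show ?thesis using E[OF that(4,3) refl]
        by (simp add: Q_def add_def c_def d_def prof_def del: comp_apply)
    qed
    moreover have "\<not> (Q i w \<and> Q j w)" if "i < length vs" "j < i" for i j w
    proof
      assume "Q i w \<and> Q j w"
      then have "prof (fst (vs ! i)) = prof (fst (vs ! j))" by (auto simp: Q_def add_def prod_eq_iff)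
      then show False using ok'(6) that by (auto simp: distinct_conv_nth)
    qed
    ultimately have "separates X a b' xs vs Q" unfolding separates_def by blast
    then show "\<exists>Q. separates X a b' xs vs Q" by (rule exI[of _ Q])
  qed (use ok' l in auto)
qed

theorem many_by_strict:
  assumes X: "finite X" "a permutes X" "b permutes X"
    and forms: "has_form X a ls Strict" "form_on X b ms Closed ys" "\<forall>x \<in> X - set ys. b x = x"
    and ok: "strict_ok ls ms vs"
  shows "many (length vs) X a b"
proof -
  obtain xs where xs: "form_on X a ls Strict xs" using forms(1) by (auto simp: has_form_def)
  note ys = forms(2)
  have l: "length xs = sum_list ls" "distinct xs" "set xs \<subseteq> X" using xs by (auto simp: form_on_def)
  define prof where "prof = (\<lambda>s. label_profile (length xs) (gamma ls Strict ms s))"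
  define good where "good = (\<lambda>s. \<forall>z \<in> set (exits ls Strict). fst z \<noteq> snd z \<and> (snd z, snd z) \<in> set (relabel s (arcs ms Closed)))"
  define two where "two = (\<lambda>t :: nat \<times> nat \<times> nat. (fst t, fst (snd t)))"
  have ok': "sum_list ls = sum_list ms" "ls \<noteq> []" "ms \<noteq> []" "0 \<notin> set ls" "0 \<notin> set ms"
    "distinct (map (\<lambda>v. two (prof (fst v))) vs)"
    "\<And>v. v \<in> set vs \<Longrightarrow> labelling (length xs) (fst v) \<and> swaps_ok (length xs) (snd v) \<and>
       good (fst v) \<and> good (swaps (fst v) (snd v)) \<and> two (prof (swaps (fst v) (snd v))) = two (prof (fst v))"
    using ok unfolding strict_ok_def Let_def prof_def good_def two_def l(1) by blast+
  show ?thesis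
  proof (rule many_by_labellings[OF X ys ok'(3,5) l(2,3)])
    show "\<forall>(s, r) \<in> set vs. labelling (length xs) s \<and> swaps_ok (length xs) r" using ok'(7) by fastforce
    fix b' assume b': "b' permutes X" "form_on X b' ms Closed xs"
      and "(\<forall>x \<in> X - set ys. b x = x) \<Longrightarrow> (\<forall>x \<in> X - set xs. b' x = x)"
    then have fix': "\<forall>x \<in> X - set xs. b' x = x" using forms(3) by blast
    note E = strict_profile[OF X(1,2) b'(1) xs ok'(2,4) b'(2) ok'(3,5) _ _ refl fix']
    define c1 where "c1 = card {x \<in> X - set xs. inv' a x = x}"
    define c2 where "c2 = card {x \<in> X - set xs. inv' a x \<notin> set xs \<and> inv' a (inv' a x) = x}"
    define Q where "Q = (\<lambda>i (w :: nat \<times> nat \<times> nat). fst w = fst (prof (fst (vs ! i))) + c1 \<and> fst (snd w) = fst (snd (prof (fst (vs ! i)))) + c2)"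
    have "Q i (profile_at X a b' h)" if "i < length vs" "s' \<in> {fst (vs ! i), swaps (fst (vs ! i)) (snd (vs ! i))}"
        "labelling (length xs) s'" "realises xs s' h" for i s' h
    proof -
      have "two (prof s') = two (prof (fst (vs ! i)))" "good s'" using ok'(7)[OF nth_mem[OF that(1)]] that(2) by auto
      then show ?thesis using E[OF that(4,3)]
        by (simp add: Q_def c1_def c2_def prof_def good_def two_def)
    qed
    moreover have "\<not> (Q i w \<and> Q j w)" if "i < length vs" "j < i" for i j w
    proof
      assume "Q i w \<and> Q j w"
      then have "two (prof (fst (vs ! i))) = two (prof (fst (vs ! j)))" by (auto simp: Q_def two_def)
      then show False using ok'(6) that by (auto simp: distinct_conv_nth)
    qed
    ultimately have "separates X a b' xs vs Q" unfolding separates_def by blast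
    then show "\<exists>Q. separates X a b' xs vs Q" by (rule exI[of _ Q])
  qed (use ok' l in auto)
qed

subsection \<open>Cycle decompositions and forms\<close>

definition cyclic :: "('a \<Rightarrow> 'a) \<Rightarrow> 'a list \<Rightarrow> bool" where
  "cyclic f c \<longleftrightarrow> c \<noteq> [] \<and> map f c = rotate1 c"

definition cycles_of :: "'a set \<Rightarrow> ('a \<Rightarrow> 'a) \<Rightarrow> 'a list list \<Rightarrow> bool" where
  "cycles_of X f css \<longleftrightarrow> distinct (concat css) \<and> set (concat css) \<subseteq> X \<and> (\<forall>c \<in> set css. cyclic f c)"

lemma cyclic_nth:
  assumes "cyclic f c" "i < length c"
  shows "f (c ! i) = c ! (Suc i mod length c)"
proof -
  have "f (c ! i) = rotate1 c ! i" using assms by (metis cyclic_def nth_map)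
  then show ?thesis using assms by (simp add: nth_rotate1)
qed

lemma block_arcs_snoc:
  "m > 0 \<Longrightarrow> butlast (block_arcs i (ls @ [m])) =
     block_arcs i ls @ map (\<lambda>k. (k, Suc k)) [i + sum_list ls..<i + sum_list ls + m - 1]"
proof (induction ls arbitrary: i)
  case (Cons l ls)
  have "block_arcs (i + l) (ls @ [m]) \<noteq> []" by (simp add: block_arcs_ne)
  then show ?case using Cons by (simp add: butlast_append add.assoc)
qed simp

lemma last_block_arcs_snoc:
  "last (block_arcs i (ls @ [m])) = (i + sum_list ls + m - 1, i + sum_list ls)"
proof (induction ls arbitrary: i)
  case (Cons l ls)
  have "block_arcs (i + l) (ls @ [m]) \<noteq> []" by (simp add: block_arcs_ne)
  then show ?case using Cons by (simp add: add.assoc)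
qed simp

lemma block_arcs_cycles:
  assumes "\<forall>c \<in> set css. cyclic f c" "(i, j) \<in> set (block_arcs (length us) (map length css))"
  shows "f ((us @ concat css @ vs) ! i) = (us @ concat css @ vs) ! j"
  using assms
proof (induction css arbitrary: us)
  case (Cons c css)
  have c: "cyclic f c" "length c > 0" using Cons.prems(1) by (auto simp: cyclic_def)
  consider "i \<in> {length us..<length us + length c - 1}" "j = Suc i" | "i = length us + length c - 1" "j = length us"
    | "(i, j) \<in> set (block_arcs (length (us @ c)) (map length css))"
    using Cons.prems(2) by auto
  then show ?case
  proof cases
    case 1
    define k where "k = i - length us"
    have k: "i = length us + k" "Suc k < length c" using 1(1) by (auto simp: k_def)
    then show ?thesis using cyclic_nth[OF c(1), of k] 1(2) by (simp add: nth_append)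
  next
    case 2
    define k where "k = length c - 1"
    have k: "i = length us + k" "Suc k = length c" using 2(1) c(2) by (auto simp: k_def simp del: length_greater_0_conv)
    then show ?thesis using cyclic_nth[OF c(1), of k] 2(2) c(2) by (simp add: nth_append)
  next
    case 3
    then show ?thesis using Cons.IH[of "us @ c"] Cons.prems(1) by simp
  qed
qed simp

lemma length_concat_lengths: "length (concat css) = sum_list (map length css)"
  by (simp add: length_concat)

lemma form_closed:
  assumes "cycles_of X f css"
  shows "form_on X f (map length css) Closed (concat css)"
  using assms block_arcs_cycles[of css f _ _ "[]" "[]"]
  by (auto simp: form_on_def cycles_of_def arcs_def length_concat_lengths)

text \<open>The unfinished block consists of the first \<open>m\<close> points of the last cycle.
  Only for \<open>m < length c\<close> is it certain that the block does not close, which is what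
  \<open>Strict\<close> records.\<close>

lemma form_open:
  assumes "cycles_of X f (css @ [c])" "0 < m" "m \<le> length c"
    "e = Open \<or> e = Strict \<and> m < length c"
  shows "has_form X f (map length css @ [m]) e"
proof -
  let ?xs = "concat css @ take m c"
  have c: "cyclic f c" "distinct c" and css: "\<forall>c \<in> set css. cyclic f c" using assms(1) by (auto simp: cycles_of_def)
  have e: "e \<noteq> Closed" using assms(4) by auto
  have l: "length (concat css) = sum_list (map length css)" by (rule length_concat_lengths)
  have "form_on X f (map length css @ [m]) e ?xs"
    unfolding form_on_def
  proof (intro conjI)
    show "length ?xs = sum_list (map length css @ [m])" using assms(3) l by simp
    show "distinct ?xs" "set ?xs \<subseteq> X"
      using assms(1) by (auto simp: cycles_of_def dest: in_set_takeD)
    show "\<forall>(i, j) \<in> set (arcs (map length css @ [m]) e). f (?xs ! i) = ?xs ! j"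
    proof clarify
      fix i j assume "(i, j) \<in> set (arcs (map length css @ [m]) e)"
      then consider "(i, j) \<in> set (block_arcs 0 (map length css))"
        | "sum_list (map length css) \<le> i" "i < sum_list (map length css) + m - 1" "j = Suc i"
        using e assms(2) by (auto simp: arcs_def block_arcs_snoc)
      then show "f (?xs ! i) = ?xs ! j"
      proof cases
        case 1
        then show ?thesis using block_arcs_cycles[OF css, of i j "[]"] by simp
      next
        case 2
        define k where "k = i - sum_list (map length css)"
        have k: "i = length (concat css) + k" "Suc k < m" using 2 by (auto simp: k_def l)
        then show ?thesis using cyclic_nth[OF c(1), of k] assms(3) 2(3) by (simp add: nth_append)
      qed
    qed
    show "e = Strict \<longrightarrow> (\<forall>(i, j) \<in> set (exits (map length css @ [m]) e). f (?xs ! i) \<noteq> ?xs ! j)"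
    proof clarify
      fix i j assume s: "e = Strict" "(i, j) \<in> set (exits (map length css @ [m]) Strict)" "f (?xs ! i) = ?xs ! j"
      have ij: "i = length (concat css) + (m - 1)" "j = length (concat css)"
        using s(2) assms(2) by (auto simp: exits_def last_block_arcs_snoc l)
      have "m < length c" using assms(4) s(1) by auto
      then have "f (c ! (m - 1)) = c ! m" using cyclic_nth[OF c(1), of "m - 1"] assms(2) by simp
      moreover have "f (c ! (m - 1)) = c ! 0"
        using s(3) ij assms(2) nth_append_length_plus[of "concat css" "take m c" "m - 1"]
          nth_append_length_plus[of "concat css" "take m c" 0] by simp
      ultimately show False using c(2) \<open>m < length c\<close> assms(2) by (metis gr_implies_not0 length_greater_0_conv list.size(3) nth_eq_iff_index_eq)
    qed
  qed
  then show ?thesis by (auto simp: has_form_def)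
qed

lemma orbit_cyclic:
  assumes "f permutes X" "finite X"
  shows "\<exists>c. cyclic f c \<and> distinct c \<and> x \<in> set c \<and> (x \<in> X \<longrightarrow> set c \<subseteq> X)"
proof -
  have p: "permutation f" using assms by (auto simp: permutation_permutes)
  let ?c = "support f x" and ?m = "least_power f x"
  have m: "?m > 0" "(f ^^ ?m) x = x" using least_power_of_permutation[OF p] by auto
  have "map f ?c = rotate1 ?c"
  proof (rule nth_equalityI)
    fix i assume i: "i < length (map f ?c)"
    then have "rotate1 ?c ! i = (f ^^ (Suc i mod ?m)) x" by (simp add: nth_rotate1)
    also have "\<dots> = (f ^^ Suc i) x" using i m by (cases "Suc i = ?m") auto
    finally show "map f ?c ! i = rotate1 ?c ! i" using i by simp
  qed simp
  moreover have "x \<in> set ?c" using m(1) by (auto simp: image_iff intro!: bexI[of _ 0])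
  moreover have "set ?c \<subseteq> X" if "x \<in> X"
  proof -
    have "(f ^^ i) x \<in> X" for i by (induction i) (use that assms(1) in \<open>auto simp: permutes_in_image\<close>)
    then show ?thesis by auto
  qed
  moreover have "distinct ?c" by (rule cycle_of_permutation[OF p])
  ultimately show ?thesis unfolding cyclic_def by (intro exI[of _ ?c]) auto
qed

lemma cyclic_set_closed: "cyclic f c \<Longrightarrow> f ` set c = set c"
  unfolding cyclic_def by (metis set_map set_rotate1)

lemma cycles_exist:
  assumes "f permutes X" "finite X"
  shows "\<exists>css. cycles_of X f css \<and> set (concat css) = X"
proof -
  have "\<exists>css. distinct (concat css) \<and> (\<forall>c \<in> set css. cyclic f c) \<and> set (concat css) = Y"
    if "finite Y" "Y \<subseteq> X" "f ` Y = Y" for Y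
    using that
  proof (induction "card Y" arbitrary: Y rule: less_induct)
    case less
    show ?case
    proof (cases "Y = {}")
      case True
      then show ?thesis by (intro exI[of _ "[]"]) simp
    next
      case False
      then obtain x where x: "x \<in> Y" by blast
      obtain c where c: "cyclic f c" "distinct c" "x \<in> set c" using orbit_cyclic[OF assms] by blast
      have pw: "(f ^^ i) x \<in> Y" for i by (induction i) (use x less.prems(3) in auto)
      have cY: "set c \<subseteq> Y"
      proof
        fix y assume "y \<in> set c"
        obtain k where k: "k < length c" "x = c ! k" using c(3) by (metis in_set_conv_nth)
        have "c ! ((k + i) mod length c) \<in> Y" for i
        proof (induction i)
          case 0 then show ?case using k x by simp
        next
          case (Suc i)
          have "f (c ! ((k + i) mod length c)) = c ! (Suc ((k + i) mod length c) mod length c)"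
            using k by (intro cyclic_nth[OF c(1)] mod_less_divisor) linarith
          then show ?case using Suc less.prems(3) by (metis add_Suc_right imageI mod_Suc_eq)
        qed
        moreover obtain j where j: "j < length c" "y = c ! j" using \<open>y \<in> set c\<close> by (metis in_set_conv_nth)
        moreover have "(k + (length c - k + j)) mod length c = j" using k j by simp
        ultimately show "y \<in> Y" by metis
      qed
      have inj: "inj f" using permutes_inj[OF assms(1)] .
      have "f ` (Y - set c) = Y - set c"
        using less.prems(3) cyclic_set_closed[OF c(1)] by (simp add: image_set_diff[OF inj])
      moreover have "card (Y - set c) < card Y"
        using less.prems(1) c(3) x by (intro psubset_card_mono) auto
      ultimately obtain css where css: "distinct (concat css)" "\<forall>c \<in> set css. cyclic f c" "set (concat css) = Y - set c"
        using less.hyps[of "Y - set c"] less.prems by blast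
      have "distinct (concat (c # css))" "\<forall>c \<in> set (c # css). cyclic f c" "set (concat (c # css)) = Y"
        using css c cY by auto
      then show ?thesis by blast
    qed
  qed
  from this[OF assms(2) subset_refl permutes_image[OF assms(1)]]
  show ?thesis unfolding cycles_of_def by blast
qed

lemma cycles_of_perm:
  assumes "cycles_of X f css" "mset css' = mset css"
  shows "cycles_of X f css'"
proof -
  have "mset (concat css') = mset (concat css)"
    using assms(2) by (metis mset_concat mset_map sum_mset_sum_list)
  then show ?thesis using assms mset_eq_setD[OF assms(2)] mset_eq_setD[of "concat css'" "concat css"]
    unfolding cycles_of_def by (metis mset_eq_imp_distinct_iff)
qed

lemma cycles_of_subset:
  assumes "cycles_of X f css" "mset css' \<subseteq># mset css"
  shows "cycles_of X f css'"
proof -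
  obtain r where "mset css = mset css' + mset r" using assms(2) by (metis ex_mset subset_mset.le_iff_add)
  then have "cycles_of X f (css' @ r)" using cycles_of_perm[OF assms(1), of "css' @ r"] by simp
  then show ?thesis unfolding cycles_of_def by auto
qed

lemma sorted_cycles_exist:
  assumes "f permutes X" "finite X"
  obtains css where "cycles_of X f css" "set (concat css) = X" "sorted_wrt (\<ge>) (map length css)"
    "sum_list (map length css) = card X"
proof -
  obtain css where css: "cycles_of X f css" "set (concat css) = X" using cycles_exist[OF assms] by blast
  define css' where "css' = rev (sort_key length css)"
  have m: "mset css' = mset css" by (simp add: css'_def)
  have c: "cycles_of X f css'" by (rule cycles_of_perm[OF css(1) m])
  moreover have s: "set (concat css') = X" using css(2) mset_eq_setD[OF m] by simp
  moreover have "sorted_wrt (\<ge>) (map length css')"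
    by (simp add: css'_def sorted_wrt_rev rev_map[symmetric])
  moreover have "sum_list (map length css') = card X"
    using c s distinct_card[of "concat css'"] by (simp add: cycles_of_def length_concat_lengths)
  ultimately show ?thesis using that by blast
qed

section \<open>Parity of a permutation from its cycle lengths\<close>

lemma swapidseq_cycle: "distinct c \<Longrightarrow> swapidseq (length c - 1) (cycle_of_list c)"
proof (induction c rule: cycle_of_list.induct)
  case (1 i j cs)
  then have "swapidseq (Suc (length (j # cs) - 1)) (transpose i j \<circ> cycle_of_list (j # cs))"
    by (intro comp_Suc) auto
  then show ?case by (simp add: comp_def)
qed auto

lemma map_cycle_of_list: "distinct c \<Longrightarrow> map (cycle_of_list c) c = rotate1 c"
  using cyclic_rotation[of c 1] by (simp add: comp_def)

text \<open>The permutation is built anew as a product of disjoint cycles, since its parity is then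
  computed factor by factor; \<open>even_cycles\<close> identifies it with the given one. Empty
  lists are removed because their length 0 would count as even.\<close>

lemma evenperm_cycles:
  assumes "distinct (concat css)"
  shows "\<exists>g. g permutes set (concat css) \<and> (\<forall>c \<in> set css. map g c = rotate1 c) \<and>
    (evenperm g \<longleftrightarrow> even (length (filter even (map length (filter (\<lambda>c. c \<noteq> []) css)))))"
  using assms
proof (induction css)
  case (Cons c css)
  then obtain g where g: "g permutes set (concat css)" "\<forall>c \<in> set css. map g c = rotate1 c"
    "evenperm g \<longleftrightarrow> even (length (filter even (map length (filter (\<lambda>c. c \<noteq> []) css))))" by auto
  let ?h = "cycle_of_list c \<circ> g"
  have c: "distinct c" "set c \<inter> set (concat css) = {}" using Cons.prems by auto
  have p1: "?h permutes set (concat (c # css))"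
    using cycle_permutes[of c] g(1) by (auto intro!: permutes_compose intro: permutes_subset)
  have h1: "map ?h c = rotate1 c"
  proof -
    have "map ?h c = map (cycle_of_list c) c"
    proof (rule map_cong[OF refl])
      fix x assume "x \<in> set c"
      then have "g x = x" using c(2) permutes_not_in[OF g(1), of x] by blast
      then show "?h x = cycle_of_list c x" by simp
    qed
    then show ?thesis using map_cycle_of_list[OF c(1)] by simp
  qed
  have h2: "map ?h d = rotate1 d" if d: "d \<in> set css" for d
  proof -
    have "cycle_of_list c (g x) = g x" if "x \<in> set d" for x
    proof -
      have "g x \<in> set (concat css)" using permutes_in_image[OF g(1)] that d by auto
      then show ?thesis using c(2) id_outside_supp by (metis disjoint_iff)
    qed
    then have "map ?h d = map g d" by simp
    then show ?thesis using g(2) d by simp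
  qed
  have h3: "evenperm ?h \<longleftrightarrow> even (length (filter even (map length (filter (\<lambda>c. c \<noteq> []) (c # css)))))"
  proof -
    have "permutation g" using g(1) by (metis List.finite_set permutation_permutes)
    then have "evenperm ?h \<longleftrightarrow> (evenperm (cycle_of_list c) \<longleftrightarrow> evenperm g)"
      by (simp add: evenperm_comp permutation_of_cycle)
    moreover have "evenperm (cycle_of_list c) \<longleftrightarrow> even (length c - 1)"
      using evenperm_unique[OF swapidseq_cycle[OF c(1)]] by blast
    ultimately show ?thesis using g(3) by (cases c) auto
  qed
  have "\<forall>d \<in> set (c # css). map ?h d = rotate1 d" using h1 h2 by (metis set_ConsD)
  then show ?case using p1 h3 by blast
qed (auto intro!: exI[of _ id])

lemma even_cycles:
  assumes "f permutes X" "cycles_of X f css" "set (concat css) = X"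
  shows "evenperm f \<longleftrightarrow> even (length (filter even (map length css)))"
proof -
  obtain g where g: "g permutes X" "\<forall>c \<in> set css. map g c = rotate1 c"
    "evenperm g \<longleftrightarrow> even (length (filter even (map length (filter (\<lambda>c. c \<noteq> []) css))))"
    using evenperm_cycles[of css] assms(2,3) unfolding cycles_of_def by metis
  have "f x = g x" for x
  proof (cases "x \<in> X")
    case True
    then obtain c where c: "c \<in> set css" "x \<in> set c" using assms(3) by auto
    then have "map f c = map g c" using assms(2) g(2) by (simp add: cycles_of_def cyclic_def)
    then show ?thesis using c(2) by simp
  qed (use assms(1) g(1) in \<open>simp add: permutes_not_in\<close>)
  then have "f = g" by blast
  moreover have "filter (\<lambda>c. c \<noteq> []) css = css" using assms(2) by (simp add: cycles_of_def cyclic_def)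
  ultimately show ?thesis using g(3) by simp
qed

subsection \<open>Counting the classes in a product of two classes\<close>

abbreviation Alt :: "nat \<Rightarrow> (nat \<Rightarrow> nat) set" where
  "Alt n \<equiv> {g. g permutes {1..n} \<and> evenperm g}"

lemma carrier_alt: "carrier (alt_group n) = Alt n"
  by (auto simp: alt_group_carrier)

lemma even_permutes_comp:
  "finite X \<Longrightarrow> g permutes X \<Longrightarrow> h permutes X \<Longrightarrow> evenperm (g \<circ> h) \<longleftrightarrow> evenperm g = evenperm h"
  by (metis evenperm_comp permutation_permutes)

lemma even_permutes_inv: "finite X \<Longrightarrow> g permutes X \<Longrightarrow> evenperm (inv' g) = evenperm g"
  by (metis evenperm_inv permutation_permutes)

lemma Alt_comp: "g \<in> Alt n \<Longrightarrow> h \<in> Alt n \<Longrightarrow> g \<circ> h \<in> Alt n"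
  by (simp add: even_permutes_comp[of "{1..n}"] permutes_compose)

lemma Alt_inv: "g \<in> Alt n \<Longrightarrow> inv' g \<in> Alt n"
  by (simp add: even_permutes_inv[of "{1..n}"] permutes_inv)

lemma even_twist: "finite X \<Longrightarrow> g permutes X \<Longrightarrow> b permutes X \<Longrightarrow> evenperm (twist g b) = evenperm b"
  unfolding twist_def by (simp add: even_permutes_comp even_permutes_inv permutes_compose permutes_inv) auto

lemma twist_id [simp]: "twist id b = b"
  by (simp add: twist_def)

lemma twist_inv_twist: "g permutes X \<Longrightarrow> twist (inv' g) (twist g b) = b"
  using twist_comp[of g X "inv' g" b] by (simp add: permutes_inv permutes_inv_o)

lemma twist_mult: "g permutes X \<Longrightarrow> twist g (a \<circ> b) = twist g a \<circ> twist g b"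
  by (auto simp: twist_def fun_eq_iff permutes_inverses)

text \<open>\<open>conj_class\<close> conjugates as inverse, element, conjugator, and
  \<open>twist\<close> the other way round; replacing each conjugator by its inverse reconciles the
  two.\<close>

lemma conj_class_alt:
  assumes "a \<in> Alt n"
  shows "conj_class (alt_group n) a = (\<lambda>g. twist g a) ` Alt n"
proof -
  have "conj_class (alt_group n) a = {twist (inv' g) a | g. g \<in> Alt n}"
  proof -
    have "inv\<^bsub>alt_group n\<^esub> g \<otimes>\<^bsub>alt_group n\<^esub> a \<otimes>\<^bsub>alt_group n\<^esub> g = twist (inv' g) a" if "g \<in> Alt n" for g
      using that alt_group_inv_equality[of g n] permutes_inv_inv[of g "{1..n}"]
      by (simp add: carrier_alt alt_group_mult twist_def)
    then show ?thesis unfolding conj_class_def carrier_alt by (metis (mono_tags, lifting))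
  qed
  also have "\<dots> = (\<lambda>g. twist g a) ` Alt n"
  proof (intro equalityI subsetI)
    fix x assume "x \<in> (\<lambda>g. twist g a) ` Alt n"
    then obtain g where g: "g \<in> Alt n" "x = twist g a" by blast
    then have "x = twist (inv' (inv' g)) a" using permutes_inv_inv[of g "{1..n}"] by simp
    then show "x \<in> {twist (inv' g) a | g. g \<in> Alt n}" using Alt_inv[OF g(1)] by blast
  qed (use Alt_inv in blast)
  finally show ?thesis .
qed

definition class_prod :: "nat \<Rightarrow> (nat \<Rightarrow> nat) \<Rightarrow> (nat \<Rightarrow> nat) \<Rightarrow> (nat \<Rightarrow> nat) set" where
  "class_prod n a b = conj_class (alt_group n) a <#>\<^bsub>alt_group n\<^esub> conj_class (alt_group n) b"

lemma class_prod_eq: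
  assumes "a \<in> Alt n" "b \<in> Alt n"
  shows "class_prod n a b = {twist g a \<circ> twist h b | g h. g \<in> Alt n \<and> h \<in> Alt n}"
  unfolding class_prod_def set_mult_def conj_class_alt[OF assms(1)] conj_class_alt[OF assms(2)] alt_group_mult
  by blast

text \<open>Pulling the first conjugator \<open>h\<close> out of the product replaces the second one
  by \<open>inv' h \<circ> g\<close>, which is still even.\<close>

lemma class_prod_up_to_twist:
  assumes "a \<in> Alt n" "b \<in> Alt n" "x \<in> class_prod n a b"
  obtains g h where "g \<in> Alt n" "h \<in> Alt n" "x = twist h (a \<circ> twist g b)"
proof -
  obtain h g where hg: "h \<in> Alt n" "g \<in> Alt n" "x = twist h a \<circ> twist g b"
    using assms class_prod_eq by blast
  have p: "h permutes {1..n}" "inv' h permutes {1..n}" "g permutes {1..n}" using hg by (auto simp: permutes_inv)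
  have "twist h (a \<circ> twist (inv' h \<circ> g) b) = twist h a \<circ> twist h (twist (inv' h) (twist g b))"
    using p by (simp add: twist_mult[OF p(1)] twist_comp[OF p(3,2)])
  also have "twist h (twist (inv' h) (twist g b)) = twist g b"
    using twist_inv_twist[OF p(2), of "twist g b"] permutes_inv_inv[OF p(1)] by simp
  finally have "x = twist h (a \<circ> twist (inv' h \<circ> g) b)" using hg(3) by (simp del: o_apply)
  then show ?thesis using that Alt_comp[OF Alt_inv[OF hg(1)] hg(2)] hg(1) by blast
qed

lemma class_prod_Alt:
  assumes "a \<in> Alt n" "b \<in> Alt n"
  shows "class_prod n a b \<subseteq> Alt n"
proof
  fix x assume "x \<in> class_prod n a b"
  then obtain g h where "g \<in> Alt n" "h \<in> Alt n" "x = twist g a \<circ> twist h b"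
    using class_prod_eq[OF assms] by blast
  then show "x \<in> Alt n"
    using Alt_comp[of "twist g a" n "twist h b"] assms by (simp add: twist_permutes even_twist[of "{1..n}"])
qed

lemma class_prod_closed:
  assumes "a \<in> Alt n" "b \<in> Alt n" "x \<in> class_prod n a b"
  shows "conj_class (alt_group n) x \<subseteq> class_prod n a b"
proof -
  obtain g h where gh: "g \<in> Alt n" "h \<in> Alt n" "x = twist g a \<circ> twist h b"
    using assms class_prod_eq by blast
  have *: "twist k x \<in> class_prod n a b" if k: "k \<in> Alt n" for k
  proof -
    have "twist k x = twist (k \<circ> g) a \<circ> twist (k \<circ> h) b"
      using gh k by (simp add: twist_mult[of k "{1..n}"] twist_comp[of _ "{1..n}"])
    then show ?thesis using Alt_comp[OF k gh(1)] Alt_comp[OF k gh(2)] class_prod_eq[OF assms(1,2)] by blast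
  qed
  have x: "x \<in> Alt n" using class_prod_Alt[OF assms(1,2)] assms(3) by (rule subsetD)
  show ?thesis unfolding conj_class_alt[OF x] using * by (rule image_subsetI)
qed

lemma finite_conj_classes: "finite (conj_classes (alt_group n))"
  unfolding conj_classes_def carrier_alt by (simp add: finite_permutations)

lemma self_in_conj_class: "x \<in> Alt n \<Longrightarrow> x \<in> conj_class (alt_group n) x"
  using conj_class_alt[of x n] by (auto intro!: image_eqI[of _ _ id] simp: permutes_id)

text \<open>\<open>F\<close> is constant on each class, so its value can be read off an arbitrary
  element chosen by \<open>SOME\<close>, and the classes in the product map onto the attained
  values.\<close>

lemma eta_ge:
  assumes "a \<in> Alt n" "b \<in> Alt n" "finite W"
    and inv: "\<And>g x. g \<in> Alt n \<Longrightarrow> x \<in> Alt n \<Longrightarrow> F (twist g x) = F x"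
    and att: "\<And>w. w \<in> W \<Longrightarrow> \<exists>g \<in> Alt n. F (a \<circ> twist g b) = w"
  shows "card W \<le> eta (alt_group n) (class_prod n a b)"
proof -
  let ?C = "{K \<in> conj_classes (alt_group n). K \<subseteq> class_prod n a b}"
  have "W \<subseteq> (\<lambda>K. F (SOME x. x \<in> K)) ` ?C"
  proof
    fix w assume "w \<in> W"
    then obtain g where g: "g \<in> Alt n" "F (a \<circ> twist g b) = w" using att by blast
    let ?x = "a \<circ> twist g b" and ?K = "conj_class (alt_group n) (a \<circ> twist g b)"
    have x: "?x \<in> class_prod n a b"
    proof -
      have "?x = twist id a \<circ> twist g b" "id \<in> Alt n" by (simp_all add: permutes_id)
      then show ?thesis unfolding class_prod_eq[OF assms(1,2)] using g(1) by blast
    qed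
    then have xA: "?x \<in> Alt n" using class_prod_Alt[OF assms(1,2)] by blast
    have "(SOME x. x \<in> ?K) \<in> ?K" using someI[of "\<lambda>x. x \<in> ?K", OF self_in_conj_class[OF xA]] .
    then have "F (SOME x. x \<in> ?K) = w" using g(2) inv xA unfolding conj_class_alt[OF xA] by auto
    moreover have "?K \<in> ?C"
      using class_prod_closed[OF assms(1,2) x] xA by (auto simp: conj_classes_def carrier_alt)
    ultimately show "w \<in> (\<lambda>K. F (SOME x. x \<in> K)) ` ?C" by blast
  qed
  moreover have "finite ?C" using finite_conj_classes by simp
  ultimately show ?thesis unfolding eta_def by (meson card_image_le card_mono finite_imageI le_trans)
qed

lemma eta_ge_many:
  assumes "a \<in> Alt n" "b \<in> Alt n" "many k {1..n} (inv' a) b"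
  shows "k \<le> eta (alt_group n) (class_prod n a b)"
proof -
  let ?W = "profile_at {1..n} (inv' a) b ` Alt n"
  have "card ?W \<le> eta (alt_group n) (class_prod n a b)"
  proof (rule eta_ge[OF assms(1,2), where F = "fix_profile {1..n}"])
    show "\<exists>g \<in> Alt n. fix_profile {1..n} (a \<circ> twist g b) = w" if "w \<in> ?W" for w
      using that assms(1) permutes_inv_inv[of a "{1..n}"] by (auto simp: profile_at_def)
  qed (auto simp: finite_permutations fix_profile_twist)
  then show ?thesis using assms(3) by (simp add: many_def)
qed

text \<open>By \<open>class_prod_up_to_twist\<close> it is enough to conjugate the elements
  \<open>a \<circ> twist g b\<close> into the list. The conjugators \<open>h\<close> must be even,
  so a class of the symmetric group that splits needs two representatives.\<close>

lemma eta_le: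
  assumes "a \<in> Alt n" "b \<in> Alt n"
    and reps: "\<And>g. g \<in> Alt n \<Longrightarrow> \<exists>r \<in> set rs. \<exists>h \<in> Alt n. a \<circ> twist g b = twist h r"
  shows "eta (alt_group n) (class_prod n a b) \<le> length rs"
proof -
  let ?C = "{K \<in> conj_classes (alt_group n). K \<subseteq> class_prod n a b}"
  have "?C \<subseteq> (\<lambda>r. (\<lambda>g. twist g r) ` Alt n) ` set rs"
  proof
    fix K assume K: "K \<in> ?C"
    then obtain x where x: "x \<in> Alt n" "K = conj_class (alt_group n) x" by (auto simp: conj_classes_def carrier_alt)
    then have "x \<in> class_prod n a b" using K self_in_conj_class by blast
    then obtain g h where gh: "g \<in> Alt n" "h \<in> Alt n" "x = twist h (a \<circ> twist g b)"
      using class_prod_up_to_twist[OF assms(1,2)] by blast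
    obtain r k where r: "r \<in> set rs" "k \<in> Alt n" "a \<circ> twist g b = twist k r" using reps[OF gh(1)] by blast
    let ?m = "h \<circ> k"
    have m: "?m \<in> Alt n" using Alt_comp gh(2) r(2) by blast
    have xm: "x = twist ?m r" using gh r twist_comp[of k "{1..n}" h r] by simp
    have "(\<lambda>g. twist g x) ` Alt n = (\<lambda>g. twist g r) ` Alt n"
    proof (intro equalityI subsetI)
      fix y assume "y \<in> (\<lambda>g. twist g x) ` Alt n"
      then obtain g' where g': "g' \<in> Alt n" "y = twist g' x" by blast
      then have "y = twist (g' \<circ> ?m) r" using xm m twist_comp[of ?m "{1..n}" g' r] by simp
      then show "y \<in> (\<lambda>g. twist g r) ` Alt n" using Alt_comp[OF g'(1) m] by blast
    next
      fix y assume "y \<in> (\<lambda>g. twist g r) ` Alt n"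
      then obtain g' where g': "g' \<in> Alt n" "y = twist g' r" by blast
      have "r = twist (inv' ?m) x" using xm m twist_inv_twist[of ?m "{1..n}" r] by simp
      then have "y = twist (g' \<circ> inv' ?m) x"
        using g' m twist_comp[of "inv' ?m" "{1..n}" g' x] by (simp add: permutes_inv)
      then show "y \<in> (\<lambda>g. twist g x) ` Alt n" using Alt_comp[OF g'(1) Alt_inv[OF m]] by blast
    qed
    then show "K \<in> (\<lambda>r. (\<lambda>g. twist g r) ` Alt n) ` set rs"
      using r(1) x conj_class_alt[OF x(1)] by auto
  qed
  then have "card ?C \<le> card ((\<lambda>r. (\<lambda>g. twist g r) ` Alt n) ` set rs)" by (intro card_mono) auto
  also have "\<dots> \<le> card (set rs)" by (rule card_image_le) simp
  also have "\<dots> \<le> length rs" by (rule card_length)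
  finally show ?thesis by (simp add: eta_def)
qed

lemma min_etaI:
  assumes "\<And>a b. a \<in> Alt n - {id} \<Longrightarrow> b \<in> Alt n - {id} \<Longrightarrow> v \<le> eta (alt_group n) (class_prod n a b)"
    and "a0 \<in> Alt n - {id}" "b0 \<in> Alt n - {id}" "eta (alt_group n) (class_prod n a0 b0) \<le> v"
  shows "min_eta n = v"
proof -
  let ?S = "{eta (alt_group n) (class_prod n a b) | a b. a \<in> Alt n - {id} \<and> b \<in> Alt n - {id}}"
  have "?S = (\<lambda>(a, b). eta (alt_group n) (class_prod n a b)) ` ((Alt n - {id}) \<times> (Alt n - {id}))" by auto
  moreover have "finite (Alt n)" by (simp add: finite_permutations)
  ultimately have "finite ?S" by simp
  moreover have "eta (alt_group n) (class_prod n a0 b0) = v" using assms by (meson le_antisym)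
  ultimately have "Min ?S = v" using assms by (intro Min_eqI) auto
  then show ?thesis unfolding min_eta_def carrier_alt alt_group_one class_prod_def .
qed

subsection \<open>Involutions times three-cycles\<close>

lemma twist_cycle: "h permutes X \<Longrightarrow> distinct cs \<Longrightarrow> twist h (cycle_of_list cs) = cycle_of_list (map h cs)"
  unfolding twist_def using conjugation_of_cycle[of cs h] permutes_bij[of h X] by simp

lemma cycle3_rotate: "distinct [p, q, r] \<Longrightarrow> cycle_of_list [p, q, r] = cycle_of_list [q, r, p]"
  by (rule ext) (auto simp: transpose_def)

text \<open>Parity is left free on purpose: odd elements of the centraliser are used to correct the
  parity of a conjugator.\<close>

definition centralising :: "'a set \<Rightarrow> ('a \<Rightarrow> 'a) \<Rightarrow> ('a \<Rightarrow> 'a) set" where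
  "centralising X a = {h. h permutes X \<and> (\<forall>x. h (a x) = a (h x))}"

lemma centralising_comp: "g \<in> centralising X a \<Longrightarrow> h \<in> centralising X a \<Longrightarrow> g \<circ> h \<in> centralising X a"
  by (auto simp: centralising_def permutes_compose)

lemma centralising_transpose:
  assumes "u \<in> X" "v \<in> X" "\<And>x. a (a x) = x" "a u = v \<or> a u = u \<and> a v = v"
  shows "transpose u v \<in> centralising X a"
  unfolding centralising_def
proof (intro CollectI conjI allI)
  show "transpose u v permutes X" using assms by (simp add: permutes_swap_id)
  fix x show "transpose u v (a x) = a (transpose u v x)"
    using assms(3)[of x] assms(3)[of u] assms(3)[of v] assms(4) unfolding transpose_def by metis
qed

text \<open>This permutation exchanges the two 2-cycles of \<open>a\<close> through \<open>u\<close>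
  and \<open>v\<close>.\<close>

lemma centralising_transpose2:
  assumes "u \<in> X" "v \<in> X" "a permutes X" "\<And>x. a (a x) = x" "a u \<noteq> u" "a v \<noteq> v" "u \<noteq> v" "a u \<noteq> v"
  shows "transpose u v \<circ> transpose (a u) (a v) \<in> centralising X a"
  unfolding centralising_def
proof (intro CollectI conjI allI)
  show "transpose u v \<circ> transpose (a u) (a v) permutes X"
    using assms by (intro permutes_compose permutes_swap_id) (auto simp: permutes_in_image)
  have ne: "a v \<noteq> u" "a u \<noteq> a v" using assms(4,7,8) by metis+
  fix x
  consider "x = u" | "x = v" | "x = a u" | "x = a v" | "x \<notin> {u, v, a u, a v}" by blast
  then show "(transpose u v \<circ> transpose (a u) (a v)) (a x) = a ((transpose u v \<circ> transpose (a u) (a v)) x)"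
  proof cases
    case 5
    then have "a x \<notin> {u, v, a u, a v}" using assms(4) by (metis insert_iff singletonD)
    then show ?thesis using 5 by (simp add: transpose_def)
  qed (use assms ne in \<open>simp_all add: transpose_def\<close>)
qed

text \<open>\<open>h\<close> is followed by an element of the centraliser that moves
  \<open>h x\<close> to \<open>y\<close> and fixes \<open>S\<close>: a transposition if the two
  points are partners or both fixed by \<open>a\<close>, an exchange of their 2-cycles otherwise. As
  \<open>S\<close> is closed under \<open>a\<close>, the partners involved also avoid it.\<close>

lemma centralising_extend:
  assumes X: "a permutes X" "\<And>x. a (a x) = x"
    and h: "h \<in> centralising X a" "x \<in> X" "y \<in> X" "a x = x \<longleftrightarrow> a y = y"
    and S: "h x \<notin> S" "y \<notin> S" "\<And>z. z \<in> S \<Longrightarrow> a z \<in> S"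
  shows "\<exists>h' \<in> centralising X a. h' x = y \<and> (\<forall>z. h z \<in> S \<longrightarrow> h' z = h z)"
proof -
  let ?u = "h x"
  have hp: "h permutes X" "\<And>x. h (a x) = a (h x)" using h(1) by (auto simp: centralising_def)
  have u: "?u \<in> X" "a ?u = ?u \<longleftrightarrow> a y = y"
    using h hp permutes_inj[OF hp(1)] by (auto simp: permutes_in_image dest: injD) (metis injD)+
  have au: "a ?u \<notin> S" "a y \<notin> S" using S X(2) by metis+
  consider "a ?u = ?u \<and> a y = y \<or> a ?u = y" | "a ?u \<noteq> ?u" "a y \<noteq> y" "?u \<noteq> y" "a ?u \<noteq> y" | "?u = y"
    using u by blast
  then obtain m where m: "m \<in> centralising X a" "m ?u = y" "\<And>z. z \<in> S \<Longrightarrow> m z = z"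
  proof cases
    case 1
    have "transpose ?u y \<in> centralising X a"
      by (rule centralising_transpose) (use 1 u h(3) X(2) in auto)
    moreover have "transpose ?u y z = z" if "z \<in> S" for z
      using that S by (intro transpose_apply_other) auto
    ultimately show ?thesis using that[of "transpose ?u y"] by simp
  next
    case 2
    have "transpose ?u y \<circ> transpose (a ?u) (a y) \<in> centralising X a"
      by (rule centralising_transpose2) (use 2 u h(3) X in auto)
    moreover have "(transpose ?u y \<circ> transpose (a ?u) (a y)) z = z" if "z \<in> S" for z
      using that S au by (auto simp: transpose_def)
    moreover have "(transpose ?u y \<circ> transpose (a ?u) (a y)) ?u = y"
      using 2 X(2)[of y] by (auto simp: transpose_def)
    ultimately show ?thesis using that by blast
  next
    case 3
    have "id \<in> centralising X a" by (simp add: centralising_def permutes_id)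
    then show ?thesis using that[of id] 3 by simp
  qed
  have "m \<circ> h \<in> centralising X a" by (rule centralising_comp[OF m(1) h(1)])
  moreover have "\<forall>z. h z \<in> S \<longrightarrow> (m \<circ> h) z = h z" using m(3) by simp
  ultimately show ?thesis using m(2) by (intro bexI[of _ "m \<circ> h"]) auto
qed

text \<open>The centraliser of an involution acts homogeneously: it realises every partial isomorphism.\<close>

lemma centralising_homogeneous:
  assumes X: "a permutes X" "\<And>x. a (a x) = x"
    and "length us = length vs" "set us \<subseteq> X" "set vs \<subseteq> X"
    and "\<And>i j. i < length us \<Longrightarrow> j < length us \<Longrightarrow> us ! i = us ! j \<longleftrightarrow> vs ! i = vs ! j"
    and "\<And>i j. i < length us \<Longrightarrow> j < length us \<Longrightarrow> a (us ! i) = us ! j \<longleftrightarrow> a (vs ! i) = vs ! j"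
  shows "\<exists>h \<in> centralising X a. map h us = vs"
  using assms(3-)
proof (induction us arbitrary: vs rule: rev_induct)
  case Nil
  have "id \<in> centralising X a" by (simp add: centralising_def permutes_id)
  then show ?case using Nil by auto
next
  case (snoc x us)
  then obtain ws y where vs: "vs = ws @ [y]" by (metis append_butlast_last_id length_append_singleton length_greater_0_conv zero_less_Suc)
  have len: "length us = length ws" using snoc.prems(1) vs by simp
  note eq = snoc.prems(4)[unfolded vs]
  note rel = snoc.prems(5)[unfolded vs]
  have "us ! i = us ! j \<longleftrightarrow> ws ! i = ws ! j" if "i < length us" "j < length us" for i j
    using eq[of i j] that len by (simp add: nth_append)
  moreover have "a (us ! i) = us ! j \<longleftrightarrow> a (ws ! i) = ws ! j" if "i < length us" "j < length us" for i j
    using rel[of i j] that len by (simp add: nth_append)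
  ultimately obtain h where h: "h \<in> centralising X a" "map h us = ws"
    using snoc.IH[of ws] len snoc.prems(2,3) vs by auto
  have hp: "h permutes X" "\<And>x. h (a x) = a (h x)" using h(1) by (auto simp: centralising_def)
  have inj: "h p = h q \<longleftrightarrow> p = q" for p q using permutes_inj[OF hp(1)] by (auto dest: injD)
  have hu: "h (us ! i) = ws ! i" if "i < length us" for i using h(2) that by (metis nth_map)
  have e: "us ! i = x \<longleftrightarrow> ws ! i = y" "a (us ! i) = x \<longleftrightarrow> a (ws ! i) = y" if "i < length us" for i
    using eq[of i "length us"] rel[of i "length us"] that len by (auto simp: nth_append)
  have r: "a x = x \<longleftrightarrow> a y = y"
    using rel[of "length us" "length us"] len by (simp add: nth_append)
  show ?case
  proof (cases "h x = y")
    case True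
    then show ?thesis using h vs by auto
  next
    case False
    \<comment> \<open>The points already placed together with their partners, so that the correction
      for the new point disturbs none of them.\<close>
    define S where "S = set ws \<union> a ` set ws"
    have "h x \<notin> S"
    proof
      assume "h x \<in> S"
      then obtain i where i: "i < length us" "h x = ws ! i \<or> h x = a (ws ! i)"
        using len by (auto simp: S_def in_set_conv_nth)
      then have "x = us ! i \<or> x = a (us ! i)" using hu hp(2) inj by metis
      then show False using e[OF i(1)] hu[OF i(1)] hp(2) False by metis
    qed
    moreover have "y \<notin> S"
    proof
      assume "y \<in> S"
      then obtain i where i: "i < length us" "y = ws ! i \<or> y = a (ws ! i)"
        using len by (auto simp: S_def in_set_conv_nth)
      then show False using e[OF i(1)] hu[OF i(1)] hp(2) False by metis
    qed
    moreover have "a z \<in> S" if "z \<in> S" for z using that X(2) by (auto simp: S_def)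
    ultimately obtain h' where h': "h' \<in> centralising X a" "h' x = y" "\<forall>z. h z \<in> S \<longrightarrow> h' z = h z"
      using centralising_extend[OF X h(1), of x y S] r snoc.prems(2,3) vs by auto
    have "map h' us = ws"
      using h(2) h'(3) by (intro nth_equalityI) (auto simp: S_def hu len)
    then show ?thesis using h' vs by (intro bexI[of _ h']) auto
  qed
qed

lemma involution_triple_map:
  assumes a: "a \<in> Alt n" "\<And>x. a (a x) = x"
    and t: "distinct [p, q, r]" "distinct [p', q', r']" "{p, q, r, p', q', r'} \<subseteq> {1..n}"
    and iso: "a p = p \<longleftrightarrow> a p' = p'" "a q = q \<longleftrightarrow> a q' = q'" "a r = r \<longleftrightarrow> a r' = r'"
      "a p = q \<longleftrightarrow> a p' = q'" "a p = r \<longleftrightarrow> a p' = r'" "a q = r \<longleftrightarrow> a q' = r'"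
  shows "\<exists>h \<in> centralising {1..n} a. h p' = p \<and> h q' = q \<and> h r' = r"
proof -
  have ap: "a permutes {1..n}" using a(1) by simp
  have sym: "a x = y \<longleftrightarrow> a y = x" for x y using a(2) by metis
  have "\<exists>h \<in> centralising {1..n} a. map h [p', q', r'] = [p, q, r]"
  proof (rule centralising_homogeneous[OF ap a(2)])
    fix i j assume "i < length [p', q', r']" "j < length [p', q', r']"
    then have ij: "i \<in> {0, 1, 2}" "j \<in> {0, 1, 2}" by auto
    show "[p', q', r'] ! i = [p', q', r'] ! j \<longleftrightarrow> [p, q, r] ! i = [p, q, r] ! j" using ij t(1,2) by auto
    from ij show "a ([p', q', r'] ! i) = [p', q', r'] ! j \<longleftrightarrow> a ([p, q, r] ! i) = [p, q, r] ! j"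
      using iso sym[of q p] sym[of r p] sym[of r q] sym[of q' p'] sym[of r' p'] sym[of r' q']
      by (elim insertE emptyE) (simp_all (no_asm_simp) only: nth_Cons_0 nth_Cons_Suc numeral_2_eq_2 One_nat_def)
  qed (use t in auto)
  then show ?thesis by auto
qed

text \<open>A map of the triples that commutes with \<open>a\<close> conjugates one product into the
  other. If it is odd, composing it on the right with \<open>c\<close> makes it even and changes
  neither \<open>a\<close> nor the images of \<open>p'\<close>, \<open>q'\<close>,
  \<open>r'\<close>.\<close>

lemma involution_triple:
  assumes a: "a \<in> Alt n" "\<And>x. a (a x) = x"
    and t: "distinct [p, q, r]" "distinct [p', q', r']" "{p, q, r, p', q', r'} \<subseteq> {1..n}"
    and iso: "a p = p \<longleftrightarrow> a p' = p'" "a q = q \<longleftrightarrow> a q' = q'" "a r = r \<longleftrightarrow> a r' = r'"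
      "a p = q \<longleftrightarrow> a p' = q'" "a p = r \<longleftrightarrow> a p' = r'" "a q = r \<longleftrightarrow> a q' = r'"
    and odd: "c \<in> centralising {1..n} a" "\<not> evenperm c" "c p' = p'" "c q' = q'" "c r' = r'"
  shows "\<exists>h \<in> Alt n. a \<circ> cycle_of_list [p, q, r] = twist h (a \<circ> cycle_of_list [p', q', r'])"
proof -
  obtain h where h: "h \<in> centralising {1..n} a" "h p' = p" "h q' = q" "h r' = r"
    using involution_triple_map[OF a t iso] by blast
  define k where "k = (if evenperm h then h else h \<circ> c)"
  have kc: "k \<in> centralising {1..n} a" using h(1) odd(1) centralising_comp by (auto simp: k_def)
  have k: "k permutes {1..n}" "\<And>x. k (a x) = a (k x)" using kc by (auto simp: centralising_def)
  have kv: "k p' = p" "k q' = q" "k r' = r" using h odd by (auto simp: k_def)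
  have "evenperm k"
    using h(1) odd(1,2) by (auto simp: k_def centralising_def even_permutes_comp[of "{1..n}"])
  moreover have "twist k a = a"
    using k by (auto simp: twist_def fun_eq_iff permutes_inverses)
  then have "twist k (a \<circ> cycle_of_list [p', q', r']) = a \<circ> cycle_of_list [p, q, r]"
    using twist_mult[OF k(1), of a "cycle_of_list [p', q', r']"] twist_cycle[OF k(1) t(2)] kv by simp
  ultimately show ?thesis using k(1) by (intro bexI[of _ k]) auto
qed

section \<open>The standard involution times a three-cycle\<close>

lemma cycle3_Alt: "distinct [p, q, r] \<Longrightarrow> {p, q, r} \<subseteq> {1..n} \<Longrightarrow> cycle_of_list [p, q, r] \<in> Alt n"
  using evenperm_unique[OF swapidseq_cycle[of "[p, q, r]"]] permutes_subset[OF cycle_permutes[of "[p, q, r]"]]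
  by (simp del: cycle_of_list.simps)

lemma twist_cycle3_form:
  assumes "g \<in> Alt n" "distinct [x, y, z]" "{x, y, z} \<subseteq> {1..n}"
  obtains p q r where "twist g (cycle_of_list [x, y, z]) = cycle_of_list [p, q, r]" "distinct [p, q, r]" "{p, q, r} \<subseteq> {1..n}"
proof -
  have g: "g permutes {1..n}" using assms(1) by simp
  have "inj g" using permutes_inj[OF g] .
  then have "distinct [g x, g y, g z]" using assms(2) by (auto dest: injD)
  moreover have "{g x, g y, g z} \<subseteq> {1..n}" using assms(3) permutes_in_image[OF g] by auto
  ultimately show ?thesis using that[of "g x" "g y" "g z"] twist_cycle[OF g assms(2)] by simp
qed

text \<open>The involution (1 2)(3 4)...(2m-1 2m).\<close>

definition pairing :: "nat \<Rightarrow> nat \<Rightarrow> nat" where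
  "pairing m x = (if 1 \<le> x \<and> x \<le> 2 * m then (if odd x then x + 1 else x - 1) else x)"

lemma pairing_involution: "pairing m (pairing m x) = x"
  by (auto simp: pairing_def elim!: oddE evenE) presburger+

lemma pairing_permutes: "2 * m \<le> n \<Longrightarrow> pairing m permutes {1..n}"
proof (rule bij_imp_permutes)
  assume m: "2 * m \<le> n"
  have "pairing m x \<in> {1..n}" if "x \<in> {1..n}" for x
    using that m by (auto simp: pairing_def elim!: oddE evenE) presburger+
  then show "bij_betw (pairing m) {1..n} {1..n}"
    by (intro bij_betwI[where g = "pairing m"]) (auto simp: pairing_involution)
qed (auto simp: pairing_def)

lemma pairing_Suc: "pairing (Suc m) = transpose (2 * m + 1) (2 * m + 2) \<circ> pairing m"
proof
  fix x
  consider "x = 2 * m + 1" | "x = 2 * m + 2" | "1 \<le> x" "x \<le> 2 * m" | "x = 0 \<or> x > 2 * m + 2" by linarith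
  then show "pairing (Suc m) x = (transpose (2 * m + 1) (2 * m + 2) \<circ> pairing m) x"
    by cases (auto simp: pairing_def transpose_def elim!: oddE evenE, presburger+)
qed

lemma evenperm_pairing: "evenperm (pairing m) \<longleftrightarrow> even m"
proof (induction m)
  case 0
  have "pairing 0 = id" by (auto simp: pairing_def)
  then show ?case by simp
next
  case (Suc m)
  have "permutation (pairing m)" using pairing_permutes[of m "2 * m"] by (auto simp: permutation_permutes)
  then show ?case
    unfolding pairing_Suc using Suc by (subst evenperm_comp) (simp_all add: permutation_swap_id evenperm_swap)
qed

text \<open>Up to rotation of the three-cycle, its points form one of the kinds of triples
  distinguished by the pairing, and each kind has its representative in \<open>rs\<close>. Every
  case also needs an odd element of the centraliser that fixes the representative triple; it is a
  transposition taken from an untouched 2-cycle or from two untouched fixed points. As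
  \<open>m\<close> is even and \<open>n \<ge> 6\<close>, either \<open>m \<ge> 4\<close>, or
  \<open>m = 2\<close> and \<open>f = 2\<close>.\<close>

lemma eta_pairing:
  assumes n: "n = 2 * m + f" "f \<le> 2" "even m" "n \<ge> 6"
  shows "eta (alt_group n) (class_prod n (pairing m) (cycle_of_list [1, 2, 3]))
    \<le> (if f = 0 then 2 else if f = 1 then 4 else 5)"
proof -
  let ?a = "pairing m" and ?X = "{1..n}"
  have m2: "m \<ge> 2" using n by auto
  have m4: "m \<ge> 4 \<or> m = 2" using n(3) m2 by presburger
  have m4': "m \<ge> 4 \<or> f = 2" using m4 n by auto
  have a: "?a \<in> Alt n" using pairing_permutes[of m n] n by (simp add: evenperm_pairing)
  note inv = pairing_involution[of m]
  have b: "cycle_of_list [1, 2, 3] \<in> Alt n"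
    by (rule cycle3_Alt) (use n(4) in auto)
  have moved: "?a x = x \<longleftrightarrow> x > 2 * m" if "x \<in> ?X" for x
    using that by (auto simp: pairing_def)
  have tr: "transpose u v \<in> centralising ?X ?a" "\<not> evenperm (transpose u v)"
    if "u \<in> ?X" "v \<in> ?X" "u \<noteq> v" "?a u = v \<or> ?a u = u \<and> ?a v = v" for u v
    using centralising_transpose[OF that(1,2) inv that(4)] that(3) by (auto simp: evenperm_swap)
  have v: "?a 1 = 2" "?a (Suc 0) = 2" "?a 2 = 1" "?a 3 = 4" "m \<ge> 4 \<Longrightarrow> ?a 5 = 6"
    "?a (2 * m + 1) = 2 * m + 1" "?a (Suc (2 * m)) = Suc (2 * m)"
    "?a (2 * m + 2) = 2 * m + 2" "?a (Suc (Suc (2 * m))) = Suc (Suc (2 * m))"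
    using m2 by (auto simp: pairing_def)
  let ?w = "\<lambda>p q r. ?a \<circ> cycle_of_list [p, q, r]"
  let ?w4 = "?w 1 3 (2 * m + 1)"
  \<comment> \<open>In degree 6, where \<open>m = 2\<close>, no three points lie in distinct
    2-cycles. On the other hand \<open>?w4\<close> is then a five-cycle, whose class splits, and its
    conjugate under the odd \<open>o1\<close> represents the other half. The list again has five
    entries.\<close>
  define o1 where "o1 = transpose (1 :: nat) 2"
  define rs where "rs = (if f = 0 then [?w 1 2 3, ?w 1 3 5]
     else if f = 1 then [?w 1 2 3, ?w 1 3 5, ?w 1 2 (2 * m + 1), ?w4]
     else [?w 1 2 3, ?w 1 2 (2 * m + 1), ?w4, ?w 1 (2 * m + 1) (2 * m + 2),
           if m = 2 then twist o1 ?w4 else ?w 1 3 5])"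
  have "eta (alt_group n) (class_prod n ?a (cycle_of_list [1, 2, 3])) \<le> length rs"
  proof (rule eta_le[OF a b])
    fix g assume g: "g \<in> Alt n"
    obtain p q r where t: "twist g (cycle_of_list [1, 2, 3]) = cycle_of_list [p, q, r]" "distinct [p, q, r]" "{p, q, r} \<subseteq> ?X"
      using twist_cycle3_form[OF g, of 1 2 3] n(4) by auto
    define good where "good = (\<lambda>p q r. \<exists>x \<in> set rs. \<exists>h \<in> Alt n. ?w p q r = twist h x)"
    have rot: "good p q r" if "good q r p" "distinct [p, q, r]" for p q r
      using that(1) unfolding good_def cycle3_rotate[OF that(2)] .
    have c1: "good p q r" if t: "distinct [p, q, r]" "{p, q, r} \<subseteq> ?X" and p: "?a p = q" "r \<le> 2 * m" for p q r
    proof -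
      have "\<exists>h \<in> Alt n. ?w p q r = twist h (?w 1 2 3)"
      proof (rule involution_triple[OF a inv t(1)])
        \<comment> \<open>For \<open>m \<ge> 4\<close> the points 5 and 6 form a 2-cycle of the
          pairing, for \<open>m = 2\<close> they are its two fixed points. In both cases the
          transposition commutes with it.\<close>
        show "transpose 5 6 \<in> centralising ?X ?a" "\<not> evenperm (transpose 5 (6 :: nat))"
          using tr[of 5 6] n m4' by (auto simp: pairing_def)
        have "?a q = p" using p inv by metis
        moreover have "?a r \<noteq> r" using moved[of r] p t by auto
        moreover have "?a p \<noteq> p" "?a q \<noteq> q" using p \<open>?a q = p\<close> t by auto
        ultimately show "(?a p = p) = (?a 1 = 1)" "(?a q = q) = (?a 2 = 2)" "(?a r = r) = (?a 3 = 3)"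
          "(?a p = q) = (?a 1 = 2)" "(?a p = r) = (?a 1 = 3)" "(?a q = r) = (?a 2 = 3)"
          using p t m2 by (auto simp: v)
      qed (use t n in \<open>auto simp: transpose_def\<close>)
      then show ?thesis unfolding good_def rs_def by auto
    qed
    have c2: "good p q r" if t: "distinct [p, q, r]" "{p, q, r} \<subseteq> ?X" and p: "?a p = q" "r > 2 * m" for p q r
    proof -
      have f: "f > 0" using p t n by auto
      have "\<exists>h \<in> Alt n. ?w p q r = twist h (?w 1 2 (2 * m + 1))"
      proof (rule involution_triple[OF a inv t(1)])
        show "transpose 3 4 \<in> centralising ?X ?a" "\<not> evenperm (transpose 3 (4 :: nat))"
          using tr[of 3 4] n m2 by (auto simp: pairing_def)
        have "?a q = p" using p inv by metis
        moreover have "?a r = r" using moved[of r] p t by auto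
        moreover have "?a p \<noteq> p" "?a q \<noteq> q" using p \<open>?a q = p\<close> t by auto
        ultimately show "(?a p = p) = (?a 1 = 1)" "(?a q = q) = (?a 2 = 2)" "(?a r = r) = (?a (2 * m + 1) = 2 * m + 1)"
          "(?a p = q) = (?a 1 = 2)" "(?a p = r) = (?a 1 = 2 * m + 1)" "(?a q = r) = (?a 2 = 2 * m + 1)"
          using p t m2 by (auto simp: v)
      qed (use t n m2 f in \<open>auto simp: transpose_def\<close>)
      then show ?thesis using f unfolding good_def rs_def by auto
    qed
    have c3: "good p q r" if t: "distinct [p, q, r]" "{p, q, r} \<subseteq> ?X"
      and p: "?a p \<noteq> q" "?a q \<noteq> r" "?a r \<noteq> p" "p \<le> 2 * m" "q \<le> 2 * m" "r \<le> 2 * m" for p q r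
    proof -
      have mv: "?a p \<noteq> p" "?a q \<noteq> q" "?a r \<noteq> r" "?a p \<noteq> r" using moved[of p] moved[of q] moved[of r] p t inv by auto
      \<comment> \<open>Two 2-cycles cannot hold three points with no two in the same one.\<close>
      have "m \<noteq> 2"
      proof
        assume "m = 2"
        then have "1 \<le> p \<and> p \<le> 4" "1 \<le> q \<and> q \<le> 4" "1 \<le> r \<and> r \<le> 4" using t p by auto
        then have "p = 1 \<or> p = 2 \<or> p = 3 \<or> p = 4" "q = 1 \<or> q = 2 \<or> q = 3 \<or> q = 4"
          "r = 1 \<or> r = 2 \<or> r = 3 \<or> r = 4" by arith+
        then show False using t(1) p mv \<open>m = 2\<close> by (auto simp: pairing_def)
      qed
      then have m4: "m \<ge> 4" using m4 by blast
      have "\<exists>h \<in> Alt n. ?w p q r = twist h (?w 1 3 5)"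
      proof (rule involution_triple[OF a inv t(1)])
        show "transpose 7 8 \<in> centralising ?X ?a" "\<not> evenperm (transpose 7 (8 :: nat))"
          using tr[of 7 8] n m4 by (auto simp: pairing_def)
        show "(?a p = p) = (?a 1 = 1)" "(?a q = q) = (?a 3 = 3)" "(?a r = r) = (?a 5 = 5)"
          "(?a p = q) = (?a 1 = 3)" "(?a p = r) = (?a 1 = 5)" "(?a q = r) = (?a 3 = 5)"
          using p mv m4 by (auto simp: v)
      qed (use t n m4 in \<open>auto simp: transpose_def\<close>)
      then show ?thesis using \<open>m \<noteq> 2\<close> n(2) unfolding good_def rs_def by auto
    qed
    have c4: "good p q r" if t: "distinct [p, q, r]" "{p, q, r} \<subseteq> ?X"
      and p: "?a p \<noteq> q" "p \<le> 2 * m" "q \<le> 2 * m" "r > 2 * m" for p q r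
    proof -
      have mv: "?a p \<noteq> p" "?a q \<noteq> q" "?a r = r" using moved[of p] moved[of q] moved[of r] p t inv by auto
      then have mv': "?a p \<noteq> r" "?a q \<noteq> r" using inv t by (metis distinct_length_2_or_more)+
      have f: "f > 0" using p t n by auto
      have iso: "(?a p = p) = (?a 1 = 1)" "(?a q = q) = (?a 3 = 3)" "(?a r = r) = (?a (2 * m + 1) = 2 * m + 1)"
          "(?a p = q) = (?a 1 = 3)" "(?a p = r) = (?a 1 = 2 * m + 1)" "(?a q = r) = (?a 3 = 2 * m + 1)"
        using p mv mv' m2 by (auto simp: v)
      have d: "distinct [1, 3, 2 * m + 1]" "{p, q, r, 1, 3, 2 * m + 1} \<subseteq> ?X" using t n m2 f by auto
      show ?thesis
      proof (cases "m = 2")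
        case False
        then have m4: "m \<ge> 4" using m4 by blast
        have "\<exists>h \<in> Alt n. ?w p q r = twist h ?w4"
        proof (rule involution_triple[OF a inv t(1) d iso])
          show "transpose 5 6 \<in> centralising ?X ?a" "\<not> evenperm (transpose 5 (6 :: nat))"
            using tr[of 5 6] n m4 by (auto simp: pairing_def)
        qed (use m4 in \<open>auto simp: transpose_def\<close>)
        then show ?thesis using f unfolding good_def rs_def by auto
      next
        case True
        then have f2: "f = 2" using n by auto
        obtain h where h: "h permutes ?X" "\<And>x. h (?a x) = ?a (h x)" "h 1 = p" "h 3 = q" "h (2 * m + 1) = r"
          using involution_triple_map[OF a inv t(1) d iso]
          by (auto simp: centralising_def)
        have "twist h ?a = ?a" using h by (auto simp: twist_def fun_eq_iff permutes_inverses)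
        then have hw: "?w p q r = twist h ?w4"
          using twist_mult[OF h(1), of ?a "cycle_of_list [1, 3, 2 * m + 1]"] twist_cycle[OF h(1) d(1)] h(3-5) by simp
        show ?thesis
        proof (cases "evenperm h")
          case True
          then show ?thesis using hw h(1) f unfolding good_def rs_def by auto
        next
          case False
          \<comment> \<open>An odd \<open>h\<close> becomes even after composition with
            \<open>o1\<close>, at the price of starting from the second representative
            \<open>twist o1 ?w4\<close>.\<close>
          have o: "o1 permutes ?X" "\<not> evenperm o1" "inv' o1 = o1"
            using n(4) by (auto simp: o1_def permutes_swap_id evenperm_swap)
          have "h \<circ> o1 \<in> Alt n" using o h(1) False by (simp add: even_permutes_comp[of ?X] permutes_compose)
          moreover have "twist (h \<circ> o1) (twist o1 ?w4) = twist h ?w4"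
            using twist_comp[OF o(1) h(1), of "twist o1 ?w4"] twist_inv_twist[OF o(1), of ?w4] o(3) by simp
          ultimately have "\<exists>k \<in> Alt n. ?w p q r = twist k (twist o1 ?w4)"
            unfolding hw by (intro bexI[of _ "h \<circ> o1"]) (simp_all only:)
          moreover have "twist o1 ?w4 \<in> set rs" using f2 \<open>m = 2\<close> by (simp add: rs_def del: cycle_of_list.simps)
          ultimately show ?thesis unfolding good_def by blast
        qed
      qed
    qed
    have c5: "good p q r" if t: "distinct [p, q, r]" "{p, q, r} \<subseteq> ?X"
      and p: "p \<le> 2 * m" "q > 2 * m" "r > 2 * m" for p q r
    proof -
      have mv: "?a p \<noteq> p" "?a q = q" "?a r = r" using moved[of p] moved[of q] moved[of r] p t by auto
      then have mv': "?a p \<noteq> q" "?a p \<noteq> r" using inv t by (metis distinct_length_2_or_more)+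
      have f: "f = 2" using p t n by auto
      have "\<exists>h \<in> Alt n. ?w p q r = twist h (?w 1 (2 * m + 1) (2 * m + 2))"
      proof (rule involution_triple[OF a inv t(1)])
        show "transpose 3 4 \<in> centralising ?X ?a" "\<not> evenperm (transpose 3 (4 :: nat))"
          using tr[of 3 4] n m2 by (auto simp: pairing_def)
        show "(?a p = p) = (?a 1 = 1)" "(?a q = q) = (?a (2 * m + 1) = 2 * m + 1)" "(?a r = r) = (?a (2 * m + 2) = 2 * m + 2)"
          "(?a p = q) = (?a 1 = 2 * m + 1)" "(?a p = r) = (?a 1 = 2 * m + 2)" "(?a q = r) = (?a (2 * m + 1) = 2 * m + 2)"
          using mv mv' t m2 by (auto simp: v)
      qed (use t n m2 f in \<open>auto simp: transpose_def\<close>)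
      then show ?thesis using f unfolding good_def rs_def by auto
    qed
    have not3: "\<not> (p > 2 * m \<and> q > 2 * m \<and> r > 2 * m)" using t(2,3) n by auto
    have main: "good p q r" if t: "distinct [p, q, r]" "{p, q, r} \<subseteq> ?X" and "p \<le> 2 * m" "q \<le> 2 * m" "r > 2 * m" for p q r
      using c2[OF t] c4[OF t] that by blast
    have t': "distinct [q, r, p]" "distinct [r, p, q]" "{q, r, p} \<subseteq> ?X" "{r, p, q} \<subseteq> ?X" using t(2,3) by auto
    \<comment> \<open>A rotation puts a single fixed point last, a single moved point first, or the
      two points of a common 2-cycle in consecutive places.\<close>
    have "good p q r \<or> good q r p \<or> good r p q"
    proof (cases "p \<le> 2 * m \<and> q \<le> 2 * m \<and> r \<le> 2 * m")
      case True
      then show ?thesis using c1[OF t(2,3)] c1[OF t'(1,3)] c1[OF t'(2,4)] c3[OF t(2,3)] by blast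
    next
      case False
      then show ?thesis
        using not3 main[OF t(2,3)] main[OF t'(1,3)] main[OF t'(2,4)] c5[OF t(2,3)] c5[OF t'(1,3)] c5[OF t'(2,4)]
        unfolding not_le[symmetric] by blast
    qed
    then have "good p q r" using rot[of q r p] rot[of r p q] t(2) t'(1) by blast
    then show "\<exists>x \<in> set rs. \<exists>h \<in> Alt n. ?a \<circ> twist g (cycle_of_list [1, 2, 3]) = twist h x"
      unfolding t(1) good_def .
  qed
  then show ?thesis using n(2) by (auto simp: rs_def split: if_splits)
qed


subsection \<open>Products of three-cycles\<close>

text \<open>A conjugator of unknown parity comes from \<open>list_transport\<close>. If it is odd,
  it is composed with \<open>c\<close>, which is odd and commutes with \<open>w\<close>.\<close>

lemma Alt_transport:
  assumes L: "distinct us" "distinct vs" "length us = length vs" "set us \<subseteq> {1..n}" "set vs \<subseteq> {1..n}"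
    and c: "c permutes {1..n}" "\<not> evenperm c" "twist c w = w"
    and W: "\<And>h. h permutes {1..n} \<Longrightarrow> map h us = vs \<Longrightarrow> twist h w = w'"
  shows "\<exists>h \<in> Alt n. w' = twist h w"
proof -
  obtain g where g: "g permutes {1..n}" "\<forall>k < length vs. g (us ! k) = vs ! k"
    using list_transport[of "{1..n}" vs us] L by auto
  have "map g us = vs" using g(2) L(3) by (intro nth_equalityI) auto
  then have w: "twist g w = w'" using W g(1) by blast
  show ?thesis
  proof (cases "evenperm g")
    case True
    then show ?thesis using g(1) w by auto
  next
    case False
    then have "g \<circ> c \<in> Alt n" using g(1) c by (simp add: even_permutes_comp[of "{1..n}"] permutes_compose)
    moreover have "twist (g \<circ> c) w = w'" using twist_comp[OF c(1) g(1), of w] c(3) w by simp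
    ultimately show ?thesis by metis
  qed
qed

lemma twist_fixed_points:
  assumes "\<And>x. x \<in> set cs \<Longrightarrow> c x = x" "c permutes X" "distinct cs"
  shows "twist c (cycle_of_list cs) = cycle_of_list cs"
  using twist_cycle[OF assms(2,3)] assms(1) by (simp add: map_idI)

text \<open>The cases go by the number of common points of the two three-cycles. None gives type 3+3
  and one gives a five-cycle; two give 2+2 or a three-cycle and three give a three-cycle or the
  identity, each according to orientation. From degree 7 on none of these types splits: the
  transposition of 6 and 7 commutes with the representatives of types 3, 2+2 and 5, and an odd
  permutation exchanges the two cycles of type 3+3.\<close>

lemma eta_three_cycles:
  assumes n: "n \<ge> 7"
  shows "eta (alt_group n) (class_prod n (cycle_of_list [1, 2, 3]) (cycle_of_list [1, 2, 3])) \<le> 5"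
proof -
  let ?X = "{1..n}" and ?c = "cycle_of_list [1, 2, 3 :: nat]"
  have a: "?c \<in> Alt n" by (rule cycle3_Alt) (use n in auto)
  let ?w3 = ?c and ?w22 = "cycle_of_list [1, 2] \<circ> cycle_of_list [3, 4 :: nat]"
    and ?w5 = "cycle_of_list [1, 2, 3, 4, 5 :: nat]" and ?w33 = "?c \<circ> cycle_of_list [4, 5, 6 :: nat]"
  let ?t = "transpose 6 (7 :: nat)"
  have t: "?t permutes ?X" "\<not> evenperm ?t" using n by (auto simp: permutes_swap_id evenperm_swap)
  have tf: "?t x = x" if "x \<le> 5" for x using that by (simp add: transpose_def)
  define rs where "rs = [id, ?w3, ?w22, ?w5, ?w33]"
  define ok where "ok = (\<lambda>w. \<exists>x \<in> set rs. \<exists>h \<in> Alt n. w = twist h x)"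
  have ok1: "ok id"
  proof -
    have "id \<in> Alt n" "id = twist id (id :: nat \<Rightarrow> nat)" by (simp_all add: permutes_id)
    then show ?thesis unfolding ok_def rs_def by (meson list.set_intros(1))
  qed
  have ok3: "ok (cycle_of_list [x, y, z])" if "distinct [x, y, z]" "{x, y, z} \<subseteq> ?X" for x y z
  proof -
    have "\<exists>h \<in> Alt n. cycle_of_list [x, y, z] = twist h ?w3"
    proof (rule Alt_transport[of "[1, 2, 3]" "[x, y, z]", OF _ _ _ _ _ t])
      show "twist ?t ?w3 = ?w3" by (rule twist_fixed_points[OF _ t(1)]) (auto simp: tf)
      show "twist h ?w3 = cycle_of_list [x, y, z]" if "h permutes ?X" "map h [1, 2, 3] = [x, y, z]" for h
        using twist_cycle[OF that(1), of "[1, 2, 3]"] that(2) by (simp del: cycle_of_list.simps)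
    qed (use that n in auto)
    then show ?thesis unfolding ok_def rs_def by auto
  qed
  have ok22: "ok (cycle_of_list [x, y] \<circ> cycle_of_list [z, u])" if "distinct [x, y, z, u]" "{x, y, z, u} \<subseteq> ?X" for x y z u
  proof -
    have "\<exists>h \<in> Alt n. cycle_of_list [x, y] \<circ> cycle_of_list [z, u] = twist h ?w22"
    proof (rule Alt_transport[of "[1, 2, 3, 4]" "[x, y, z, u]", OF _ _ _ _ _ t])
      show "twist ?t ?w22 = ?w22"
        unfolding twist_mult[OF t(1)]
        by (intro arg_cong2[of _ _ _ _ "(\<circ>)"] twist_fixed_points[OF _ t(1)]) (auto simp: tf)
      show "twist h ?w22 = cycle_of_list [x, y] \<circ> cycle_of_list [z, u]"
        if "h permutes ?X" "map h [1, 2, 3, 4] = [x, y, z, u]" for h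
        using twist_cycle[OF that(1), of "[1, 2]"] twist_cycle[OF that(1), of "[3, 4]"] that(2)
        by (simp add: twist_mult[OF that(1)] del: cycle_of_list.simps)
    qed (use that n in auto)
    then show ?thesis unfolding ok_def rs_def by auto
  qed
  have ok5: "ok (cycle_of_list [x, y, z, u, v])" if "distinct [x, y, z, u, v]" "{x, y, z, u, v} \<subseteq> ?X" for x y z u v
  proof -
    have "\<exists>h \<in> Alt n. cycle_of_list [x, y, z, u, v] = twist h ?w5"
    proof (rule Alt_transport[of "[1, 2, 3, 4, 5]" "[x, y, z, u, v]", OF _ _ _ _ _ t])
      show "twist ?t ?w5 = ?w5" by (rule twist_fixed_points[OF _ t(1)]) (auto simp: tf)
      show "twist h ?w5 = cycle_of_list [x, y, z, u, v]" if "h permutes ?X" "map h [1, 2, 3, 4, 5] = [x, y, z, u, v]" for h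
        using twist_cycle[OF that(1), of "[1, 2, 3, 4, 5]"] that(2) by (simp del: cycle_of_list.simps)
    qed (use that n in auto)
    then show ?thesis unfolding ok_def rs_def by auto
  qed
  have ok33: "ok (cycle_of_list [x, y, z] \<circ> cycle_of_list [u, v, s])"
    if "distinct [x, y, z, u, v, s]" "{x, y, z, u, v, s} \<subseteq> ?X" for x y z u v s
  proof -
    let ?s = "transpose 1 4 \<circ> (transpose 2 5 \<circ> transpose 3 (6 :: nat))"
    have s: "?s permutes ?X" using n by (intro permutes_compose permutes_swap_id) auto
    have so: "\<not> evenperm ?s"
      by (simp add: evenperm_comp permutation_swap_id permutation_compose evenperm_swap del: comp_apply)
    have "\<exists>h \<in> Alt n. cycle_of_list [x, y, z] \<circ> cycle_of_list [u, v, s] = twist h ?w33"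
    proof (rule Alt_transport[of "[1, 2, 3, 4, 5, 6]" "[x, y, z, u, v, s]", OF _ _ _ _ _ s so])
      have "twist ?s ?w33 = cycle_of_list [4, 5, 6] \<circ> cycle_of_list [1, 2, 3]"
      proof -
        have "twist ?s ?c = cycle_of_list [4, 5, 6]" "twist ?s (cycle_of_list [4, 5, 6]) = ?c"
          using twist_cycle[OF s, of "[1, 2, 3]"] twist_cycle[OF s, of "[4, 5, 6]"]
          by (simp_all add: transpose_def del: cycle_of_list.simps)
        then show ?thesis by (simp only: twist_mult[OF s])
      qed
      also have "\<dots> = ?w33" by (rule cycles_commute) auto
      finally show "twist ?s ?w33 = ?w33" .
      show "twist h ?w33 = cycle_of_list [x, y, z] \<circ> cycle_of_list [u, v, s]"
        if "h permutes ?X" "map h [1, 2, 3, 4, 5, 6] = [x, y, z, u, v, s]" for h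
        using twist_cycle[OF that(1), of "[1, 2, 3]"] twist_cycle[OF that(1), of "[4, 5, 6]"] that(2)
        by (simp add: twist_mult[OF that(1)] del: cycle_of_list.simps)
    qed (use that n in auto)
    then show ?thesis unfolding ok_def rs_def by auto
  qed
  have rot: "?c = cycle_of_list [2, 3, 1]" "?c = cycle_of_list [3, 1, 2]"
    using cycle3_rotate[of 1 2 "3 :: nat"] cycle3_rotate[of 2 3 "1 :: nat"] by simp_all
  have one: "ok (?c \<circ> cycle_of_list [p, q, r])"
    if "distinct [p, q, r]" "{p, q, r} \<subseteq> ?X" "p \<in> {1, 2, 3}" "q \<notin> {1, 2, 3}" "r \<notin> {1, 2, 3}" for p q r
  proof -
    note p = that(3)
    obtain b c where bc: "?c = cycle_of_list [p, b, c]" "distinct [p, b, c]" "{p, b, c} = {1, 2, 3}"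
    proof -
      consider "p = 1" | "p = 2" | "p = 3" using p by blast
      then show thesis
      proof cases
        case 1
        show thesis by (rule that[of 2 3]) (auto simp: 1)
      next
        case 2
        show thesis by (rule that[of 3 1]) (use 2 rot(1) in auto)
      next
        case 3
        show thesis by (rule that[of 1 2]) (use 3 rot(2) in auto)
      qed
    qed
    have bc': "b \<in> {1, 2, 3}" "c \<in> {1, 2, 3}" using bc(3) by blast+
    have "{1, 2, 3} \<subseteq> ?X" using n by auto
    then have d: "{p, q, r, b, c} \<subseteq> ?X" using bc' that(2) by blast
    have "q \<noteq> b" "q \<noteq> c" "r \<noteq> b" "r \<noteq> c" using bc' that(4,5) by blast+
    then have d': "distinct [p, q, r, b, c]" using that(1) bc(2) by auto
    have "cycle_of_list [p, b, c] \<circ> cycle_of_list [p, q, r] = cycle_of_list [p, q, r, b, c]"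
      using d' by (intro ext) (auto simp: transpose_def)
    then show ?thesis using ok5[OF d' d] bc(1) by (simp del: cycle_of_list.simps)
  qed
  have two: "ok (?c \<circ> cycle_of_list [p, q, r])"
    if "distinct [p, q, r]" "{p, q, r} \<subseteq> ?X" "p \<in> {1, 2, 3}" "q \<in> {1, 2, 3}" "r \<notin> {1, 2, 3}" for p q r
  proof -
    note pq = that(1,3,4)
    have "(\<exists>c. ?c = cycle_of_list [p, q, c] \<and> c \<in> {1, 2, 3} - {p, q}) \<or> (\<exists>c. ?c = cycle_of_list [q, p, c] \<and> c \<in> {1, 2, 3} - {p, q})"
    proof -
      consider "p = 1" "q = 2" | "p = 2" "q = 3" | "p = 3" "q = 1" | "p = 2" "q = 1" | "p = 3" "q = 2" | "p = 1" "q = 3"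
        using pq by auto
      then show ?thesis
      proof cases
        case 1 show ?thesis by (rule disjI1, rule exI[of _ 3]) (simp add: 1)
      next
        case 2 show ?thesis using rot(1) by (intro disjI1 exI[of _ 1]) (simp add: 2 del: cycle_of_list.simps)
      next
        case 3 show ?thesis using rot(2) by (intro disjI1 exI[of _ 2]) (simp add: 3 del: cycle_of_list.simps)
      next
        case 4 show ?thesis by (rule disjI2, rule exI[of _ 3]) (simp add: 4)
      next
        case 5 show ?thesis using rot(1) by (intro disjI2 exI[of _ 1]) (simp add: 5 del: cycle_of_list.simps)
      next
        case 6 show ?thesis using rot(2) by (intro disjI2 exI[of _ 2]) (simp add: 6 del: cycle_of_list.simps)
      qed
    qed
    then show ?thesis
    proof (elim disjE exE conjE)
      fix c assume c: "?c = cycle_of_list [p, q, c]" "c \<in> {1, 2, 3} - {p, q}"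
      have d: "distinct [p, c, q, r]" "{p, c, q, r} \<subseteq> ?X" using that c(2) n by auto
      have "cycle_of_list [p, q, c] \<circ> cycle_of_list [p, q, r] = cycle_of_list [p, c] \<circ> cycle_of_list [q, r]"
        using d(1) by (intro ext) (auto simp: transpose_def)
      then show ?thesis using ok22[OF d] c(1) by (simp del: cycle_of_list.simps)
    next
      fix c assume c: "?c = cycle_of_list [q, p, c]" "c \<in> {1, 2, 3} - {p, q}"
      have d: "distinct [q, r, c]" "{q, r, c} \<subseteq> ?X" "distinct [p, q, r, c]" using that c(2) n by auto
      have "cycle_of_list [q, p, c] \<circ> cycle_of_list [p, q, r] = cycle_of_list [q, r, c]"
        using d(3) by (intro ext) (auto simp: transpose_def)
      then show ?thesis using ok3[OF d(1,2)] c(1) by (simp del: cycle_of_list.simps)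
    qed
  qed
  have three: "ok (?c \<circ> cycle_of_list [p, q, r])"
    if "distinct [p, q, r]" "p \<in> {1, 2, 3}" "q \<in> {1, 2, 3}" "r \<in> {1, 2, 3}" for p q r
  proof -
    note pqr = that
    have "?c = cycle_of_list [p, q, r] \<or> ?c = cycle_of_list [p, r, q]"
    proof -
      consider "p = 1" "q = 2" "r = 3" | "p = 2" "q = 3" "r = 1" | "p = 3" "q = 1" "r = 2"
        | "p = 2" "q = 1" "r = 3" | "p = 3" "q = 2" "r = 1" | "p = 1" "q = 3" "r = 2"
        using pqr by auto
      then show ?thesis
      proof cases
        case 4 then show ?thesis using rot(1) by (intro disjI2) (simp only:)
      next
        case 5 then show ?thesis using rot(2) by (intro disjI2) (simp only:)
      qed (use rot in \<open>simp_all only: simp_thms\<close>)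
    qed
    then show ?thesis
    proof
      assume c: "?c = cycle_of_list [p, q, r]"
      have "cycle_of_list [p, q, r] \<circ> cycle_of_list [p, q, r] = cycle_of_list [p, r, q]"
        using that(1) by (intro ext) (auto simp: transpose_def)
      moreover have "distinct [p, r, q]" "{p, r, q} \<subseteq> ?X" using that n by auto
      ultimately show ?thesis using ok3 c by metis
    next
      assume c: "?c = cycle_of_list [p, r, q]"
      have "cycle_of_list [p, r, q] \<circ> cycle_of_list [p, q, r] = id"
        using that(1) by (intro ext) (auto simp: transpose_def)
      then show ?thesis using ok1 c by metis
    qed
  qed
  have zero: "ok (?c \<circ> cycle_of_list [p, q, r])"
    if "distinct [p, q, r]" "{p, q, r} \<subseteq> ?X" "p \<notin> {1, 2, 3}" "q \<notin> {1, 2, 3}" "r \<notin> {1, 2, 3}" for p q r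
    by (rule ok33) (use that n in auto)
  have "eta (alt_group n) (class_prod n ?c ?c) \<le> length rs"
  proof (rule eta_le[OF a a])
    fix g assume g: "g \<in> Alt n"
    obtain p q r where t: "twist g ?c = cycle_of_list [p, q, r]" "distinct [p, q, r]" "{p, q, r} \<subseteq> ?X"
      using twist_cycle3_form[OF g, of 1 2 3] n by auto
    have t': "distinct [q, r, p]" "distinct [r, p, q]" "{q, r, p} \<subseteq> ?X" "{r, p, q} \<subseteq> ?X" using t(2,3) by auto
    have r: "cycle_of_list [p, q, r] = cycle_of_list [q, r, p]" "cycle_of_list [p, q, r] = cycle_of_list [r, p, q]"
      using cycle3_rotate[OF t(2)] cycle3_rotate[OF t'(1)] by simp_all
    define S :: "nat set" where "S = {1, 2, 3}"
    define P where "P = ok (?c \<circ> cycle_of_list [p, q, r])"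
    note P1 = P_def and P2 = P_def[unfolded r(1)] and P3 = P_def[unfolded r(2)]
    have "p \<notin> S \<Longrightarrow> q \<notin> S \<Longrightarrow> r \<notin> S \<Longrightarrow> P" unfolding P1 S_def by (rule zero[OF t(2,3)])
    moreover have "p \<in> S \<Longrightarrow> q \<notin> S \<Longrightarrow> r \<notin> S \<Longrightarrow> P" unfolding P1 S_def by (rule one[OF t(2,3)])
    moreover have "q \<in> S \<Longrightarrow> r \<notin> S \<Longrightarrow> p \<notin> S \<Longrightarrow> P" unfolding P2 S_def by (rule one[OF t'(1,3)])
    moreover have "r \<in> S \<Longrightarrow> p \<notin> S \<Longrightarrow> q \<notin> S \<Longrightarrow> P" unfolding P3 S_def by (rule one[OF t'(2,4)])
    moreover have "p \<in> S \<Longrightarrow> q \<in> S \<Longrightarrow> r \<notin> S \<Longrightarrow> P" unfolding P1 S_def by (rule two[OF t(2,3)])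
    moreover have "q \<in> S \<Longrightarrow> r \<in> S \<Longrightarrow> p \<notin> S \<Longrightarrow> P" unfolding P2 S_def by (rule two[OF t'(1,3)])
    moreover have "r \<in> S \<Longrightarrow> p \<in> S \<Longrightarrow> q \<notin> S \<Longrightarrow> P" unfolding P3 S_def by (rule two[OF t'(2,4)])
    moreover have "p \<in> S \<Longrightarrow> q \<in> S \<Longrightarrow> r \<in> S \<Longrightarrow> P" unfolding P1 S_def by (rule three[OF t(2)])
    ultimately have "ok (?c \<circ> cycle_of_list [p, q, r])" unfolding P_def[symmetric] by blast
    then show "\<exists>x \<in> set rs. \<exists>h \<in> Alt n. ?c \<circ> twist g ?c = twist h x"
      unfolding t(1) ok_def .
  qed
  then show ?thesis by (simp add: rs_def del: cycle_of_list.simps)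
qed

subsection \<open>Categories of cycle types\<close>

text \<open>A category \<open>(E, t, full)\<close> with \<open>t = 0\<close> prescribes the lengths \<open>E\<close> of some cycles, and with \<open>full\<close>
  also that all other points are fixed; with \<open>t > 0\<close> it asks for a further cycle of length at least \<open>t\<close>.\<close>

type_synonym category = "nat list \<times> nat \<times> bool"

fun in_category :: "'a set \<Rightarrow> ('a \<Rightarrow> 'a) \<Rightarrow> category \<Rightarrow> bool" where
  "in_category X f (E, t, full) \<longleftrightarrow> (\<exists>css ds. cycles_of X f (css @ ds) \<and> map length css = E \<and>
     (if t = 0 then ds = [] else \<exists>d. ds = [d] \<and> t \<le> length d) \<and>
     (full \<longrightarrow> t = 0 \<and> (\<forall>x \<in> X - set (concat css). f x = x)))"

text \<open>Inclusion of multisets in a recursive form that evaluates directly on literal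
  lists.\<close>

fun sublist_mset :: "nat list \<Rightarrow> nat list \<Rightarrow> bool" where
  "sublist_mset [] ys = True"
| "sublist_mset (x # xs) ys \<longleftrightarrow> x \<in> set ys \<and> sublist_mset xs (remove1 x ys)"

text \<open>The unfinished block of length \<open>m\<close> is cut from a cycle of \<open>E\<close>,
  which is then taken out of the supply for the other blocks, or from the long cycle promised by
  \<open>t\<close>. Equality of lengths is left to \<open>Open\<close>, as a block that exhausts its
  cycle does close.\<close>

fun has_subform :: "category \<Rightarrow> nat list \<Rightarrow> ending \<Rightarrow> bool" where
  "has_subform (E, t, full) ls Closed \<longleftrightarrow> sublist_mset ls E"
| "has_subform (E, t, full) ls e \<longleftrightarrow> ls \<noteq> [] \<and> (let m = last ls; F = butlast ls in 0 < m \<and>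
     ((\<exists>l \<in> set E. (m < l \<or> m = l \<and> e = Open) \<and> sublist_mset (l # F) E) \<or>
      0 < t \<and> (m < t \<or> m = t \<and> e = Open) \<and> sublist_mset F E))"

lemma sublist_mset_lengths:
  assumes "sublist_mset ls (map length css)"
  shows "\<exists>ds. map length ds = ls \<and> mset ds \<subseteq># mset css"
  using assms
proof (induction ls arbitrary: css)
  case (Cons l ls)
  then obtain c where c: "c \<in> set css" "length c = l" by auto
  have "mset (remove1 l (map length css)) = mset (map length (remove1 c css))"
    using c by (simp add: image_mset_Diff)
  moreover have sub_cong: "sublist_mset xs ys \<longleftrightarrow> sublist_mset xs zs" if "mset ys = mset zs" for xs ys zs
    using that
  proof (induction xs arbitrary: ys zs)
    case (Cons x xs)
    then have "mset (remove1 x ys) = mset (remove1 x zs)" by simp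
    from Cons.IH[OF this] show ?case using mset_eq_setD[OF Cons.prems] by simp
  qed simp
  ultimately have "sublist_mset ls (map length (remove1 c css))" using Cons.prems by (metis sublist_mset.simps(2))
  from Cons.IH[OF this] obtain ds where ds: "map length ds = ls" "mset ds \<subseteq># mset (remove1 c css)" by blast
  then have "map length (c # ds) = l # ls" "mset (c # ds) \<subseteq># mset css"
    using c by (simp_all add: insert_subset_eq_iff)
  then show ?case by (intro exI[of _ "c # ds"] conjI)
qed simp

lemma category_form:
  assumes "in_category X f c" "has_subform c ls e"
  shows "has_form X f ls e"
proof -
  obtain E t full where c: "c = (E, t, full)" by (cases c)
  obtain css ds where css: "cycles_of X f (css @ ds)" "map length css = E"
    "if t = 0 then ds = [] else \<exists>d. ds = [d] \<and> t \<le> length d"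
    using assms(1) c by auto
  show ?thesis
  proof (cases "e = Closed")
    case True
    then have "sublist_mset ls (map length css)" using assms(2) c css(2) by simp
    then obtain bs where bs: "map length bs = ls" "mset bs \<subseteq># mset css" using sublist_mset_lengths by blast
    have "mset bs \<subseteq># mset (css @ ds)" using bs(2) by (simp add: subset_mset.add_increasing2)
    from form_closed[OF cycles_of_subset[OF css(1) this]] show ?thesis
      using bs(1) True by (auto simp: has_form_def)
  next
    case False
    define m F where "m = last ls" and "F = butlast ls"
    have ls: "ls = F @ [m]" "0 < m" and
      alt: "(\<exists>l \<in> set E. (m < l \<or> m = l \<and> e = Open) \<and> sublist_mset (l # F) E) \<or>
        0 < t \<and> (m < t \<or> m = t \<and> e = Open) \<and> sublist_mset F E"
      using assms(2) c False by (cases e; auto simp: m_def F_def Let_def)+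
    consider l where "l \<in> set E" "m < l \<or> m = l \<and> e = Open" "sublist_mset (l # F) E"
      | "0 < t" "m < t \<or> m = t \<and> e = Open" "sublist_mset F E"
      using alt by blast
    then have "\<exists>bs d. cycles_of X f (bs @ [d]) \<and> map length bs = F \<and> (m < length d \<or> m = length d \<and> e = Open)"
    proof cases
      case l: (1 l)
      from sublist_mset_lengths[of "l # F" css, unfolded css(2), OF l(3)]
      obtain cs where cs: "map length cs = l # F" "mset cs \<subseteq># mset css" by (elim exE conjE)
      then obtain d bs where d: "cs = d # bs" "length d = l" "map length bs = F" by (cases cs) auto
      have "mset (bs @ [d]) \<subseteq># mset (css @ ds)" using cs(2) d(1) by (simp add: subset_mset.add_increasing2)
      from cycles_of_subset[OF css(1) this] show ?thesis using d l(2) by blast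
    next
      case t: 2
      then obtain d where d: "ds = [d]" "t \<le> length d" using css(3) by auto
      from sublist_mset_lengths[of F css, unfolded css(2), OF t(3)]
      obtain bs where bs: "map length bs = F" "mset bs \<subseteq># mset css" by (elim exE conjE)
      have "mset (bs @ [d]) \<subseteq># mset (css @ ds)" using bs(2) d(1) by simp
      from cycles_of_subset[OF css(1) this] show ?thesis using d bs t(2) by force
    qed
    then obtain bs d where d: "cycles_of X f (bs @ [d])" "map length bs = F" "m < length d \<or> m = length d \<and> e = Open"
      by blast
    have "e = Open \<or> e = Strict \<and> m < length d" using False d(3) by (cases e) auto
    moreover have "m \<le> length d" using d(3) by auto
    ultimately show ?thesis using form_open[OF d(1) ls(2), of e] d(2) ls(1) by simp
  qed
qed

text \<open>Three ways to make the unknown points harmless. \<open>Robust\<close> allows unfinished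
  blocks on both sides but counts only fixed points. \<open>Exact\<close> takes complete cycles on
  both sides and sees the whole profile. \<open>Stretched\<close> confronts an unfinished cycle with
  a permutation that fixes everything outside the form, and sees the first two counts.\<close>

datatype pattern =
    Robust "nat list" ending "nat list" ending "(nat list \<times> (nat \<times> nat) list) list"
  | Exact "nat list" "nat list" "(nat list \<times> (nat \<times> nat) list) list"
  | Stretched "nat list" "nat list" "(nat list \<times> (nat \<times> nat) list) list"

fun valid_pattern :: "pattern \<Rightarrow> bool" where
  "valid_pattern (Robust ls e ms f vs) \<longleftrightarrow> pattern_ok ls e ms f vs"
| "valid_pattern (Exact ls ms vs) \<longleftrightarrow> exact_ok ls ms vs"
| "valid_pattern (Stretched ls ms vs) \<longleftrightarrow> strict_ok ls ms vs"

fun pattern_size :: "pattern \<Rightarrow> nat" where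
  "pattern_size (Robust ls e ms f vs) = length vs"
| "pattern_size (Exact ls ms vs) = length vs"
| "pattern_size (Stretched ls ms vs) = length vs"

text \<open>For \<open>Stretched\<close>, equality of the lists without ones means that all
  nontrivial cycles of the second permutation lie in the form; only fixed points may be left
  out.\<close>

fun applies :: "category \<Rightarrow> category \<Rightarrow> pattern \<Rightarrow> bool" where
  "applies c d (Robust ls e ms f vs) \<longleftrightarrow> has_subform c ls e \<and> has_subform d ms f"
| "applies c d (Exact ls ms vs) \<longleftrightarrow> has_subform c ls Closed \<and> has_subform d ms Closed"
| "applies c d (Stretched ls ms vs) \<longleftrightarrow> has_subform c ls Strict \<and>
     snd d = (0, True) \<and> has_subform d ms Closed \<and> filter (\<lambda>l. l \<noteq> 1) ms = filter (\<lambda>l. l \<noteq> 1) (fst d)"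

lemma many_by_applies:
  assumes X: "finite X" "a permutes X" "b permutes X"
    and "in_category X a c" "in_category X b d" "valid_pattern p" "applies c d p"
  shows "many (pattern_size p) X a b"
proof (cases p)
  case (Robust ls e ms f vs)
  then have h: "has_subform c ls e" "has_subform d ms f" "pattern_ok ls e ms f vs" using assms(6,7) by auto
  show ?thesis
    using many_by_pattern[OF X category_form[OF assms(4) h(1)] category_form[OF assms(5) h(2)] h(3)] Robust by simp
next
  case (Exact ls ms vs)
  then have h: "has_subform c ls Closed" "has_subform d ms Closed" "exact_ok ls ms vs" using assms(6,7) by auto
  show ?thesis
    using many_by_exact[OF X category_form[OF assms(4) h(1)] category_form[OF assms(5) h(2)] h(3)] Exact by simp
next
  case (Stretched ls ms vs)
  obtain E where d: "d = (E, 0, True)" "sublist_mset ms E" "filter (\<lambda>l. l \<noteq> 1) ms = filter (\<lambda>l. l \<noteq> 1) E"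
    using assms(7) Stretched by (cases d) auto
  have c: "has_subform c ls Strict" and ok: "strict_ok ls ms vs" using assms(6,7) Stretched by auto
  obtain css where css: "cycles_of X b css" "map length css = E" "\<forall>x \<in> X - set (concat css). b x = x"
    using assms(5) d by auto
  from sublist_mset_lengths[of ms css, unfolded css(2), OF d(2)]
  obtain bs where bs: "map length bs = ms" "mset bs \<subseteq># mset css" by (elim exE conjE)
  then obtain rs where rs: "mset css = mset bs + mset rs" by (metis ex_mset subset_mset.le_iff_add)
  have "filter_mset (\<lambda>l. l \<noteq> 1) (mset E) = filter_mset (\<lambda>l. l \<noteq> 1) (mset ms)"
    using d(3) by (metis mset_filter)
  moreover have "mset E = mset ms + mset (map length rs)"
    using arg_cong[OF rs, of "image_mset length"] css(2) bs(1) by (metis image_mset_union mset_map)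
  ultimately have "filter_mset (\<lambda>l. l \<noteq> 1) (mset (map length rs)) = {#}" by (simp del: mset_map)
  then have "filter (\<lambda>l. l \<noteq> 1) (map length rs) = []" by (metis mset_filter mset_zero_iff)
  then have one: "length r = 1" if "r \<in> set rs" for r
    using that by (simp add: filter_empty_conv)
  have "b x = x" if x: "x \<in> X - set (concat bs)" for x
  proof (cases "x \<in> set (concat css)")
    case True
    then obtain r where r: "r \<in> set css" "x \<in> set r" by auto
    then have "r \<in> set rs" using x mset_eq_setD[of css "bs @ rs"] rs by auto
    then have "length r = Suc 0" using one by simp
    then have "r = [x]" using r(2) by (auto simp: length_Suc_conv)
    then have "cyclic b [x]" using css(1) r(1) by (auto simp: cycles_of_def)
    then show ?thesis by (simp add: cyclic_def)
  qed (use css(3) x in blast)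
  moreover have "cycles_of X b bs" by (rule cycles_of_subset[OF css(1) bs(2)])
  ultimately show ?thesis
    using many_by_strict[OF X category_form[OF assms(4) c] form_closed[of X b bs, unfolded bs(1)] _ ok] Stretched by simp
qed

text \<open>Whether a pattern serves a pair of categories depends only on its blocks, its endings
  and the number of its entries. Without the labellings, the evaluations over all pairs run on small
  terms, and each certificate is validated only once.\<close>

fun shape :: "pattern \<Rightarrow> pattern \<times> nat" where
  "shape (Robust ls e ms f vs) = (Robust ls e ms f [], length vs)"
| "shape (Exact ls ms vs) = (Exact ls ms [], length vs)"
| "shape (Stretched ls ms vs) = (Stretched ls ms [], length vs)"

lemma shape_simps: "applies c d (fst (shape p)) = applies c d p" "snd (shape p) = pattern_size p"
  by (cases p; simp)+

definition resolves :: "(pattern \<times> nat) list \<Rightarrow> nat \<Rightarrow> category \<Rightarrow> category \<Rightarrow> bool" where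
  "resolves ss k c d \<longleftrightarrow> (\<exists>s \<in> set ss. k \<le> snd s \<and> (applies c d (fst s) \<or> applies d c (fst s)))"

lemma resolves_sym: "resolves ss k c d \<Longrightarrow> resolves ss k d c"
  unfolding resolves_def by blast

lemma many_by_resolves:
  assumes X: "finite X" "a permutes X" "b permutes X"
    and "\<forall>p \<in> set ps. valid_pattern p" "resolves (map shape ps) k c d" "in_category X a c" "in_category X b d"
  shows "many k X a b"
proof -
  obtain p where p: "p \<in> set ps" "k \<le> pattern_size p" "applies c d p \<or> applies d c p"
    using assms(5) unfolding resolves_def by (auto simp: shape_simps)
  have "valid_pattern p" using assms(4) p(1) by blast
  from p(3) have "many (pattern_size p) X a b"
  proof
    assume "applies c d p"
    then show ?thesis using many_by_applies[OF X assms(6,7) \<open>valid_pattern p\<close>] by blast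
  next
    assume "applies d c p"
    then have "many (pattern_size p) X b a"
      using many_by_applies[OF X(1,3,2) assms(7,6) \<open>valid_pattern p\<close>] by blast
    then show ?thesis using many_sym[OF X(1,3,2)] by blast
  qed
  then show ?thesis using many_mono p(2) by blast
qed

subsection \<open>Every even permutation belongs to a category\<close>

definition type_of :: "'a set \<Rightarrow> ('a \<Rightarrow> 'a) \<Rightarrow> nat list \<Rightarrow> bool" where
  "type_of X f ls \<longleftrightarrow> (\<exists>css. cycles_of X f css \<and> set (concat css) = X \<and> map length css = ls)"

lemma type_exists:
  assumes "f permutes X" "finite X" "evenperm f" "f \<noteq> id"
  shows "\<exists>ls. type_of X f ls \<and> sorted_wrt (\<ge>) ls \<and> 0 \<notin> set ls \<and> sum_list ls = card X \<and>
    even (length (filter even ls)) \<and> \<not> set ls \<subseteq> {1}"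
proof -
  obtain css where css: "cycles_of X f css" "set (concat css) = X" "sorted_wrt (\<ge>) (map length css)"
    "sum_list (map length css) = card X"
    by (rule sorted_cycles_exist[OF assms(1,2)])
  have "\<not> set (map length css) \<subseteq> {1}"
  proof
    assume one: "set (map length css) \<subseteq> {1}"
    have "f x = x" for x
    proof (cases "x \<in> X")
      case True
      then obtain c where c: "c \<in> set css" "x \<in> set c" using css(2) by auto
      have "length c = 1" using one c(1) by auto
      then have "c = [x]" using c(2) by (cases c) auto
      then show ?thesis using css(1) c(1) by (auto simp: cycles_of_def cyclic_def)
    qed (use assms(1) in \<open>simp add: permutes_not_in\<close>)
    then show False using assms(4) by auto
  qed
  moreover have "0 \<notin> set (map length css)" using css(1) by (auto simp: cycles_of_def cyclic_def)
  moreover have "even (length (filter even (map length css)))"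
    using even_cycles[OF assms(1) css(1,2)] assms(3) by simp
  ultimately show ?thesis using css unfolding type_of_def by blast
qed

lemma type_closed:
  assumes "type_of X f ls" "mset E \<subseteq># mset ls"
  shows "in_category X f (E, 0, False)"
proof -
  obtain css where css: "cycles_of X f css" "map length css = ls" using assms(1) by (auto simp: type_of_def)
  obtain ds where "map length ds = E" "mset ds \<subseteq># mset css"
  proof -
    have "sublist_mset E (map length css)" if "mset E \<subseteq># mset (map length css)" for E
      using that
    proof -
      have "sublist_mset xs ys" if "mset xs \<subseteq># mset ys" for xs ys
        using that
      proof (induction xs arbitrary: ys)
        case (Cons x xs)
        then have "x \<in> set ys" "mset xs \<subseteq># mset (remove1 x ys)"
          by (auto simp: insert_subset_eq_iff)
        then show ?case using Cons.IH by simp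
      qed simp
      then show ?thesis using that by blast
    qed
    then show ?thesis using sublist_mset_lengths assms(2) css(2) that by metis
  qed
  then show ?thesis using cycles_of_subset[OF css(1)] by (auto intro!: exI[of _ ds])
qed

lemma type_tail:
  assumes "type_of X f (E @ l # rest)" "0 < t" "t \<le> l"
  shows "in_category X f (E, t, False)"
proof -
  obtain css where css: "cycles_of X f css" "map length css = E @ l # rest" using assms(1) by (auto simp: type_of_def)
  then obtain bs d r where d: "css = bs @ d # r" "map length bs = E" "length d = l"
    by (auto simp: map_eq_append_conv)
  have "mset (bs @ [d]) \<subseteq># mset css" using d(1) by simp
  from cycles_of_subset[OF css(1) this] show ?thesis using d assms(2,3) by auto
qed

lemma type_full:
  assumes "type_of X f (E @ rest)" "set rest \<subseteq> {1}"
  shows "in_category X f (E, 0, True)"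
proof -
  obtain css where css: "cycles_of X f css" "set (concat css) = X" "map length css = E @ rest"
    using assms(1) by (auto simp: type_of_def)
  then obtain bs r where r: "css = bs @ r" "map length bs = E" "map length r = rest"
    by (auto simp: map_eq_append_conv)
  have "f x = x" if x: "x \<in> X - set (concat bs)" for x
  proof -
    obtain c where c: "c \<in> set r" "x \<in> set c" using x css(2) r(1) by auto
    have "length c \<in> set rest" using c(1) r(3) by auto
    then have "length c = 1" using assms(2) by blast
    then have "c = [x]" using c(2) by (cases c) auto
    then have "cyclic f [x]" using css(1) c(1) r(1) by (auto simp: cycles_of_def)
    then show ?thesis by (simp add: cyclic_def)
  qed
  moreover have "cycles_of X f bs" using css(1) r(1) by (auto simp: cycles_of_def)
  ultimately show ?thesis using r(2) by auto
qed

text \<open>Each category comes with the number of classes that it guarantees; only involutions without fixed points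
  or with exactly one give fewer than five.\<close>

definition categories :: "nat \<Rightarrow> (category \<times> nat) list" where
  "categories k =
    [(([], 9, False), 5), (([8], 0, False), 5), (([7], 1, False), 5), (([6, 2], 0, False), 5), (([6], 3, False), 5),
     (([5], 4, False), 5), (([5, 3], 0, False), 5), (([5, 2, 2], 0, False), 5), (([5, 1, 1, 1, 1], 0, False), 5),
     (([4, 4], 0, False), 5), (([4, 3, 2], 0, False), 5), (([4, 2, 2, 2], 0, False), 5), (([4, 2, 1, 1, 1], 0, False), 5),
     (([3, 3, 3], 0, False), 5), (([3, 3, 2, 2], 0, False), 5), (([3, 3, 1, 1, 1], 0, False), 5),
     (([3, 2, 2, 2, 2], 0, False), 5), (([3, 2, 2, 1, 1], 0, False), 5), (([3, 1, 1, 1, 1, 1, 1], 0, True), 5),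
     (([2, 2, 1, 1, 1, 1, 1], 0, True), 5), (([2, 2, 2, 2, 1, 1], 0, False), 5)] @
    (if k = 0 then [(([2, 2, 2, 2], 0, False), 2)] else if k = 1 then [(([2, 2, 2, 2, 1], 0, False), 4)] else [])"

lemma ones_after:
  assumes "sorted_wrt (\<ge>) (us @ (1 :: nat) # vs)" "0 \<notin> set (us @ 1 # vs)"
  shows "vs = replicate (length vs) 1"
proof -
  have "v = 1" if "v \<in> set vs" for v
  proof -
    have "v \<le> 1" using assms(1) that by (auto simp: sorted_wrt_append)
    moreover have "v \<noteq> 0" using assms(2) that by (intro notI) simp
    ultimately show ?thesis by linarith
  qed
  then show ?thesis by (simp add: replicate_length_same)
qed

text \<open>The type is read from its largest cycle downwards until a listed piece appears. The
  bound \<open>n \<ge> 9\<close> guarantees a next cycle while the piece is incomplete, and the even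
  number of even lengths removes the branches without a category.\<close>

lemma category_exists:
  fixes ls :: "nat list"
  assumes f: "type_of X f ls" and srt: "sorted_wrt (\<ge>) ls" and pos: "0 \<notin> set ls" and sum: "sum_list ls = n"
    and n: "n \<ge> 9" and ev: "even (length (filter even ls))" and ne: "\<not> set ls \<subseteq> {1}"
  shows "\<exists>c \<in> set (categories (n mod 4)). in_category X f (fst c)"
proof -
  let ?thesis' = "\<exists>c \<in> set (categories (n mod 4)). in_category X f (fst c)"
  have pick: ?thesis' if "(c, r) \<in> set (categories (n mod 4))" "in_category X f c" for c r
    using that by force
  note closed = type_closed[OF f]
  have tail: "in_category X f (E, t, False)" if "ls = E @ l # rest" "0 < t" "t \<le> l" for E l rest t
    using type_tail f that by blast
  have full: "in_category X f (E, 0, True)" if "ls = E @ rest" "set rest \<subseteq> {1}" for E rest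
    using type_full f that by blast
  have ones: "vs = replicate (length vs) 1" if "ls = us @ 1 # vs" for us vs
    using ones_after[of us vs] srt pos that by simp
  have le: "y \<le> x" if "ls = us @ x # vs" "y \<in> set vs" for us x vs y
    using srt that by (auto simp: sorted_wrt_append)
  have gt: "y \<ge> 1" if "y \<in> set ls" for y using pos that by (cases y) auto
  obtain x l1 where l1: "ls = x # l1" using sum n by (cases ls) auto
  have x2: "x \<ge> 2"
  proof (rule ccontr)
    assume "\<not> x \<ge> 2"
    then have "x = 1" using gt[of x] l1 by auto
    then have "set l1 \<subseteq> {1}" using ones[of "[]" l1] l1 set_replicate_conv_if[of "length l1" 1]
      by (metis append_Nil empty_subsetI subset_refl)
    then have "set ls \<subseteq> {1}" using l1 \<open>x = 1\<close> by simp
    then show False using ne by blast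
  qed
  have nxt: "\<exists>y l'. vs = y # l' \<and> 1 \<le> y \<and> y \<le> x" if "ls = us @ x # vs" "sum_list (us @ [x]) < n" for us x vs
  proof -
    have "vs \<noteq> []" using that sum by auto
    then obtain y l' where "vs = y # l'" by (cases vs) auto
    moreover from this have "1 \<le> y" "y \<le> x" using gt[of y] le[OF that(1), of y] that(1) by auto
    ultimately show ?thesis by blast
  qed
  have rep: "\<exists>v. vs = replicate k 1 @ v" if "ls = us @ 1 # vs" "sum_list us + 1 + k \<le> n" for us vs k
  proof -
    have v: "vs = replicate (length vs) 1" using ones[OF that(1)] .
    have "sum_list vs = length vs" using arg_cong[OF v, of sum_list] by (simp add: sum_list_replicate)
    then have "k \<le> length vs" using that sum by simp
    then show ?thesis using v by (metis le_Suc_ex replicate_add)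
  qed
  \<comment> \<open>After the first 1 only ones follow, so the number of even lengths before it must
    already be even.\<close>
  have noev: "even (length (filter even (us @ [1])))" if "ls = us @ 1 # vs" for us vs
  proof -
    have "filter even vs = []" using ones[OF that] by (metis filter_False in_set_replicate odd_one)
    then show ?thesis using ev that by simp
  qed
  consider "x \<ge> 9" | "x = 8" | "x = 7" | "x = 6" | "x = 5" | "x = 4" | "x = 3" | "x = 2" using x2 by linarith
  then show ?thesis
  proof cases
    case 1
    have "in_category X f ([], 9, False)" by (rule tail[of "[]" x l1]) (use l1 1 in auto)
    then show ?thesis by (rule pick[rotated, where r = 5]) (simp add: categories_def)
  next
    case 2
    have "in_category X f ([8], 0, False)" by (rule closed) (use l1 2 in simp)
    then show ?thesis by (rule pick[rotated, where r = 5]) (simp add: categories_def)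
  next
    case 3
    obtain y l2 where y: "l1 = y # l2" "1 \<le> y" using nxt[of "[]" x l1] l1 3 n by auto
    have "in_category X f ([7], 1, False)" by (rule tail[of "[7]" y l2]) (use l1 3 y in auto)
    then show ?thesis by (rule pick[rotated, where r = 5]) (simp add: categories_def)
  next
    case 4
    obtain y l2 where y: "l1 = y # l2" "1 \<le> y" using nxt[of "[]" x l1] l1 4 n by auto
    consider "y = 1" | "y = 2" | "y \<ge> 3" using y by linarith
    then show ?thesis
    proof cases
      case 1
      then show ?thesis using noev[of "[6]" l2] l1 y 4 by simp
    next
      case 2
      have "in_category X f ([6, 2], 0, False)" by (rule closed) (use l1 4 y 2 in simp)
      then show ?thesis by (rule pick[rotated, where r = 5]) (simp add: categories_def)
    next
      case 3
      have "in_category X f ([6], 3, False)" by (rule tail[of "[6]" y l2]) (use l1 4 y 3 in auto)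
      then show ?thesis by (rule pick[rotated, where r = 5]) (simp add: categories_def)
    qed
  next
    case 5
    obtain y l2 where y: "l1 = y # l2" "1 \<le> y" using nxt[of "[]" x l1] l1 5 n by auto
    consider "y = 1" | "y = 2" | "y = 3" | "y \<ge> 4" using y by linarith
    then show ?thesis
    proof cases
      case 1
      obtain v where v: "l2 = replicate 3 1 @ v" using rep[of "[5]" l2 3] l1 y 1 5 n by auto
      have "in_category X f ([5, 1, 1, 1, 1], 0, False)"
        by (rule closed) (use l1 5 y 1 v in \<open>simp add: numeral_3_eq_3\<close>)
      then show ?thesis by (rule pick[rotated, where r = 5]) (simp add: categories_def)
    next
      case 2
      obtain z l3 where z: "l2 = z # l3" "1 \<le> z" "z \<le> 2" using nxt[of "[5]" y l2] l1 y 2 5 n by auto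
      have "z \<noteq> 1" using noev[of "[5, 2]" l3] l1 y z 2 5 by auto
      then have "in_category X f ([5, 2, 2], 0, False)" by (intro closed) (use l1 5 y 2 z in auto)
      then show ?thesis by (rule pick[rotated, where r = 5]) (simp add: categories_def)
    next
      case 3
      have "in_category X f ([5, 3], 0, False)" by (rule closed) (use l1 5 y 3 in simp)
      then show ?thesis by (rule pick[rotated, where r = 5]) (simp add: categories_def)
    next
      case 4
      have "in_category X f ([5], 4, False)" by (rule tail[of "[5]" y l2]) (use l1 5 y 4 in auto)
      then show ?thesis by (rule pick[rotated, where r = 5]) (simp add: categories_def)
    qed
  next
    case 6
    obtain y l2 where y: "l1 = y # l2" "1 \<le> y" "y \<le> 4" using nxt[of "[]" x l1] l1 6 n by auto
    consider "y = 1" | "y = 2" | "y = 3" | "y = 4" using y by linarith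
    then show ?thesis
    proof cases
      case 1
      then show ?thesis using noev[of "[4]" l2] l1 y 6 by simp
    next
      case 2
      obtain z l3 where z: "l2 = z # l3" "1 \<le> z" "z \<le> 2" using nxt[of "[4]" y l2] l1 y 2 6 n by auto
      consider "z = 1" | "z = 2" using z by linarith
      then show ?thesis
      proof cases
        case 1
        obtain v where v: "l3 = replicate 2 1 @ v" using rep[of "[4, 2]" l3 2] l1 y z 1 2 6 n by auto
        have "in_category X f ([4, 2, 1, 1, 1], 0, False)"
          by (rule closed) (use l1 6 y 1 2 z v in \<open>simp add: numeral_2_eq_2\<close>)
        then show ?thesis by (rule pick[rotated, where r = 5]) (simp add: categories_def)
      next
        case z2: 2
        obtain w l4 where w: "l3 = w # l4" "1 \<le> w" "w \<le> 2" using nxt[of "[4, 2]" z l3] l1 y z z2 2 6 n by auto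
        have "w \<noteq> 1" using noev[of "[4, 2, 2]" l4] l1 y z w z2 2 6 by auto
        then have "in_category X f ([4, 2, 2, 2], 0, False)" by (intro closed) (use l1 6 y 2 z z2 w in auto)
        then show ?thesis by (rule pick[rotated, where r = 5]) (simp add: categories_def)
      qed
    next
      case 3
      \<comment> \<open>The 4 needs a further even length, and what follows the 3 is at most
        3.\<close>
      have "2 \<in> set l2"
      proof (rule ccontr)
        assume no: "2 \<notin> set l2"
        have "odd z" if "z \<in> set l2" for z
        proof -
          have "z \<le> 3" "z \<ge> 1" "z \<noteq> 2" using le[of "[4]" 3 l2 z] gt[of z] no that l1 y 3 6 by auto
          then have "z = 1 \<or> z = 3" by linarith
          then show ?thesis by auto
        qed
        then have "filter even l2 = []" by (simp add: filter_empty_conv)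
        then show False using ev l1 y 3 6 by simp
      qed
      then have "{#2#} \<subseteq># mset l2" by simp
      then have "in_category X f ([4, 3, 2], 0, False)" by (intro closed) (use l1 6 y 3 in simp)
      then show ?thesis by (rule pick[rotated, where r = 5]) (simp add: categories_def)
    next
      case 4
      have "in_category X f ([4, 4], 0, False)" by (rule closed) (use l1 6 y 4 in simp)
      then show ?thesis by (rule pick[rotated, where r = 5]) (simp add: categories_def)
    qed
  next
    case 7
    obtain y l2 where y: "l1 = y # l2" "1 \<le> y" "y \<le> 3" using nxt[of "[]" x l1] l1 7 n by auto
    consider "y = 1" | "y = 2" | "y = 3" using y by linarith
    then show ?thesis
    proof cases
      case 1
      obtain v where v: "l2 = replicate 5 1 @ v" using rep[of "[3]" l2 5] l1 y 1 7 n by auto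
      have "l2 = replicate (length l2) 1" by (rule ones[of "[3]"]) (use l1 y 1 7 in simp)
      then have "set l2 \<subseteq> {1}" using set_replicate_conv_if[of "length l2" 1] by (metis empty_subsetI subset_refl)
      then have "set v \<subseteq> {1}" using v by simp
      \<comment> \<open>The type is known completely here, and the flag keeps this information for
        the \<open>Stretched\<close> patterns.\<close>
      then have "in_category X f ([3, 1, 1, 1, 1, 1, 1], 0, True)"
        by (intro full[of _ v]) (use l1 y 1 7 v in \<open>auto simp: eval_nat_numeral\<close>)
      then show ?thesis by (rule pick[rotated, where r = 5]) (simp add: categories_def)
    next
      case 2
      obtain z l3 where z: "l2 = z # l3" "1 \<le> z" "z \<le> 2" using nxt[of "[3]" y l2] l1 y 2 7 n by auto
      have "z \<noteq> 1" using noev[of "[3, 2]" l3] l1 y z 2 7 by auto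
      then have z2: "z = 2" using z by linarith
      obtain w l4 where w: "l3 = w # l4" "1 \<le> w" "w \<le> 2" using nxt[of "[3, 2]" z l3] l1 y z z2 2 7 n by auto
      consider "w = 1" | "w = 2" using w by linarith
      then show ?thesis
      proof cases
        case 1
        obtain v where v: "l4 = replicate 1 1 @ v" using rep[of "[3, 2, 2]" l4 1] l1 y z z2 w 1 2 7 n by auto
        have "in_category X f ([3, 2, 2, 1, 1], 0, False)"
          by (rule closed) (use l1 7 y 1 2 z z2 w v in simp)
        then show ?thesis by (rule pick[rotated, where r = 5]) (simp add: categories_def)
      next
        case w2: 2
        \<comment> \<open>The type 3+2+2+2 has an odd number of even lengths.\<close>
        have "l4 \<noteq> []" using ev l1 y z z2 w w2 2 7 by auto
        then obtain u l5 where u: "l4 = u # l5" by (cases l4) auto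
        have "1 \<le> u" "u \<le> 2" using gt[of u] le[of "[3, 2, 2]" 2 l4 u] u l1 y z z2 w w2 2 7 by auto
        moreover have "u \<noteq> 1" using noev[of "[3, 2, 2, 2]" l5] u l1 y z z2 w w2 2 7 by auto
        ultimately have "u = 2" by linarith
        then have "in_category X f ([3, 2, 2, 2, 2], 0, False)" by (intro closed) (use l1 7 y 2 z z2 w w2 u in simp)
        then show ?thesis by (rule pick[rotated, where r = 5]) (simp add: categories_def)
      qed
    next
      case 3
      obtain z l3 where z: "l2 = z # l3" "1 \<le> z" "z \<le> 3" using nxt[of "[3]" y l2] l1 y 3 7 n by auto
      consider "z = 1" | "z = 2" | "z = 3" using z by linarith
      then show ?thesis
      proof cases
        case 1
        obtain v where v: "l3 = replicate 2 1 @ v" using rep[of "[3, 3]" l3 2] l1 y z 1 3 7 n by auto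
        have "in_category X f ([3, 3, 1, 1, 1], 0, False)"
          by (rule closed) (use l1 7 y 1 3 z v in \<open>simp add: numeral_2_eq_2\<close>)
        then show ?thesis by (rule pick[rotated, where r = 5]) (simp add: categories_def)
      next
        case z2: 2
        obtain w l4 where w: "l3 = w # l4" "1 \<le> w" "w \<le> 2" using nxt[of "[3, 3]" z l3] l1 y z z2 3 7 n by auto
        have "w \<noteq> 1" using noev[of "[3, 3, 2]" l4] l1 y z w z2 3 7 by auto
        then have "in_category X f ([3, 3, 2, 2], 0, False)" by (intro closed) (use l1 7 y 3 z z2 w in auto)
        then show ?thesis by (rule pick[rotated, where r = 5]) (simp add: categories_def)
      next
        case z3: 3
        have "in_category X f ([3, 3, 3], 0, False)" by (rule closed) (use l1 7 y 3 z z3 in simp)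
        then show ?thesis by (rule pick[rotated, where r = 5]) (simp add: categories_def)
      qed
    qed
  next
    case 8
    define k where "k = length (takeWhile (\<lambda>y. y = 2) ls)"
    define us where "us = dropWhile (\<lambda>y. y = 2) ls"
    have tw: "takeWhile (\<lambda>y. y = 2) ls = replicate k 2"
      unfolding k_def using set_takeWhileD[of _ "\<lambda>y. y = 2" ls]
      by (intro replicate_length_same[symmetric] ballI) blast
    have dec: "ls = replicate k 2 @ us" using tw takeWhile_dropWhile_id[of "\<lambda>y. y = 2" ls] us_def by metis
    have us1: "set us \<subseteq> {1}"
    proof (cases us)
      case (Cons u vs)
      have "u \<noteq> 2" using Cons hd_dropWhile[of "\<lambda>y. y = 2" ls] by (simp add: us_def)
      moreover have "u \<in> set ls" using dec Cons by simp
      then have "u \<le> 2" "1 \<le> u" using gt[of u] le[of "[]" 2 l1 u] l1 8 by auto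
      ultimately have "u = 1" by linarith
      then have "vs = replicate (length vs) 1" using ones[of "replicate k 2" vs] dec Cons by simp
      then have "set vs \<subseteq> {1}" using set_replicate_conv_if[of "length vs" 1] by (metis empty_subsetI subset_refl)
      then show ?thesis using Cons \<open>u = 1\<close> by simp
    qed simp
    then have usr: "us = replicate (length us) 1"
      by (intro replicate_length_same[symmetric]) blast
    define m where "m = length us"
    have ls: "ls = replicate k 2 @ replicate m 1" using dec usr m_def by metis
    have ek: "even k" using ev ls by simp
    have nk: "n = 2 * k + m" using sum ls by (simp add: sum_list_replicate)
    have "k \<noteq> 0" using ls l1 8 by (cases k; cases m) auto
    \<comment> \<open>There are \<open>k\<close> 2-cycles and \<open>m\<close> fixed points. With
      \<open>k\<close> even, \<open>m = 0\<close> and \<open>m = 1\<close> force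
      \<open>n mod 4\<close> to be 0 and 1, which is where the smaller counts 2 and 4 enter.\<close>
    then have "k = 2 \<or> k \<ge> 4" using ek by presburger
    then consider "k = 2" | "k \<ge> 4" "m = 0" | "k \<ge> 4" "m = 1" | "k \<ge> 4" "m \<ge> 2" by linarith
    then show ?thesis
    proof cases
      case 1
      then have "5 \<le> m" using nk n by simp
      then obtain m' where m': "m = 5 + m'" using le_Suc_ex by blast
      have "in_category X f ([2, 2, 1, 1, 1, 1, 1], 0, True)"
        by (intro full[of _ "replicate m' 1"]) (auto simp: ls 1 m' eval_nat_numeral)
      then show ?thesis by (rule pick[rotated, where r = 5]) (simp add: categories_def)
    next
      case 2
      then obtain k' where k': "k = 4 + k'" using le_Suc_ex by blast
      have "in_category X f ([2, 2, 2, 2], 0, False)"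
        by (rule closed) (simp add: ls k' eval_nat_numeral)
      moreover have "n mod 4 = 0" using nk 2 ek by (auto elim!: evenE)
      moreover from this have "(([2, 2, 2, 2], 0, False), 2) \<in> set (categories (n mod 4))" by (simp add: categories_def)
      ultimately show ?thesis using pick by blast
    next
      case 3
      then obtain k' where k': "k = 4 + k'" using le_Suc_ex by blast
      have "in_category X f ([2, 2, 2, 2, 1], 0, False)"
        by (rule closed) (simp add: ls k' 3 eval_nat_numeral)
      moreover have "n mod 4 = 1" using nk 3 ek by (auto elim!: evenE)
      moreover from this have "(([2, 2, 2, 2, 1], 0, False), 4) \<in> set (categories (n mod 4))" by (simp add: categories_def)
      ultimately show ?thesis using pick by blast
    next
      case 4
      then obtain k' m' where k': "k = 4 + k'" "m = 2 + m'" using le_Suc_ex by metis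
      have "in_category X f ([2, 2, 2, 2, 1, 1], 0, False)"
        by (rule closed) (simp add: ls k' eval_nat_numeral)
      then show ?thesis by (rule pick[rotated, where r = 5]) (simp add: categories_def)
    qed
  qed
qed

subsection \<open>Small degrees\<close>

text \<open>The partitions of \<open>n\<close> into parts of size at most \<open>k\<close>, each
  with its parts in nonincreasing order.\<close>

fun partitions :: "nat \<Rightarrow> nat \<Rightarrow> nat list list" where
  "partitions 0 n = (if n = 0 then [[]] else [])"
| "partitions (Suc k) n =
     (if Suc k \<le> n then map (\<lambda>ls. Suc k # ls) (partitions (Suc k) (n - Suc k)) else []) @ partitions k n"

declare partitions.simps [simp del]

definition even_types :: "nat \<Rightarrow> nat list list" where
  "even_types n = filter (\<lambda>ls. even (length (filter even ls)) \<and> \<not> list_all (\<lambda>l. l = 1) ls) (partitions n n)"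

lemma partitions_complete:
  "sorted_wrt (\<ge>) ls \<Longrightarrow> 0 \<notin> set ls \<Longrightarrow> \<forall>l \<in> set ls. l \<le> k \<Longrightarrow> sum_list ls = n \<Longrightarrow> ls \<in> set (partitions k n)"
proof (induction k n arbitrary: ls rule: partitions.induct)
  case (1 n)
  then have "ls = []" by (cases ls) auto
  then show ?case using 1 by (simp add: partitions.simps(1))
next
  case (2 k n)
  show ?case
  proof (cases "\<exists>us. ls = Suc k # us")
    case True
    then obtain us where us: "ls = Suc k # us" by blast
    have n: "Suc k \<le> n" "sum_list us = n - Suc k" using 2(6) us by auto
    have "sorted_wrt (\<ge>) us" "0 \<notin> set us" "\<forall>l \<in> set us. l \<le> Suc k" using 2(3-5) us by simp_all
    then have "us \<in> set (partitions (Suc k) (n - Suc k))" using 2(1)[OF n(1)] n(2) by blast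
    then show ?thesis using us n(1) unfolding partitions.simps(2)[of k n] by simp
  next
    case False
    have "\<forall>l \<in> set ls. l \<le> k"
    proof (cases ls)
      case (Cons l us)
      then have "l \<noteq> Suc k" "l \<le> Suc k" using False 2(5) by auto
      then have "l \<le> k" by simp
      moreover have "\<forall>m \<in> set us. m \<le> l" using Cons 2(3) by simp
      ultimately show ?thesis using Cons by force
    qed simp
    then have "ls \<in> set (partitions k n)" using 2(2)[OF 2(3,4) _ 2(6)] by blast
    then show ?thesis unfolding partitions.simps(2)[of k n] by simp
  qed
qed

lemma even_type_exists:
  assumes "f permutes X" "finite X" "evenperm f" "f \<noteq> id"
  obtains ls where "ls \<in> set (even_types (card X))" "type_of X f ls"
proof -
  obtain ls where ls: "type_of X f ls" "sorted_wrt (\<ge>) ls" "0 \<notin> set ls" "sum_list ls = card X"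
    "even (length (filter even ls))" "\<not> set ls \<subseteq> {1}"
    using type_exists[OF assms] by blast
  have "\<forall>l \<in> set ls. l \<le> card X" using member_le_sum_list[of _ ls] unfolding ls(4) by blast
  then have "ls \<in> set (partitions (card X) (card X))" using partitions_complete ls by blast
  moreover have "\<not> list_all (\<lambda>l. l = 1) ls" using ls(6) by (auto simp: list_all_iff)
  ultimately show ?thesis using ls that by (simp add: even_types_def)
qed

subsection \<open>Degree six\<close>

text \<open>The form fills \<open>X\<close>, so no unknown constant is added and the profile is
  known as a value. Degree six needs this in order to recognise five-cycles.\<close>

lemma attained_exact:
  assumes X: "finite X" "a permutes X" "b permutes X"
    and forms: "has_form X a ls Closed" "has_form X b ms Closed" "card X = sum_list ls"
    and ok: "exact_ok ls ms vs" and v: "v \<in> set vs"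
  shows "\<exists>g. g permutes X \<and> evenperm g \<and>
    profile_at X a b g = label_profile (sum_list ls) (gamma ls Closed ms (fst v))"
proof -
  obtain xs where xs: "form_on X a ls Closed xs" using forms(1) by (auto simp: has_form_def)
  obtain ys where ys: "form_on X b ms Closed ys" using forms(2) by (auto simp: has_form_def)
  have l: "length xs = sum_list ls" "distinct xs" "set xs \<subseteq> X" using xs by (auto simp: form_on_def)
  have "card (set xs) = card X" using l forms(3) by (simp add: distinct_card)
  then have all: "X - set xs = {}" using card_subset_eq[OF X(1) l(3)] by blast
  define prof where "prof = (\<lambda>s. label_profile (length xs) (gamma ls Closed ms s))"
  have ok': "sum_list ls = sum_list ms" "ls \<noteq> []" "ms \<noteq> []" "0 \<notin> set ls" "0 \<notin> set ms"
    "labelling (length xs) (fst v)" "swaps_ok (length xs) (snd v)" "prof (swaps (fst v) (snd v)) = prof (fst v)"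
    using ok v unfolding exact_ok_def Let_def prof_def l(1) by blast+
  have len: "length xs = sum_list ms" using l(1) ok'(1) by simp
  obtain b' where b': "b' permutes X" "form_on X b' ms Closed xs"
    "\<And>s r. labelling (length xs) s \<Longrightarrow> swaps_ok (length xs) r \<Longrightarrow>
       \<exists>g h s'. g permutes X \<and> evenperm g \<and> s' \<in> {s, swaps s r} \<and> labelling (length xs) s' \<and>
         realises xs s' h \<and> profile_at X a b g = profile_at X a b' h"
    by (rule labelling_attained[OF X ys ok'(3,5) l(2,3) len]) blast
  from b'(3)[OF ok'(6,7)] obtain g h s' where g: "g permutes X" "evenperm g"
    "s' \<in> {fst v, swaps (fst v) (snd v)}" "labelling (length xs) s'" "realises xs s' h"
    "profile_at X a b g = profile_at X a b' h" by blast
  have "profile_at X a b' h = prof s'"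
    using exact_profile[OF X(1,2) b'(1) xs ok'(2,4) b'(2) ok'(3,5) g(5,4) refl] all
    by (simp add: prof_def)
  also have "prof s' = prof (fst v)" using g(3) ok'(8) by auto
  finally show ?thesis using g(1,2,6) by (auto simp: prof_def l(1))
qed

lemma twist_commuting:
  assumes "f permutes X" "f ` S = S" "r permutes S" "\<And>t. t \<in> S \<Longrightarrow> r (f t) = f (r t)"
  shows "twist r f = f"
proof -
  have "r (f t) = f (r t)" for t
  proof (cases "t \<in> S")
    case False
    then have "f t \<notin> S" using assms(2) permutes_inj[OF assms(1)] by (metis imageE injD)
    then show ?thesis using False permutes_not_in[OF assms(3)] by simp
  qed (rule assms(4))
  then show ?thesis using assms(3) by (auto simp: twist_def fun_eq_iff permutes_inverses)
qed

text \<open>The odd permutation is the 2-cycle itself, the transposition of two fixed points, or the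
  exchange of two three-cycles, a product of three transpositions. This covers every nontrivial even
  type of degree six except 5+1.\<close>

lemma odd_centraliser:
  assumes f: "f permutes X" "finite X" and t: "type_of X f ls"
    and c: "mset [2] \<subseteq># mset ls \<or> mset [1, 1] \<subseteq># mset ls \<or> mset [3, 3] \<subseteq># mset ls"
  shows "\<exists>r. r permutes X \<and> \<not> evenperm r \<and> twist r f = f"
  using c
proof (elim disjE)
  assume "mset [2] \<subseteq># mset ls"
  then obtain css where css: "cycles_of X f css" "map length css = [2]" using type_closed[OF t, of "[2]"] by auto
  then obtain x y where "css = [[x, y]]" by (auto simp: length_Suc_conv eval_nat_numeral)
  then have xy: "x \<noteq> y" "x \<in> X" "y \<in> X" "f x = y" "f y = x" using css(1) by (auto simp: cycles_of_def cyclic_def)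
  have "twist (transpose x y) f = f"
    by (rule twist_commuting[OF f(1), of "{x, y}"]) (use xy in \<open>auto simp: permutes_swap_id\<close>)
  then show ?thesis using xy by (intro exI[of _ "transpose x y"]) (auto simp: permutes_swap_id evenperm_swap)
next
  assume "mset [1, 1] \<subseteq># mset ls"
  then obtain css where css: "cycles_of X f css" "map length css = [1, 1]" using type_closed[OF t, of "[1, 1]"] by auto
  then obtain x y where "css = [[x], [y]]" by (auto simp: length_Suc_conv)
  then have xy: "x \<noteq> y" "x \<in> X" "y \<in> X" "f x = x" "f y = y" using css(1) by (auto simp: cycles_of_def cyclic_def)
  have "twist (transpose x y) f = f"
    by (rule twist_commuting[OF f(1), of "{x, y}"]) (use xy in \<open>auto simp: permutes_swap_id\<close>)
  then show ?thesis using xy by (intro exI[of _ "transpose x y"]) (auto simp: permutes_swap_id evenperm_swap)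
next
  assume "mset [3, 3] \<subseteq># mset ls"
  then obtain css where css: "cycles_of X f css" "map length css = [3, 3]" using type_closed[OF t, of "[3, 3]"] by auto
  then obtain x y z u v w where cs: "css = [[x, y, z], [u, v, w]]" by (auto simp: length_Suc_conv eval_nat_numeral)
  have d: "distinct [x, y, z, u, v, w]" "{x, y, z, u, v, w} \<subseteq> X"
    using css(1) cs by (auto simp: cycles_of_def)
  have fx: "f x = y" "f y = z" "f z = x" "f u = v" "f v = w" "f w = u"
    using css(1) cs by (auto simp: cycles_of_def cyclic_def)
  let ?r = "transpose x u \<circ> (transpose y v \<circ> transpose z w)"
  have "twist ?r f = f"
  proof (rule twist_commuting[OF f(1), of "{x, y, z, u, v, w}"])
    show "f ` {x, y, z, u, v, w} = {x, y, z, u, v, w}" using fx by auto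
    show "?r permutes {x, y, z, u, v, w}" by (intro permutes_compose permutes_swap_id) auto
    have rv: "?r x = u" "?r y = v" "?r z = w" "?r u = x" "?r v = y" "?r w = z"
      using d(1) by (auto simp: transpose_def)
    show "?r (f t) = f (?r t)" if "t \<in> {x, y, z, u, v, w}" for t
      using that by (elim insertE emptyE) (simp_all only: fx rv)
  qed
  moreover have "?r permutes X" using d(2) by (intro permutes_compose permutes_swap_id) auto
  moreover have "\<not> evenperm ?r"
    using d(1) by (simp add: evenperm_comp permutation_swap_id permutation_compose evenperm_swap del: comp_apply)
  ultimately show ?thesis by blast
qed

abbreviation five_cycle :: "nat \<Rightarrow> nat" where
  "five_cycle \<equiv> cycle_of_list [1, 2, 3, 4, 5]"

lemma five_cycle_values:
  "five_cycle 1 = 2" "five_cycle 2 = 3" "five_cycle 3 = 4" "five_cycle 4 = 5" "five_cycle 5 = 1" "five_cycle 6 = 6"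
  by (simp_all add: transpose_def)

lemma five_cycle_Alt: "five_cycle \<in> Alt 6"
  using evenperm_unique[OF swapidseq_cycle[of "[1, 2, 3, 4, 5 :: nat]"]]
    permutes_subset[OF cycle_permutes[of "[1, 2, 3, 4, 5 :: nat]"], of "{1..6}"]
  by (simp del: cycle_of_list.simps)

text \<open>A commuting \<open>u\<close> fixes 6 and is then determined by its value at 1. Hence it
  is a power of the five-cycle, and all these powers are even.\<close>

lemma centraliser_five_cycle:
  assumes u: "u permutes {1..6}" and comm: "\<And>x. u (five_cycle x) = five_cycle (u x)"
  shows "evenperm u"
proof -
  let ?t = five_cycle
  have t: "?t permutes {1..6}" using five_cycle_Alt by simp
  have pow: "(?t ^^ i) \<in> Alt 6" for i
  proof (induction i)
    case (Suc i)
    show ?case unfolding funpow.simps(2) by (rule Alt_comp[OF five_cycle_Alt Suc])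
  next
    case 0
    show ?case unfolding funpow.simps(1) by (simp only: mem_Collect_eq permutes_id evenperm_id simp_thms)
  qed
  have in6: "x = 1 \<or> x = 2 \<or> x = 3 \<or> x = 4 \<or> x = 5 \<or> x = 6" if "x \<in> {1..6 :: nat}" for x
    using that by auto
  have u_in: "u x \<in> {1..6}" if "x \<in> {1..6}" for x using permutes_in_image[OF u] that by blast
  have "?t (u 6) = u 6" using comm[of 6] five_cycle_values(6) by metis
  then have u6: "u 6 = 6" using in6[OF u_in[of 6]] five_cycle_values by auto
  have "u 1 \<noteq> u 6" unfolding inj_eq[OF permutes_inj[OF u]] by simp
  then have "u 1 \<noteq> 6" using u6 by simp
  then have "\<exists>i. u 1 = (?t ^^ i) 1"
  proof -
    have v: "(?t ^^ 0) 1 = 1" "(?t ^^ 1) 1 = 2" "(?t ^^ 2) 1 = 3" "(?t ^^ 3) 1 = 4" "(?t ^^ 4) 1 = 5"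
      using five_cycle_values by (simp_all add: eval_nat_numeral del: cycle_of_list.simps)
    show ?thesis using in6[OF u_in[of 1]] v \<open>u 1 \<noteq> 6\<close> by (metis atLeastAtMost_iff le_numeral_extra(4) one_le_numeral)
  qed
  then obtain i where i: "u 1 = (?t ^^ i) 1" by blast
  have tt: "?t ((?t ^^ i) x) = (?t ^^ i) (?t x)" for x by (metis funpow_swap1)
  have 1: "u 1 = (?t ^^ i) 1" by (rule i)
  have 2: "u 2 = (?t ^^ i) 2" using comm[of 1] 1 tt[of 1] five_cycle_values(1) by metis
  have 3: "u 3 = (?t ^^ i) 3" using comm[of 2] 2 tt[of 2] five_cycle_values(2) by metis
  have 4: "u 4 = (?t ^^ i) 4" using comm[of 3] 3 tt[of 3] five_cycle_values(3) by metis
  have 5: "u 5 = (?t ^^ i) 5" using comm[of 4] 4 tt[of 4] five_cycle_values(4) by metis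
  have 6: "(?t ^^ i) 6 = 6" by (induction i) (use five_cycle_values(6) in \<open>simp_all del: cycle_of_list.simps\<close>)
  have "u x = (?t ^^ i) x" for x
  proof (cases "x \<in> {1..6}")
    case True
    then show ?thesis using in6[OF True] 1 2 3 4 5 6 u6 by metis
  next
    case False
    have "(?t ^^ i) permutes {1..6}" using pow[of i] by blast
    then show ?thesis using False u permutes_not_in by metis
  qed
  then have "u = ?t ^^ i" by blast
  then show ?thesis using pow[of i] by blast
qed

text \<open>One fixed point for each of the first three powers leaves exactly one fixed point and
  neither 2-cycles nor three-cycles. Among the even types of degree six this is 5+1.\<close>

lemma is_five_cycle:
  assumes x: "x \<in> Alt 6" and p: "fix_profile {1..6} x = (1, 1, 1)"
  shows "\<exists>h. h permutes {1..6} \<and> x = twist h five_cycle"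
proof -
  let ?X = "{1..6 :: nat}"
  have xp: "x permutes ?X" "evenperm x" using x by auto
  have F: "card {y \<in> ?X. x y = y} = 1" "card {y \<in> ?X. x (x y) = y} = 1" "card {y \<in> ?X. x (x (x y)) = y} = 1"
    using p by (auto simp: fix_profile_def)
  have "x \<noteq> id"
  proof
    assume "x = id"
    then have "{y \<in> ?X. x y = y} = ?X" by auto
    then show False using F(1) by simp
  qed
  have two: False if "u \<noteq> v" "{u, v} \<subseteq> {y \<in> ?X. Q y}" "card {y \<in> ?X. Q y} = 1" for u v Q
  proof -
    have "card {u, v} \<le> card {y \<in> ?X. Q y}" using that(2) by (intro card_mono) auto
    then show False using that(1,3) by simp
  qed
  obtain ls where ls: "ls \<in> set (even_types (card ?X))" "type_of ?X x ls"
    by (rule even_type_exists[OF xp(1) _ xp(2) \<open>x \<noteq> id\<close>]) auto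
  have types: "even_types 6 = [[5, 1], [4, 2], [3, 3], [3, 1, 1, 1], [2, 2, 1, 1]]" by code_simp
  have n1: "\<not> mset [1, 1] \<subseteq># mset ls"
  proof
    assume "mset [1, 1] \<subseteq># mset ls"
    then obtain css where css: "cycles_of ?X x css" "map length css = [1, 1]" using type_closed[OF ls(2), of "[1, 1]"] by auto
    then obtain u v where "css = [[u], [v]]" by (auto simp: length_Suc_conv)
    then show False using css(1) two[of u v "\<lambda>y. x y = y"] F(1) by (auto simp: cycles_of_def cyclic_def)
  qed
  have n2: "\<not> mset [2] \<subseteq># mset ls"
  proof
    assume "mset [2] \<subseteq># mset ls"
    then obtain css where css: "cycles_of ?X x css" "map length css = [2]" using type_closed[OF ls(2), of "[2]"] by auto
    then obtain u v where "css = [[u, v]]" by (auto simp: length_Suc_conv eval_nat_numeral)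
    then show False using css(1) two[of u v "\<lambda>y. x (x y) = y"] F(2) by (auto simp: cycles_of_def cyclic_def)
  qed
  have n3: "\<not> mset [3] \<subseteq># mset ls"
  proof
    assume "mset [3] \<subseteq># mset ls"
    then obtain css where css: "cycles_of ?X x css" "map length css = [3]" using type_closed[OF ls(2), of "[3]"] by auto
    then obtain u v w where "css = [[u, v, w]]" by (auto simp: length_Suc_conv eval_nat_numeral)
    then show False using css(1) two[of u v "\<lambda>y. x (x (x y)) = y"] F(3) by (auto simp: cycles_of_def cyclic_def)
  qed
  have "ls \<in> {[5, 1], [4, 2], [3, 3], [3, 1, 1, 1], [2, 2, 1, 1]}"
    using ls(1) types by simp
  then have "ls = [5, 1]" using n1 n2 n3 by auto
  then obtain css where css: "cycles_of ?X x css" "set (concat css) = ?X" "map length css = [5, 1]"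
    using ls(2) by (auto simp: type_of_def)
  then obtain c e where ce: "css = [c, [e]]" "length c = 5" by (auto simp: length_Suc_conv)
  have c: "distinct c" "map x c = rotate1 c" "x e = e" "set c \<union> {e} = ?X" "set c \<subseteq> ?X"
    using css ce by (auto simp: cycles_of_def cyclic_def)
  have "x y = cycle_of_list c y" for y
  proof (cases "y \<in> set c")
    case True
    have "map x c = map (cycle_of_list c) c" using c(1,2) map_cycle_of_list by metis
    then show ?thesis using True by simp
  next
    case False
    then have "cycle_of_list c y = y" by (rule id_outside_supp)
    moreover have "x y = y"
      using False c(3,4) permutes_not_in[OF xp(1), of y] by (cases "y \<in> ?X") blast+
    ultimately show ?thesis by simp
  qed
  then have xc: "x = cycle_of_list c" by blast
  obtain h where h: "h permutes ?X" "\<forall>k < length c. h ([1, 2, 3, 4, 5] ! k) = c ! k"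
    using list_transport[of ?X c "[1, 2, 3, 4, 5]"] c ce(2) by auto
  have "map h [1, 2, 3, 4, 5] = c"
  proof (rule nth_equalityI)
    fix i assume "i < length (map h [1, 2, 3, 4, 5])"
    then have i: "i < length [1, 2, 3, 4, 5 :: nat]" "i < length c" using ce(2) by simp_all
    show "map h [1, 2, 3, 4, 5] ! i = c ! i" unfolding nth_map[OF i(1)] using h(2) i(2) by blast
  qed (simp add: ce(2))
  then have "twist h five_cycle = x"
    using xc conjugation_of_cycle[of "[1, 2, 3, 4, 5]" h] permutes_bij[OF h(1)] by (simp add: twist_def del: cycle_of_list.simps)
  then show ?thesis using h(1) by blast
qed

text \<open>In degree six the five-cycles form two classes, which conjugation by odd permutations exchanges.
  When both factors commute with odd permutations, their product set contains both.\<close>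

lemma eta_ge_five_cycles:
  assumes a: "a \<in> Alt 6" and b: "b \<in> Alt 6"
    and ra: "ra permutes {1..6}" "\<not> evenperm ra" "twist ra a = a"
    and rb: "rb permutes {1..6}" "\<not> evenperm rb" "twist rb b = b"
    and W: "finite W" "4 \<le> card W" "(1, 1, 1) \<in> W"
      "\<And>w. w \<in> W \<Longrightarrow> \<exists>g \<in> Alt 6. fix_profile {1..6} (a \<circ> twist g b) = w"
  shows "5 \<le> eta (alt_group 6) (class_prod 6 a b)"
proof -
  let ?X = "{1..6 :: nat}"
  define C where "C = (\<lambda>x. \<exists>h \<in> Alt 6. x = twist h five_cycle)"
  define F where "F = (\<lambda>x. (fix_profile ?X x, C x))"
  define V where "V = (\<lambda>g. F (a \<circ> twist g b)) ` Alt 6"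
  have fV: "finite V" by (simp add: V_def finite_permutations)
  have invC: "C (twist g x) = C x" if g: "g \<in> Alt 6" for g x
  proof -
    have fwd: "C (twist k y)" if "k \<in> Alt 6" "C y" for k y
    proof -
      obtain h where h: "h \<in> Alt 6" "y = twist h five_cycle" using \<open>C y\<close> by (auto simp: C_def)
      then have "twist k y = twist (k \<circ> h) five_cycle" using that(1) twist_comp[of h ?X k five_cycle] by simp
      then show ?thesis using Alt_comp[OF that(1) h(1)] by (auto simp: C_def)
    qed
    show ?thesis using fwd[OF g, of x] fwd[OF Alt_inv[OF g], of "twist g x"] twist_inv_twist[of g ?X x] g by auto
  qed
  have "card V \<le> eta (alt_group 6) (class_prod 6 a b)"
  proof (rule eta_ge[OF a b fV, where F = F])
    show "F (twist g x) = F x" if "g \<in> Alt 6" for g x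
      using that invC by (simp add: F_def fix_profile_twist)
  qed (auto simp: V_def)
  moreover have "5 \<le> card V"
  proof -
    obtain g where g: "g \<in> Alt 6" "fix_profile ?X (a \<circ> twist g b) = (1, 1, 1)" using W(3,4) by blast
    define x where "x = a \<circ> twist g b"
    have xA: "x \<in> Alt 6"
      using Alt_comp[OF a, of "twist g b"] g(1) b unfolding x_def by (simp add: twist_permutes even_twist[of ?X])
    \<comment> \<open>This is even, as \<open>g\<close> is even and both other factors are odd. As
      \<open>ra\<close> commutes with \<open>a\<close> and \<open>rb\<close> with \<open>b\<close>,
      conjugation of \<open>x\<close> by the odd \<open>ra\<close> stays in the product set.\<close>
    define g' where "g' = ra \<circ> (g \<circ> rb)"
    have g': "g' \<in> Alt 6" using g(1) ra rb unfolding g'_def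
      by (simp add: even_permutes_comp[of ?X] permutes_compose)
    have x': "twist ra x = a \<circ> twist g' b"
    proof -
      have "twist g' b = twist ra (twist g b)"
        using g(1) ra(1) rb twist_comp[of "g \<circ> rb" ?X ra b] twist_comp[of rb ?X g b]
        by (simp add: g'_def permutes_compose)
      then show ?thesis using twist_mult[OF ra(1), of a "twist g b"] ra(3) by (simp add: x_def)
    qed
    obtain h where h: "h permutes ?X" "x = twist h five_cycle" using is_five_cycle[OF xA] g(2) x_def by blast
    have C_iff: "C (twist k five_cycle) \<longleftrightarrow> evenperm k" if k: "k permutes ?X" for k
    proof
      assume "C (twist k five_cycle)"
      then obtain m where m: "m \<in> Alt 6" "twist k five_cycle = twist m five_cycle" by (auto simp: C_def)
      define u where "u = inv' m \<circ> k"
      have mp: "m permutes ?X" "inv' m permutes ?X" "evenperm (inv' m)" using m(1) Alt_inv[OF m(1)] by auto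
      have up: "u permutes ?X" using k mp(2) by (simp add: u_def permutes_compose)
      have "twist u five_cycle = five_cycle"
        using twist_comp[OF k mp(2), of five_cycle] m(2) twist_inv_twist[OF mp(1), of five_cycle] by (simp add: u_def)
      then have "u (five_cycle y) = five_cycle (u y)" for y using twist_apply[OF up, of five_cycle y] by simp
      then have "evenperm u" using centraliser_five_cycle[OF up] by blast
      then show "evenperm k" using even_permutes_comp[OF _ mp(2) k] mp(3) by (simp add: u_def)
    qed (use k in \<open>auto simp: C_def\<close>)
    have "C (twist ra x) \<longleftrightarrow> \<not> C x"
      using C_iff[OF h(1)] C_iff[OF permutes_compose[OF h(1) ra(1)]] h twist_comp[OF h(1) ra(1), of five_cycle]
        even_permutes_comp[OF _ ra(1) h(1)] ra(2) by simp
    moreover have "F x \<in> V" using g(1) by (auto simp: V_def x_def)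
    moreover have "F (twist ra x) \<in> V" unfolding x' V_def using g' by blast
    moreover have "fix_profile ?X (twist ra x) = (1, 1, 1)" "fix_profile ?X x = (1, 1, 1)"
      using fix_profile_twist[OF ra(1)] g(2) by (simp_all add: x_def)
    ultimately have TF: "((1, 1, 1), True) \<in> V" "((1, 1, 1), False) \<in> V" unfolding F_def by (cases "C x"; simp)+
    \<comment> \<open>Even without one of the two classes of five-cycles every profile in
      \<open>W\<close> is still attained, so \<open>V\<close> has at least one element more than
      \<open>W\<close>.\<close>
    let ?V = "V - {((1, 1, 1), True)}"
    have "W \<subseteq> fst ` ?V"
    proof
      fix w assume w: "w \<in> W"
      show "w \<in> fst ` ?V"
      proof (cases "w = (1, 1, 1)")
        case True
        then show ?thesis using TF(2) by (intro image_eqI[of _ _ "((1, 1, 1), False)"]) auto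
      next
        case False
        obtain k where k: "k \<in> Alt 6" "fix_profile ?X (a \<circ> twist k b) = w" using W(4)[OF w] by blast
        then have "F (a \<circ> twist k b) \<in> ?V" "fst (F (a \<circ> twist k b)) = w" using False by (auto simp: V_def F_def)
        then show ?thesis by (metis image_eqI)
      qed
    qed
    then have "card W \<le> card (fst ` ?V)" using fV by (intro card_mono) auto
    also have "\<dots> \<le> card ?V" using fV by (intro card_image_le) auto
    also have "card ?V = card V - 1" using TF(1) by simp
    finally show ?thesis using W(2) by linarith
  qed
  ultimately show ?thesis by linarith
qed

subsection \<open>The patterns\<close>

text \<open>In an entry \<open>(s, r)\<close>, \<open>s ! i\<close> is the label to which the
  \<open>i\<close>-th point of the form of \<open>b\<close> is moved, and \<open>r\<close> is an odd
  number of swaps of positions that leads to the second labelling. The number of entries is the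
  number of profiles obtained. Nothing else about these data is assumed: their validity and the
  coverage of all pairs are established by evaluation.\<close>

definition patterns1 :: "pattern list" where
  "patterns1 = [
     Exact [5, 1] [3, 3] [([0, 2, 5, 1, 4, 3], [(0, 3), (1, 4), (2, 5)]), ([0, 2, 1, 3, 5, 4], [(0, 4)]), ([0, 1, 3, 2, 4, 5], [(0, 4)]), ([0, 1, 2, 3, 5, 4], [(0, 3), (1, 4), (2, 5)]), ([0, 1, 2, 3, 4, 5], [(0, 5)])],
     Exact [3, 3] [3, 3] [([0, 2, 1, 3, 5, 4], [(0, 3)]), ([0, 1, 3, 2, 5, 4], [(0, 4)]), ([0, 1, 3, 2, 4, 5], [(0, 4)]), ([0, 1, 2, 3, 5, 4], [(0, 3), (1, 4), (2, 5)]), ([0, 1, 2, 3, 4, 5], [(0, 3), (1, 4), (2, 5)])],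
     Robust [2, 1] Open [3] Strict [([0, 2, 1], [(0, 2)]), ([0, 1, 2], [(0, 1)])],
     Robust [2, 2, 2] Strict [2, 4] Open [([0, 2, 1, 3, 5, 4], [(0, 1)]), ([0, 2, 1, 4, 5, 3], [(0, 1)]), ([0, 1, 2, 5, 3, 4], [(0, 1)]), ([0, 1, 2, 3, 5, 4], [(0, 1)]), ([0, 1, 2, 3, 4, 5], [(0, 1)])],
     Robust [2, 2, 1, 1] Open [2, 2, 2] Strict [([0, 2, 1, 5, 3, 4], [(0, 1)]), ([0, 4, 1, 5, 2, 3], [(0, 1)]), ([0, 1, 2, 5, 3, 4], [(0, 1)]), ([0, 1, 4, 5, 2, 3], [(0, 1)]), ([0, 1, 2, 3, 4, 5], [(0, 1)])],
     Robust [1, 3] Open [4] Open [([0, 1, 3, 2], [(0, 3)]), ([1, 0, 2, 3], [(0, 1)])],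
     Robust [2, 4] Open [6] Strict [([0, 2, 1, 3, 5, 4], [(0, 2)]), ([0, 1, 2, 5, 4, 3], [(0, 1)]), ([0, 1, 2, 3, 5, 4], [(0, 1)]), ([0, 2, 3, 4, 5, 1], [(0, 5)]), ([0, 1, 2, 3, 4, 5], [(0, 1)])],
     Robust [1, 1, 2] Open [2, 2] Open [([0, 2, 3, 1], [(0, 1)]), ([0, 1, 2, 3], [(0, 1)])],
     Robust [5, 1] Open [6] Strict [([0, 2, 1, 3, 5, 4], [(0, 3)]), ([0, 1, 3, 2, 5, 4], [(1, 2)]), ([0, 1, 2, 4, 5, 3], [(2, 4)]), ([0, 1, 2, 3, 5, 4], [(3, 4)]), ([0, 1, 2, 3, 4, 5], [(0, 5)])],
     Robust [3, 2, 2] Closed [7] Open [([6, 3, 1, 0, 5, 2, 4], [(0, 2)]), ([1, 2, 3, 5, 4, 0, 6], [(0, 6)]), ([5, 6, 4, 1, 3, 2, 0], [(0, 1)]), ([5, 2, 0, 1, 6, 3, 4], [(0, 4)]), ([0, 1, 2, 3, 4, 5, 6], [(3, 4)])],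
     Robust [2, 2, 1, 1] Open [2, 2, 1, 1] Open [([0, 2, 4, 5, 1, 3], [(0, 1)]), ([0, 2, 1, 5, 4, 3], [(0, 1)]), ([0, 1, 4, 5, 2, 3], [(0, 1)]), ([0, 1, 2, 5, 4, 3], [(0, 1)]), ([0, 1, 2, 3, 4, 5], [(0, 1)])],
     Robust [3, 2, 2] Open [5, 2] Open [([2, 3, 5, 4, 0, 6, 1], [(0, 1)]), ([6, 3, 1, 0, 5, 2, 4], [(1, 2)]), ([1, 2, 3, 4, 5, 6, 0], [(1, 5)]), ([2, 3, 4, 5, 6, 0, 1], [(0, 2)]), ([0, 1, 2, 3, 4, 5, 6], [(0, 3)])],
     Robust [3, 3, 1] Open [7] Open [([0, 4, 2, 3, 1, 6, 5], [(0, 1)]), ([5, 6, 4, 1, 3, 2, 0], [(0, 2)]), ([4, 6, 1, 2, 5, 3, 0], [(0, 3)]), ([0, 1, 2, 3, 6, 4, 5], [(4, 5)]), ([0, 1, 2, 3, 4, 5, 6], [(3, 6)])],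
     Robust [2, 1] Open [2, 1] Open [([0, 2, 1], [(0, 1)]), ([0, 1, 2], [(0, 1)])]]"

definition patterns2 :: "pattern list" where
  "patterns2 = [
     Exact [2, 2, 2] [6] [([0, 2, 4, 1, 3, 5], [(0, 3)]), ([0, 2, 1, 4, 3, 5], [(0, 2)]), ([0, 1, 2, 4, 3, 5], [(0, 1)]), ([0, 1, 2, 4, 5, 3], [(0, 1)]), ([0, 1, 2, 3, 4, 5], [(0, 1)])],
     Exact [2, 2, 1, 1] [4, 2] [([0, 4, 2, 5, 1, 3], [(0, 2)]), ([0, 2, 1, 3, 4, 5], [(0, 2)]), ([0, 1, 2, 4, 3, 5], [(0, 1)]), ([0, 1, 2, 3, 4, 5], [(0, 1)]), ([0, 1, 4, 5, 2, 3], [(0, 1)])],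
     Robust [5, 2] Strict [5, 2] Open [([3, 1, 5, 0, 4, 6, 2], [(0, 1)]), ([6, 3, 1, 0, 5, 2, 4], [(0, 5)]), ([2, 3, 5, 4, 0, 6, 1], [(0, 6)]), ([1, 2, 3, 4, 5, 6, 0], [(3, 5)]), ([0, 1, 2, 3, 4, 6, 5], [(5, 6)])],
     Exact [2, 2, 1, 1] [5, 1] [([0, 2, 1, 4, 5, 3], [(0, 2)]), ([0, 2, 4, 1, 5, 3], [(0, 1)]), ([0, 1, 2, 4, 5, 3], [(0, 1)]), ([0, 1, 2, 4, 3, 5], [(0, 1)]), ([0, 1, 2, 3, 4, 5], [(0, 1)])],
     Robust [7] Strict [7] Open [([6, 3, 1, 0, 5, 2, 4], [(0, 1)]), ([5, 6, 4, 1, 3, 2, 0], [(1, 4)]), ([2, 3, 6, 4, 5, 1, 0], [(1, 2)]), ([4, 6, 0, 1, 2, 3, 5], [(0, 5)]), ([1, 0, 2, 3, 4, 5, 6], [(0, 1)])],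
     Robust [5, 2] Open [6, 1] Open [([6, 3, 1, 0, 5, 2, 4], [(0, 2)]), ([5, 6, 4, 1, 3, 2, 0], [(0, 4)]), ([2, 3, 5, 4, 0, 6, 1], [(1, 2)]), ([2, 3, 4, 5, 6, 0, 1], [(0, 6)]), ([0, 1, 2, 3, 4, 5, 6], [(0, 5)])],
     Robust [3, 3, 1] Open [6, 1] Open [([6, 3, 1, 0, 5, 2, 4], [(0, 1)]), ([2, 0, 4, 3, 6, 5, 1], [(0, 3)]), ([2, 3, 6, 4, 5, 1, 0], [(1, 5)]), ([1, 2, 3, 4, 5, 6, 0], [(2, 5)]), ([0, 1, 2, 3, 4, 5, 6], [(0, 3)])],
     Robust [2, 2, 3] Open [4, 3] Open [([4, 1, 6, 2, 0, 3, 5], [(0, 1)]), ([0, 4, 2, 3, 1, 6, 5], [(0, 1)]), ([1, 2, 3, 4, 5, 6, 0], [(0, 2)]), ([2, 3, 4, 5, 6, 0, 1], [(0, 1)]), ([0, 1, 2, 3, 4, 5, 6], [(0, 1)])],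
     Exact [4, 2] [5, 1] [([0, 2, 1, 3, 4, 5], [(1, 4)]), ([0, 2, 4, 3, 5, 1], [(0, 3)]), ([0, 1, 3, 2, 4, 5], [(0, 3)]), ([0, 1, 3, 4, 5, 2], [(0, 3)]), ([0, 1, 2, 3, 4, 5], [(0, 4)])],
     Robust [3, 1, 1, 1] Open [3, 1, 1, 1] Open [([3, 4, 5, 0, 1, 2], [(0, 1)]), ([0, 3, 5, 1, 4, 2], [(0, 1)]), ([0, 2, 5, 3, 4, 1], [(3, 4)]), ([0, 1, 5, 3, 4, 2], [(3, 4)]), ([0, 1, 2, 3, 4, 5], [(3, 4)])],
     Robust [4, 2, 1] Open [5, 2] Open [([6, 3, 1, 0, 5, 2, 4], [(0, 1)]), ([4, 2, 3, 1, 6, 5, 0], [(0, 4)]), ([5, 6, 0, 1, 2, 3, 4], [(0, 1)]), ([2, 3, 4, 5, 6, 0, 1], [(2, 3)]), ([6, 0, 1, 2, 3, 4, 5], [(0, 1)])],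
     Robust [2, 2, 2, 2] Closed [8] Open [([5, 7, 0, 4, 2, 6, 1, 3], [(0, 1)]), ([4, 0, 6, 5, 7, 3, 2, 1], [(0, 3)]), ([6, 3, 1, 0, 7, 2, 5, 4], [(0, 1)]), ([6, 7, 5, 4, 1, 3, 2, 0], [(0, 1)]), ([0, 1, 2, 3, 4, 5, 6, 7], [(0, 1)])],
     Robust [3, 2, 1] Open [3, 2, 1] Open [([0, 2, 1, 3, 5, 4], [(0, 3)]), ([0, 1, 3, 2, 5, 4], [(0, 4)]), ([0, 2, 5, 3, 4, 1], [(3, 4)]), ([0, 1, 2, 3, 5, 4], [(3, 4)]), ([0, 1, 2, 3, 4, 5], [(3, 4)])],
     Robust [2, 1, 1, 1, 1] Strict [3, 1, 1, 1] Closed [([2, 3, 4, 0, 1, 5], [(0, 1)]), ([0, 2, 3, 1, 4, 5], [(0, 1)]), ([0, 2, 5, 1, 3, 4], [(0, 1)]), ([0, 1, 2, 3, 4, 5], [(0, 1)]), ([0, 1, 5, 2, 3, 4], [(0, 1)])]]"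

definition patterns3 :: "pattern list" where
  "patterns3 = [
     Stretched [6] [3, 1, 1, 1] [([1, 3, 2, 0, 4, 5], [(0, 4)]), ([1, 3, 5, 0, 2, 4], [(3, 4)]), ([1, 2, 5, 0, 3, 4], [(1, 5)]), ([1, 2, 4, 0, 3, 5], [(0, 5)]), ([1, 2, 3, 0, 4, 5], [(0, 4)])],
     Stretched [6] [2, 2, 1, 1] [([1, 3, 2, 4, 0, 5], [(0, 1)]), ([1, 5, 2, 4, 0, 3], [(0, 1)]), ([1, 5, 2, 3, 0, 4], [(0, 1)]), ([1, 2, 3, 5, 0, 4], [(0, 1)]), ([1, 2, 3, 4, 0, 5], [(0, 1)])],
     Robust [5, 1, 1] Closed [5, 2] Open [([6, 3, 1, 0, 5, 2, 4], [(0, 1)]), ([0, 4, 2, 3, 1, 6, 5], [(0, 5)]), ([1, 2, 3, 5, 4, 0, 6], [(0, 5)]), ([1, 2, 3, 4, 5, 6, 0], [(3, 5)]), ([0, 1, 2, 3, 4, 5, 6], [(5, 6)])],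
     Exact [3, 2, 2] [5, 1, 1] [([2, 3, 5, 4, 0, 6, 1], [(1, 3)]), ([1, 2, 3, 5, 4, 0, 6], [(2, 4)]), ([6, 3, 1, 0, 5, 2, 4], [(0, 4)]), ([1, 2, 3, 4, 5, 6, 0], [(0, 5)]), ([0, 1, 2, 3, 4, 5, 6], [(0, 3)])],
     Exact [3, 1, 1, 1, 1] [3, 2, 2] [([6, 3, 1, 0, 5, 2, 4], [(0, 1)]), ([0, 2, 3, 1, 4, 5, 6], [(2, 3)]), ([5, 6, 4, 1, 3, 2, 0], [(0, 1)]), ([1, 2, 3, 4, 5, 6, 0], [(0, 5)]), ([0, 1, 2, 3, 4, 5, 6], [(3, 4)])],
     Robust [6, 1] Open [7] Open [([5, 6, 4, 1, 3, 2, 0], [(0, 2)]), ([3, 4, 2, 6, 5, 1, 0], [(1, 3)]), ([2, 3, 6, 4, 5, 1, 0], [(0, 6)]), ([0, 1, 6, 3, 4, 5, 2], [(0, 6)]), ([0, 1, 2, 3, 4, 5, 6], [(0, 6)])],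
     Robust [4, 3] Open [7] Open [([6, 3, 1, 0, 5, 2, 4], [(0, 1)]), ([0, 4, 2, 3, 1, 6, 5], [(0, 3)]), ([0, 1, 6, 3, 4, 5, 2], [(1, 5)]), ([1, 2, 0, 4, 5, 6, 3], [(1, 6)]), ([4, 1, 2, 3, 0, 5, 6], [(0, 4)])],
     Robust [4, 3] Open [6, 1] Open [([2, 0, 4, 3, 6, 5, 1], [(0, 1)]), ([2, 3, 5, 4, 0, 6, 1], [(2, 6)]), ([0, 1, 6, 3, 4, 5, 2], [(0, 2)]), ([2, 3, 4, 5, 6, 0, 1], [(0, 6)]), ([0, 1, 2, 3, 4, 5, 6], [(0, 6)])],
     Robust [4, 3] Open [5, 2] Strict [([2, 0, 4, 3, 6, 5, 1], [(0, 1)]), ([6, 3, 1, 0, 5, 2, 4], [(1, 5)]), ([4, 6, 5, 1, 2, 3, 0], [(1, 3)]), ([1, 2, 3, 4, 5, 6, 0], [(0, 5)]), ([0, 1, 2, 3, 4, 5, 6], [(0, 4)])],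
     Robust [4, 3] Strict [4, 3] Open [([2, 0, 4, 3, 6, 5, 1], [(0, 5)]), ([5, 6, 4, 1, 3, 2, 0], [(0, 3)]), ([0, 4, 2, 3, 1, 6, 5], [(1, 6)]), ([2, 3, 4, 5, 6, 0, 1], [(1, 4)]), ([0, 1, 2, 3, 5, 4, 6], [(4, 5)])],
     Robust [2, 2, 1] Closed [2, 3] Strict [([0, 2, 1, 3, 4], [(0, 1)]), ([0, 4, 1, 2, 3], [(0, 1)]), ([0, 1, 2, 4, 3], [(0, 1)]), ([0, 1, 2, 3, 4], [(0, 1)])],
     Exact [6] [6] [([0, 2, 1, 3, 5, 4], [(0, 3)]), ([0, 2, 1, 5, 4, 3], [(0, 3)]), ([0, 1, 3, 2, 5, 4], [(0, 4)]), ([0, 1, 5, 3, 4, 2], [(0, 3)]), ([0, 1, 2, 3, 5, 4], [(0, 4)])],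
     Exact [5, 1] [5, 1] [([0, 2, 1, 3, 5, 4], [(0, 3)]), ([0, 2, 1, 4, 5, 3], [(0, 3)]), ([0, 1, 3, 2, 5, 4], [(1, 2)]), ([0, 1, 2, 4, 5, 3], [(0, 4)]), ([0, 1, 2, 4, 3, 5], [(0, 3)])],
     Exact [3, 1, 1, 1] [5, 1] [([0, 3, 2, 4, 5, 1], [(1, 3)]), ([0, 2, 3, 4, 5, 1], [(0, 3)]), ([0, 1, 3, 4, 5, 2], [(2, 3)]), ([0, 1, 3, 2, 4, 5], [(0, 4)]), ([0, 1, 2, 3, 4, 5], [(0, 3)])]]"

definition patterns4 :: "pattern list" where
  "patterns4 = [
     Robust [7] Closed [7] Open [([6, 3, 1, 0, 5, 2, 4], [(0, 1)]), ([5, 6, 4, 1, 3, 2, 0], [(1, 4)]), ([1, 2, 3, 5, 4, 0, 6], [(0, 6)]), ([0, 1, 6, 3, 4, 5, 2], [(1, 5)]), ([1, 0, 2, 3, 4, 5, 6], [(0, 1)])],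
     Robust [5, 1, 1] Closed [6, 1] Open [([6, 3, 1, 0, 5, 2, 4], [(0, 2)]), ([4, 2, 3, 1, 6, 5, 0], [(0, 4)]), ([2, 3, 5, 4, 0, 6, 1], [(1, 2)]), ([1, 2, 3, 4, 5, 6, 0], [(4, 5)]), ([0, 1, 2, 3, 4, 5, 6], [(0, 5)])],
     Exact [3, 2, 2] [3, 3, 1] [([4, 2, 5, 3, 1, 0, 6], [(0, 1)]), ([2, 3, 5, 4, 0, 6, 1], [(0, 4)]), ([6, 3, 1, 0, 5, 2, 4], [(0, 1)]), ([1, 2, 3, 4, 5, 6, 0], [(0, 3)]), ([0, 1, 2, 3, 4, 5, 6], [(3, 4)])],
     Exact [2, 2, 2, 1] [7] [([2, 0, 4, 3, 6, 5, 1], [(0, 3)]), ([6, 3, 1, 0, 5, 2, 4], [(0, 1)]), ([5, 6, 4, 1, 3, 2, 0], [(0, 2)]), ([1, 2, 3, 5, 4, 0, 6], [(0, 2)]), ([0, 1, 2, 3, 4, 5, 6], [(0, 1)])],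
     Exact [2, 2, 2, 1] [3, 3, 1] [([6, 3, 1, 0, 5, 2, 4], [(0, 4)]), ([2, 3, 5, 4, 0, 6, 1], [(0, 1)]), ([4, 2, 1, 5, 0, 3, 6], [(0, 3)]), ([1, 2, 3, 4, 5, 6, 0], [(0, 1)]), ([0, 1, 2, 3, 4, 5, 6], [(0, 1)])],
     Robust [3, 3, 1] Open [3, 4] Open [([6, 3, 1, 0, 5, 2, 4], [(0, 1)]), ([2, 3, 6, 4, 5, 1, 0], [(0, 1)]), ([1, 2, 3, 4, 5, 6, 0], [(1, 5)]), ([6, 0, 1, 2, 3, 4, 5], [(3, 6)]), ([0, 1, 2, 3, 4, 5, 6], [(3, 6)])],
     Stretched [5, 2] [3, 1, 1, 1, 1] [([6, 3, 1, 0, 5, 2, 4], [(0, 3)]), ([4, 1, 6, 2, 0, 3, 5], [(3, 4)]), ([6, 0, 1, 2, 3, 4, 5], [(3, 4)]), ([0, 2, 3, 1, 4, 5, 6], [(1, 3)]), ([0, 1, 2, 3, 4, 5, 6], [(0, 3)])],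
     Stretched [5, 2] [2, 2, 1, 1, 1] [([4, 2, 3, 1, 6, 5, 0], [(0, 1)]), ([4, 1, 6, 2, 0, 3, 5], [(0, 1)]), ([6, 3, 1, 0, 5, 2, 4], [(0, 1)]), ([2, 0, 4, 3, 6, 5, 1], [(0, 1)]), ([0, 1, 2, 3, 4, 5, 6], [(0, 1)])],
     Exact [2, 2, 2, 2] [4, 4] [([0, 7, 4, 3, 5, 6, 2, 1], [(0, 1)]), ([6, 2, 7, 1, 5, 4, 0, 3], [(0, 2)]), ([6, 3, 1, 0, 7, 2, 5, 4], [(0, 4)]), ([3, 6, 2, 7, 1, 5, 4, 0], [(0, 2)]), ([0, 1, 2, 3, 4, 5, 6, 7], [(0, 1)])],
     Robust [2, 2, 2, 2] Closed [3, 3, 2] Open [([4, 0, 6, 5, 7, 3, 2, 1], [(0, 1)]), ([3, 6, 2, 7, 1, 5, 4, 0], [(0, 1)]), ([6, 2, 7, 1, 5, 4, 0, 3], [(0, 1)]), ([0, 1, 2, 3, 4, 5, 6, 7], [(0, 1)])],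
     Robust [3, 2, 2, 1] Open [3, 3, 2] Open [([3, 6, 2, 7, 1, 5, 4, 0], [(0, 1)]), ([6, 3, 1, 0, 7, 2, 5, 4], [(0, 1)]), ([3, 4, 5, 6, 7, 0, 1, 2], [(0, 1)]), ([2, 3, 4, 5, 6, 7, 0, 1], [(0, 1)]), ([0, 1, 2, 3, 4, 5, 6, 7], [(3, 4)])],
     Robust [2, 2, 4] Open [3, 3, 2] Open [([4, 0, 6, 5, 7, 3, 2, 1], [(0, 1)]), ([4, 1, 5, 3, 6, 7, 2, 0], [(0, 4)]), ([3, 4, 5, 6, 7, 0, 1, 2], [(0, 3)]), ([7, 0, 1, 2, 3, 4, 5, 6], [(0, 1)]), ([2, 3, 4, 5, 6, 7, 0, 1], [(0, 1)])],
     Robust [2, 1, 1, 1] Strict [3, 1, 1] Closed [([0, 2, 3, 1, 4], [(0, 1)]), ([0, 2, 4, 1, 3], [(0, 1)]), ([0, 1, 2, 3, 4], [(0, 1)]), ([0, 1, 4, 2, 3], [(0, 1)])],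
     Robust [1, 4] Strict [2, 2, 1] Closed [([0, 1, 2, 4, 3], [(0, 1)]), ([0, 1, 2, 3, 4], [(0, 1)]), ([1, 4, 2, 3, 0], [(0, 1)]), ([1, 2, 3, 4, 0], [(0, 1)])]]"

definition patterns5 :: "pattern list" where
  "patterns5 = [
     Exact [4, 2] [6] [([0, 2, 1, 4, 3, 5], [(0, 4)]), ([0, 3, 4, 2, 1, 5], [(2, 5)]), ([0, 1, 3, 4, 2, 5], [(1, 3)]), ([0, 1, 2, 4, 3, 5], [(0, 3)]), ([0, 1, 2, 3, 4, 5], [(0, 4)])],
     Robust [4, 2] Closed [4, 2] Open [([0, 2, 1, 4, 3, 5], [(0, 3)]), ([0, 1, 3, 4, 2, 5], [(0, 3)]), ([0, 1, 2, 4, 3, 5], [(3, 5)]), ([0, 1, 4, 5, 2, 3], [(2, 3)]), ([0, 1, 2, 3, 4, 5], [(4, 5)])],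
     Robust [3, 3] Closed [4, 2] Open [([0, 2, 3, 5, 1, 4], [(0, 3)]), ([0, 1, 3, 5, 2, 4], [(0, 2)]), ([0, 1, 3, 4, 2, 5], [(4, 5)]), ([0, 1, 2, 3, 4, 5], [(0, 3)])],
     Exact [3, 2, 1] [6] [([0, 2, 3, 1, 4, 5], [(0, 4)]), ([0, 2, 1, 3, 5, 4], [(0, 5)]), ([0, 1, 3, 2, 4, 5], [(0, 4)]), ([0, 1, 2, 3, 5, 4], [(3, 5)]), ([0, 1, 2, 3, 4, 5], [(2, 5)])],
     Exact [3, 1, 1, 1] [4, 2] [([0, 2, 3, 4, 1, 5], [(2, 3)]), ([0, 2, 1, 3, 4, 5], [(0, 3)]), ([0, 1, 3, 4, 2, 5], [(0, 5)]), ([0, 1, 2, 3, 4, 5], [(0, 3)])],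
     Exact [3, 1, 1, 1] [3, 3] [([0, 2, 1, 3, 4, 5], [(3, 4)]), ([0, 2, 3, 1, 4, 5], [(0, 4)]), ([0, 1, 3, 2, 4, 5], [(0, 4)]), ([0, 1, 2, 3, 4, 5], [(3, 4)])],
     Exact [2, 2, 1, 1] [3, 3] [([0, 2, 4, 1, 3, 5], [(0, 3)]), ([0, 2, 4, 1, 5, 3], [(0, 3)]), ([0, 1, 2, 3, 4, 5], [(0, 1)]), ([0, 1, 4, 2, 3, 5], [(0, 1)])],
     Stretched [2, 4] [2, 2, 1, 1] [([0, 3, 1, 5, 2, 4], [(0, 1)]), ([0, 3, 1, 4, 2, 5], [(0, 1)]), ([0, 3, 4, 5, 1, 2], [(0, 1)]), ([0, 1, 3, 5, 2, 4], [(0, 1)]), ([0, 1, 3, 4, 2, 5], [(0, 1)])],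
     Exact [3, 3, 1] [5, 2] [([2, 3, 5, 4, 0, 6, 1], [(1, 5)]), ([6, 3, 1, 0, 5, 2, 4], [(1, 2)]), ([5, 6, 4, 1, 3, 2, 0], [(0, 1)]), ([2, 3, 6, 4, 5, 1, 0], [(0, 2)]), ([0, 1, 2, 3, 4, 5, 6], [(0, 5)])],
     Exact [3, 3, 1] [5, 1, 1] [([5, 6, 4, 1, 3, 2, 0], [(0, 1)]), ([6, 3, 1, 0, 5, 2, 4], [(1, 4)]), ([2, 3, 5, 4, 0, 6, 1], [(0, 1)]), ([1, 2, 3, 5, 4, 0, 6], [(0, 3)]), ([0, 1, 2, 3, 4, 5, 6], [(0, 5)])],
     Robust [3, 3, 1] Closed [4, 3] Open [([2, 3, 5, 4, 0, 6, 1], [(0, 1)]), ([5, 6, 4, 1, 3, 2, 0], [(0, 1)]), ([1, 2, 3, 4, 5, 6, 0], [(1, 4)]), ([0, 1, 2, 3, 4, 5, 6], [(0, 3)]), ([6, 0, 1, 2, 3, 4, 5], [(0, 1)])],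
     Exact [3, 3, 1] [4, 2, 1] [([6, 3, 1, 0, 5, 2, 4], [(0, 1)]), ([2, 3, 6, 4, 5, 1, 0], [(0, 5)]), ([1, 2, 3, 4, 5, 6, 0], [(0, 4)]), ([6, 0, 1, 2, 3, 4, 5], [(0, 1)]), ([0, 1, 2, 3, 4, 5, 6], [(0, 3)])],
     Robust [3, 3, 1] Closed [3, 3, 1] Strict [([2, 3, 5, 4, 0, 6, 1], [(0, 4)]), ([6, 3, 1, 0, 5, 2, 4], [(0, 1)]), ([1, 2, 3, 4, 5, 6, 0], [(5, 6)]), ([0, 1, 2, 3, 6, 4, 5], [(4, 6)]), ([6, 1, 2, 3, 4, 5, 0], [(0, 6)])],
     Exact [3, 3, 1] [3, 3, 1] [([2, 3, 5, 4, 0, 6, 1], [(0, 4)]), ([6, 3, 1, 0, 5, 2, 4], [(0, 5)]), ([5, 6, 4, 1, 3, 2, 0], [(1, 3)]), ([1, 2, 3, 5, 4, 0, 6], [(0, 3)]), ([1, 5, 0, 3, 4, 2, 6], [(0, 4)])]]"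

definition patterns6 :: "pattern list" where
  "patterns6 = [
     Exact [3, 1, 1, 1, 1] [7] [([6, 3, 1, 0, 5, 2, 4], [(0, 1)]), ([1, 4, 6, 2, 3, 0, 5], [(0, 1)]), ([4, 6, 1, 2, 5, 3, 0], [(0, 1)]), ([5, 6, 4, 1, 3, 2, 0], [(0, 1)]), ([0, 1, 2, 3, 4, 5, 6], [(0, 3)])],
     Exact [3, 1, 1, 1, 1] [5, 2] [([6, 3, 1, 0, 5, 2, 4], [(0, 1)]), ([4, 2, 5, 3, 1, 0, 6], [(0, 2)]), ([1, 2, 3, 4, 5, 6, 0], [(0, 5)]), ([4, 1, 6, 2, 0, 3, 5], [(0, 2)]), ([0, 1, 2, 3, 4, 5, 6], [(0, 3)])],
     Exact [3, 1, 1, 1, 1] [4, 3] [([6, 3, 1, 0, 5, 2, 4], [(0, 1)]), ([2, 3, 5, 4, 0, 6, 1], [(0, 1)]), ([1, 2, 3, 4, 5, 6, 0], [(0, 4)]), ([0, 1, 2, 3, 4, 5, 6], [(0, 3)]), ([4, 6, 3, 5, 0, 1, 2], [(0, 1)])],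
     Exact [3, 1, 1, 1, 1] [4, 2, 1] [([5, 6, 4, 1, 3, 2, 0], [(0, 1)]), ([6, 3, 1, 0, 5, 2, 4], [(0, 1)]), ([1, 2, 3, 4, 5, 6, 0], [(2, 3)]), ([1, 2, 3, 5, 4, 0, 6], [(0, 4)]), ([0, 1, 2, 3, 4, 5, 6], [(0, 3)])],
     Exact [3, 1, 1, 1, 1] [3, 3, 1] [([2, 3, 5, 4, 0, 6, 1], [(0, 1)]), ([5, 6, 4, 1, 3, 2, 0], [(0, 1)]), ([1, 2, 3, 4, 5, 6, 0], [(2, 3)]), ([6, 3, 1, 0, 5, 2, 4], [(0, 1)]), ([0, 1, 2, 3, 4, 5, 6], [(3, 4)])],
     Exact [2, 2, 2, 1] [3, 1, 1, 1, 1] [([6, 3, 1, 0, 5, 2, 4], [(0, 1)]), ([0, 4, 2, 3, 1, 6, 5], [(0, 1)]), ([5, 6, 4, 1, 3, 2, 0], [(0, 1)]), ([0, 1, 2, 3, 4, 5, 6], [(0, 1)])],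
     Exact [2, 2, 1, 1, 1] [7] [([2, 0, 4, 3, 6, 5, 1], [(0, 3)]), ([1, 5, 0, 3, 4, 2, 6], [(0, 2)]), ([6, 3, 1, 0, 5, 2, 4], [(0, 4)]), ([5, 6, 4, 1, 3, 2, 0], [(0, 1)]), ([0, 1, 2, 3, 4, 5, 6], [(0, 1)])],
     Exact [2, 2, 1, 1, 1] [3, 3, 1] [([2, 0, 4, 3, 6, 5, 1], [(0, 1)]), ([6, 3, 1, 0, 5, 2, 4], [(0, 4)]), ([2, 3, 5, 4, 0, 6, 1], [(0, 1)]), ([0, 1, 2, 3, 4, 5, 6], [(0, 1)]), ([6, 0, 1, 2, 3, 4, 5], [(0, 1)])],
     Stretched [4, 3] [2, 2, 1, 1, 1] [([0, 2, 3, 1, 4, 5, 6], [(0, 1)]), ([3, 1, 5, 0, 4, 6, 2], [(0, 1)]), ([6, 3, 1, 0, 5, 2, 4], [(0, 1)]), ([5, 6, 0, 1, 2, 3, 4], [(0, 1)]), ([0, 1, 2, 3, 4, 5, 6], [(0, 1)])],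
     Stretched [2, 5] [3, 1, 1, 1, 1] [([6, 3, 1, 0, 5, 2, 4], [(0, 1)]), ([5, 4, 6, 2, 1, 0, 3], [(0, 4)]), ([6, 0, 1, 2, 3, 4, 5], [(0, 1)]), ([5, 6, 3, 0, 4, 2, 1], [(0, 4)]), ([5, 6, 4, 1, 3, 2, 0], [(1, 4)])],
     Exact [4, 4] [5, 1, 1, 1] [([6, 3, 1, 0, 7, 2, 5, 4], [(1, 5)]), ([5, 7, 0, 4, 2, 6, 1, 3], [(0, 2)]), ([4, 0, 6, 5, 7, 3, 2, 1], [(0, 2)]), ([5, 7, 0, 1, 3, 6, 4, 2], [(0, 1)]), ([0, 1, 2, 3, 4, 5, 6, 7], [(0, 4)])],
     Robust [3, 3, 1, 1] Closed [5, 3] Open [([6, 3, 1, 0, 7, 2, 5, 4], [(0, 1)]), ([5, 7, 0, 1, 3, 6, 4, 2], [(0, 1)]), ([0, 1, 2, 7, 4, 5, 6, 3], [(0, 3)]), ([0, 1, 2, 3, 4, 5, 6, 7], [(0, 5)]), ([3, 4, 5, 6, 7, 0, 1, 2], [(0, 3)])],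
     Exact [3, 3, 1, 1] [4, 2, 2] [([3, 6, 2, 7, 1, 5, 4, 0], [(0, 1)]), ([6, 3, 1, 0, 7, 2, 5, 4], [(0, 1)]), ([6, 2, 7, 1, 5, 4, 0, 3], [(0, 2)]), ([2, 7, 4, 5, 6, 3, 0, 1], [(0, 1)]), ([0, 1, 2, 3, 4, 5, 6, 7], [(0, 3)])],
     Exact [3, 1, 1, 1, 1, 1] [4, 4] [([7, 4, 5, 6, 0, 2, 1, 3], [(0, 1)]), ([6, 3, 1, 0, 7, 2, 5, 4], [(0, 1)]), ([6, 2, 7, 1, 5, 4, 0, 3], [(0, 2)]), ([2, 3, 4, 5, 6, 7, 0, 1], [(0, 1)]), ([0, 1, 2, 3, 4, 5, 6, 7], [(0, 3)])]]"

definition patterns7 :: "pattern list" where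
  "patterns7 = [
     Exact [3, 1, 1, 1, 1, 1] [4, 2, 2] [([3, 6, 2, 7, 1, 5, 4, 0], [(0, 1)]), ([6, 3, 1, 0, 7, 2, 5, 4], [(0, 1)]), ([6, 2, 7, 1, 5, 4, 0, 3], [(0, 2)]), ([2, 3, 4, 5, 6, 7, 0, 1], [(0, 1)]), ([0, 1, 2, 3, 4, 5, 6, 7], [(0, 3)])],
     Exact [2, 2, 2, 2] [5, 3] [([5, 7, 0, 4, 2, 6, 1, 3], [(0, 1)]), ([6, 2, 7, 1, 5, 4, 0, 3], [(0, 2)]), ([4, 0, 6, 5, 7, 3, 2, 1], [(0, 1)]), ([5, 7, 0, 1, 3, 6, 4, 2], [(0, 6)]), ([6, 3, 1, 0, 7, 2, 5, 4], [(0, 4)])],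
     Exact [2, 2, 2, 1, 1] [3, 1, 1, 1, 1, 1] [([6, 2, 7, 1, 5, 4, 0, 3], [(0, 1)]), ([6, 3, 1, 0, 7, 2, 5, 4], [(0, 1)]), ([1, 5, 3, 4, 2, 6, 7, 0], [(0, 1)]), ([3, 6, 2, 7, 1, 5, 4, 0], [(0, 1)]), ([0, 1, 2, 3, 4, 5, 6, 7], [(0, 1)])],
     Robust [3, 3, 2] Open [5, 3] Open [([4, 0, 6, 5, 7, 3, 2, 1], [(0, 1)]), ([6, 7, 3, 5, 0, 1, 4, 2], [(1, 3)]), ([0, 1, 2, 7, 4, 5, 6, 3], [(0, 3)]), ([2, 3, 4, 5, 6, 7, 0, 1], [(0, 3)]), ([0, 1, 2, 3, 4, 5, 6, 7], [(0, 5)])],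
     Robust [3, 3, 2] Open [4, 4] Closed [([6, 3, 1, 0, 7, 2, 5, 4], [(0, 1)]), ([3, 6, 2, 7, 1, 5, 4, 0], [(0, 2)]), ([2, 7, 4, 5, 6, 3, 0, 1], [(0, 1)]), ([6, 7, 5, 4, 1, 3, 2, 0], [(2, 4)]), ([0, 1, 2, 3, 4, 5, 6, 7], [(0, 3)])],
     Robust [3, 3, 2] Strict [3, 3, 2] Open [([3, 6, 2, 7, 1, 5, 4, 0], [(0, 1)]), ([5, 4, 7, 6, 1, 2, 3, 0], [(0, 3)]), ([4, 1, 5, 3, 6, 7, 2, 0], [(0, 4)]), ([6, 1, 7, 3, 4, 5, 2, 0], [(0, 7)]), ([0, 1, 2, 3, 4, 5, 7, 6], [(6, 7)])],
     Stretched [6, 2] [3, 1, 1, 1, 1, 1] [([5, 7, 0, 1, 3, 6, 4, 2], [(0, 4)]), ([0, 7, 4, 3, 5, 6, 2, 1], [(3, 4)]), ([7, 1, 2, 3, 6, 5, 4, 0], [(3, 4)]), ([0, 3, 4, 1, 2, 7, 6, 5], [(0, 3)]), ([0, 1, 2, 3, 4, 5, 6, 7], [(0, 3)])],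
     Stretched [6, 2] [2, 2, 1, 1, 1, 1] [([5, 7, 0, 4, 2, 6, 1, 3], [(0, 1)]), ([0, 2, 5, 3, 6, 1, 4, 7], [(0, 1)]), ([5, 7, 0, 1, 3, 6, 4, 2], [(0, 1)]), ([0, 1, 5, 3, 4, 2, 6, 7], [(0, 1)]), ([0, 1, 2, 3, 4, 5, 6, 7], [(0, 1)])],
     Stretched [3, 3, 2] [2, 2, 1, 1, 1, 1] [([5, 7, 0, 4, 2, 6, 1, 3], [(0, 1)]), ([3, 1, 4, 0, 2, 5, 6, 7], [(0, 1)]), ([0, 1, 2, 3, 4, 5, 6, 7], [(0, 1)]), ([5, 7, 0, 1, 3, 6, 4, 2], [(0, 1)]), ([0, 1, 5, 3, 4, 2, 6, 7], [(0, 1)])],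
     Exact [3, 3, 3] [5, 1, 1, 1, 1] [([2, 3, 1, 0, 8, 7, 6, 5, 4], [(0, 1)]), ([5, 4, 2, 3, 1, 0, 6, 7, 8], [(0, 5)]), ([2, 1, 0, 3, 4, 5, 6, 7, 8], [(1, 3)]), ([2, 3, 4, 5, 6, 7, 8, 0, 1], [(0, 3)]), ([0, 1, 2, 3, 4, 5, 6, 7, 8], [(0, 5)])],
     Exact [3, 3, 3] [4, 2, 1, 1, 1] [([2, 7, 5, 0, 8, 3, 1, 4, 6], [(1, 2)]), ([2, 3, 1, 0, 8, 7, 6, 5, 4], [(0, 1)]), ([7, 4, 2, 0, 6, 8, 3, 5, 1], [(0, 1)]), ([0, 1, 2, 3, 4, 5, 6, 7, 8], [(0, 3)]), ([2, 3, 4, 5, 6, 7, 8, 0, 1], [(0, 1)])],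
     Exact [3, 1, 1, 1, 1, 1, 1] [3, 3, 3] [([7, 4, 2, 0, 6, 8, 3, 5, 1], [(0, 1)]), ([2, 1, 0, 3, 4, 5, 6, 7, 8], [(3, 4)]), ([5, 4, 2, 3, 1, 0, 6, 7, 8], [(0, 1)]), ([2, 3, 1, 0, 8, 7, 6, 5, 4], [(0, 5)]), ([0, 1, 2, 3, 4, 5, 6, 7, 8], [(3, 4)])],
     Robust [2, 2, 2, 2, 1] Closed [5, 4] Open [([2, 7, 5, 0, 8, 3, 1, 4, 6], [(0, 1)]), ([7, 4, 2, 0, 6, 8, 3, 5, 1], [(0, 3)]), ([2, 1, 0, 3, 4, 5, 6, 7, 8], [(0, 3)]), ([0, 1, 2, 3, 4, 5, 6, 7, 8], [(0, 1)]), ([2, 3, 1, 0, 8, 7, 6, 5, 4], [(0, 1)])],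
     Exact [2, 2, 2, 2, 1] [3, 3, 3] [([6, 4, 8, 2, 7, 1, 3, 5, 0], [(0, 1)]), ([7, 4, 2, 0, 6, 8, 3, 5, 1], [(0, 4)]), ([4, 5, 3, 7, 8, 0, 1, 2, 6], [(0, 1)]), ([2, 3, 1, 0, 8, 7, 6, 5, 4], [(0, 1)]), ([0, 1, 2, 3, 4, 5, 6, 7, 8], [(0, 1)])]]"

definition patterns :: "pattern list" where
  "patterns = patterns1 @ patterns2 @ patterns3 @ patterns4 @ patterns5 @ patterns6 @ patterns7"

lemma valid_patterns1: "\<forall>p \<in> set patterns1. valid_pattern p"
  by code_simp

lemma valid_patterns2: "\<forall>p \<in> set patterns2. valid_pattern p"
  by code_simp

lemma valid_patterns3: "\<forall>p \<in> set patterns3. valid_pattern p"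
  by code_simp

lemma valid_patterns4: "\<forall>p \<in> set patterns4. valid_pattern p"
  by code_simp

lemma valid_patterns5: "\<forall>p \<in> set patterns5. valid_pattern p"
  by code_simp

lemma valid_patterns6: "\<forall>p \<in> set patterns6. valid_pattern p"
  by code_simp

lemma valid_patterns7: "\<forall>p \<in> set patterns7. valid_pattern p"
  by code_simp

text \<open>Pairs of types in degree six with certificates for four profiles, one of them
  \<open>(1, 1, 1)\<close>. Both orders are listed, since \<open>resolves_six\<close> does not use
  symmetry. The type 5+1 does not occur: the argument that follows needs odd permutations commuting
  with both factors.\<close>

definition exceptional_six :: "(nat list \<times> nat list \<times> (nat list \<times> (nat \<times> nat) list) list) list" where
  "exceptional_six = [
     ([4, 2], [3, 3], [([0, 2, 4, 1, 3, 5], [(0, 1)]), ([0, 1, 4, 2, 5, 3], [(0, 3)]), ([0, 1, 4, 2, 3, 5], [(2, 5)]), ([0, 1, 2, 3, 4, 5], [(0, 3)])]),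
     ([3, 3], [4, 2], [([0, 2, 3, 5, 1, 4], [(0, 3)]), ([0, 1, 3, 5, 2, 4], [(0, 2)]), ([0, 1, 3, 4, 2, 5], [(4, 5)]), ([0, 1, 2, 3, 4, 5], [(0, 3)])]),
     ([4, 2], [3, 1, 1, 1], [([0, 3, 4, 1, 2, 5], [(2, 5)]), ([0, 2, 1, 3, 4, 5], [(0, 3)]), ([0, 1, 4, 2, 3, 5], [(0, 5)]), ([0, 1, 2, 3, 4, 5], [(0, 3)])]),
     ([3, 1, 1, 1], [4, 2], [([0, 2, 3, 4, 1, 5], [(2, 3)]), ([0, 2, 1, 3, 4, 5], [(0, 3)]), ([0, 1, 3, 4, 2, 5], [(0, 5)]), ([0, 1, 2, 3, 4, 5], [(0, 3)])]),
     ([3, 3], [3, 1, 1, 1], [([0, 2, 1, 3, 4, 5], [(3, 4)]), ([0, 2, 3, 1, 4, 5], [(0, 5)]), ([0, 1, 3, 2, 4, 5], [(0, 4)]), ([0, 1, 2, 3, 4, 5], [(3, 4)])]),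
     ([3, 1, 1, 1], [3, 3], [([0, 2, 1, 3, 4, 5], [(3, 4)]), ([0, 2, 3, 1, 4, 5], [(0, 4)]), ([0, 1, 3, 2, 4, 5], [(0, 4)]), ([0, 1, 2, 3, 4, 5], [(3, 4)])]),
     ([3, 3], [2, 2, 1, 1], [([0, 3, 1, 4, 2, 5], [(0, 1)]), ([0, 3, 1, 5, 2, 4], [(0, 1)]), ([0, 1, 2, 3, 4, 5], [(0, 1)]), ([0, 1, 3, 4, 2, 5], [(0, 1)])]),
     ([2, 2, 1, 1], [3, 3], [([0, 2, 4, 1, 3, 5], [(0, 3)]), ([0, 2, 4, 1, 5, 3], [(0, 3)]), ([0, 1, 2, 3, 4, 5], [(0, 1)]), ([0, 1, 4, 2, 3, 5], [(0, 1)])]),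
     ([3, 1, 1, 1], [2, 2, 1, 1], [([0, 3, 4, 5, 1, 2], [(0, 1)]), ([0, 3, 1, 4, 2, 5], [(0, 1)]), ([0, 1, 3, 4, 2, 5], [(0, 1)]), ([0, 1, 2, 3, 4, 5], [(0, 1)])]),
     ([2, 2, 1, 1], [3, 1, 1, 1], [([0, 4, 5, 1, 2, 3], [(0, 1)]), ([0, 2, 4, 1, 3, 5], [(0, 1)]), ([0, 1, 4, 2, 3, 5], [(0, 1)]), ([0, 1, 2, 3, 4, 5], [(0, 1)])])]"

lemma valid_patterns: "\<forall>p \<in> set patterns. valid_pattern p"
  unfolding patterns_def set_append ball_Un
  by (intro conjI valid_patterns1 valid_patterns2 valid_patterns3 valid_patterns4 valid_patterns5 valid_patterns6 valid_patterns7)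

section \<open>Coverage of all pairs of types\<close>

lemma sorted_wrt_all_pairs:
  assumes "\<And>x y. P x y \<Longrightarrow> P y x"
  shows "sorted_wrt P xs \<Longrightarrow> \<forall>x \<in> set xs. P x x \<Longrightarrow> x \<in> set xs \<Longrightarrow> y \<in> set xs \<Longrightarrow> P x y"
  by (induction xs) (auto intro: assms)

text \<open>The categories of all residues modulo 4 together, so that a single evaluation serves
  every degree from 9 on. Pairs that never occur in the same degree are checked too, at the smaller
  of their counts.\<close>

definition all_categories :: "(category \<times> nat) list" where
  "all_categories = categories 1 @ [(([2, 2, 2, 2], 0, False), 2)]"

text \<open>As \<open>resolves\<close> is symmetric, \<open>sorted_wrt\<close> visits each unordered
  pair of entries once, and the diagonal is added separately. The \<open>let\<close> shares the list
  of shapes among all these checks.\<close>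

definition all_resolved :: "(category \<times> nat) list \<Rightarrow> bool" where
  "all_resolved cs \<longleftrightarrow> (let S = map shape patterns in
     sorted_wrt (\<lambda>c d. resolves S (min (snd c) (snd d)) (fst c) (fst d)) cs \<and>
     (\<forall>c \<in> set cs. resolves S (snd c) (fst c) (fst c)))"

lemma all_resolvedD:
  assumes "all_resolved cs" "c \<in> set cs" "d \<in> set cs"
  shows "resolves (map shape patterns) (min (snd c) (snd d)) (fst c) (fst d)"
proof -
  let ?R = "\<lambda>c d. resolves (map shape patterns) (min (snd c) (snd d)) (fst c) (fst d)"
  have "?R y x" if "?R x y" for x y
    using resolves_sym[OF that] by (simp only: min.commute)
  moreover have "sorted_wrt ?R cs" "\<forall>c \<in> set cs. ?R c c"
    using assms(1) unfolding all_resolved_def Let_def by simp_all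
  ultimately show ?thesis using sorted_wrt_all_pairs[of ?R cs c d] assms(2,3) by blast
qed

definition exact_categories :: "nat \<Rightarrow> nat \<Rightarrow> (category \<times> nat) list" where
  "exact_categories n k = map (\<lambda>ls. ((ls, 0, False), k)) (even_types n)"

lemma exact_resolvedD:
  assumes "all_resolved (exact_categories n k)" "ls \<in> set (even_types n)" "ms \<in> set (even_types n)"
  shows "resolves (map shape patterns) k (ls, 0, False) (ms, 0, False)"
proof -
  have "((us, 0, False), k) \<in> set (exact_categories n k)" if "us \<in> set (even_types n)" for us
    using that by (simp add: exact_categories_def)
  from all_resolvedD[OF assms(1) this[OF assms(2)] this[OF assms(3)]] show ?thesis by simp
qed

lemma resolved_large: "all_resolved all_categories"
  by code_simp

text \<open>Below degree 9 complete cycle types take the place of the categories. The count 2 is all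
  that is claimed in degree 8, which is divisible by 4.\<close>

lemma resolved_eight: "all_resolved (exact_categories 8 2)"
  by code_simp

lemma resolved_seven: "all_resolved (exact_categories 7 5)"
  by code_simp

definition resolves_six :: "nat list \<Rightarrow> nat list \<Rightarrow> bool" where
  "resolves_six ls ms \<longleftrightarrow> (\<exists>t \<in> set exceptional_six. fst t = ls \<and> fst (snd t) = ms)"

definition splits_five_cycles :: "nat list \<Rightarrow> nat list \<Rightarrow> (nat list \<times> (nat \<times> nat) list) list \<Rightarrow> bool" where
  "splits_five_cycles ls ms vs \<longleftrightarrow> exact_ok ls ms vs \<and> length vs = 4 \<and> sum_list ls = 6 \<and>
     (1, 1, 1) \<in> set (map (\<lambda>v. label_profile 6 (gamma ls Closed ms (fst v))) vs)"

lemma valid_six: "\<forall>t \<in> set exceptional_six. splits_five_cycles (fst t) (fst (snd t)) (snd (snd t))"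
  by code_simp

lemma even_types_six: "even_types 6 = [[5, 1], [4, 2], [3, 3], [3, 1, 1, 1], [2, 2, 1, 1]]"
  by code_simp

definition all_resolved_six :: bool where
  "all_resolved_six \<longleftrightarrow> (let S = map shape patterns in \<forall>ls \<in> set (even_types 6). \<forall>ms \<in> set (even_types 6).
     resolves S 5 (ls, 0, False) (ms, 0, False) \<or> resolves_six ls ms \<and> [5, 1] \<notin> {ls, ms})"

lemma resolved_six: all_resolved_six
  by code_simp

section \<open>Assembly of the lower and upper bounds\<close>

lemma categories_subset: "set (categories k) \<subseteq> set all_categories"
  by (auto simp: categories_def all_categories_def)

lemma categories_rank:
  "c \<in> set (categories k) \<Longrightarrow> (if k = 0 then 2 else if k = 1 then 4 else 5) \<le> snd c"
  by (auto simp: categories_def split: if_splits)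

lemma many_values:
  assumes ab: "a \<in> Alt n - {id}" "b \<in> Alt n - {id}" and n: "n \<ge> 7"
  shows "many (if n mod 4 = 0 then 2 else if n mod 4 = 1 then 4 else 5) {1..n} (inv' a) b"
proof -
  let ?X = "{1..n}" and ?k = "if n mod 4 = 0 then 2 else if n mod 4 = 1 then 4 else (5 :: nat)"
  have a: "inv' a permutes ?X" "evenperm (inv' a)" "inv' a \<noteq> id"
    using Alt_inv[of a n] ab(1) permutes_inv_inv[of a ?X] by auto
  have b: "b permutes ?X" "evenperm b" "b \<noteq> id" using ab(2) by auto
  have X: "finite ?X" "card ?X = n" by simp_all
  note res = many_by_resolves[OF X(1) a(1) b(1) valid_patterns]
  consider "n = 7" | "n = 8" | "n \<ge> 9" using n by linarith
  then show ?thesis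
  proof cases
    case 3
    obtain ls where ls: "type_of ?X (inv' a) ls" "sorted_wrt (\<ge>) ls" "0 \<notin> set ls" "sum_list ls = n"
      "even (length (filter even ls))" "\<not> set ls \<subseteq> {1}" using type_exists[OF a(1) X(1) a(2,3)] X(2) by auto
    obtain ms where ms: "type_of ?X b ms" "sorted_wrt (\<ge>) ms" "0 \<notin> set ms" "sum_list ms = n"
      "even (length (filter even ms))" "\<not> set ms \<subseteq> {1}" using type_exists[OF b(1) X(1) b(2,3)] X(2) by auto
    obtain c where c: "c \<in> set (categories (n mod 4))" "in_category ?X (inv' a) (fst c)"
      using category_exists[OF ls(1-4) 3 ls(5,6)] by blast
    obtain d where d: "d \<in> set (categories (n mod 4))" "in_category ?X b (fst d)"
      using category_exists[OF ms(1-4) 3 ms(5,6)] by blast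
    have "resolves (map shape patterns) (min (snd c) (snd d)) (fst c) (fst d)"
      using all_resolvedD[OF resolved_large] categories_subset c(1) d(1) by blast
    from many_mono[OF res[OF this c(2) d(2)], of ?k] show ?thesis
      using categories_rank[OF c(1)] categories_rank[OF d(1)] by simp
  next
    case small: 1
    obtain ls where ls: "ls \<in> set (even_types n)" "type_of ?X (inv' a) ls"
      using even_type_exists[OF a(1) X(1) a(2,3)] X(2) by metis
    obtain ms where ms: "ms \<in> set (even_types n)" "type_of ?X b ms"
      using even_type_exists[OF b(1) X(1) b(2,3)] X(2) by metis
    have "resolves (map shape patterns) 5 (ls, 0, False) (ms, 0, False)" using exact_resolvedD[OF resolved_seven] ls(1) ms(1) small by blast
    from res[OF this type_closed[OF ls(2) subset_mset.order_refl] type_closed[OF ms(2) subset_mset.order_refl]]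
    show ?thesis using small by simp
  next
    case small: 2
    obtain ls where ls: "ls \<in> set (even_types n)" "type_of ?X (inv' a) ls"
      using even_type_exists[OF a(1) X(1) a(2,3)] X(2) by metis
    obtain ms where ms: "ms \<in> set (even_types n)" "type_of ?X b ms"
      using even_type_exists[OF b(1) X(1) b(2,3)] X(2) by metis
    have "resolves (map shape patterns) 2 (ls, 0, False) (ms, 0, False)" using exact_resolvedD[OF resolved_eight] ls(1) ms(1) small by blast
    from res[OF this type_closed[OF ls(2) subset_mset.order_refl] type_closed[OF ms(2) subset_mset.order_refl]]
    show ?thesis using small by simp
  qed
qed

text \<open>Either five profiles are certified, or four including that of a five-cycle. In the
  second case neither type is 5+1, so both factors commute with odd permutations and both classes of
  five-cycles occur in the product.\<close>

lemma eta_ge_six: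
  assumes ab: "a \<in> Alt 6 - {id}" "b \<in> Alt 6 - {id}"
  shows "5 \<le> eta (alt_group 6) (class_prod 6 a b)"
proof -
  let ?X = "{1..6 :: nat}"
  have a: "inv' a permutes ?X" "evenperm (inv' a)" "inv' a \<noteq> id"
    using Alt_inv[of a 6] ab(1) permutes_inv_inv[of a ?X] by auto
  have b: "b permutes ?X" "evenperm b" "b \<noteq> id" using ab(2) by auto
  have X: "finite ?X" "card ?X = 6" by simp_all
  obtain ls where ls: "ls \<in> set (even_types 6)" "type_of ?X (inv' a) ls"
    using even_type_exists[OF a(1) X(1) a(2,3)] X(2) by metis
  obtain ms where ms: "ms \<in> set (even_types 6)" "type_of ?X b ms"
    using even_type_exists[OF b(1) X(1) b(2,3)] X(2) by metis
  note cls = type_closed[OF ls(2) subset_mset.order_refl] and cms = type_closed[OF ms(2) subset_mset.order_refl]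
  consider "resolves (map shape patterns) 5 (ls, 0, False) (ms, 0, False)" | "resolves_six ls ms" "[5, 1] \<notin> {ls, ms}"
    using resolved_six ls(1) ms(1) unfolding all_resolved_six_def Let_def by blast
  then show ?thesis
  proof cases
    case 1
    from many_by_resolves[OF X(1) a(1) b(1) valid_patterns 1 cls cms]
    show ?thesis using eta_ge_many ab by blast
  next
    case 2
    then obtain vs where t: "(ls, ms, vs) \<in> set exceptional_six" unfolding resolves_six_def by force
    then have ok: "exact_ok ls ms vs" "length vs = 4" "sum_list ls = 6"
      "(1, 1, 1) \<in> set (map (\<lambda>v. label_profile 6 (gamma ls Closed ms (fst v))) vs)"
      using valid_six unfolding splits_five_cycles_def by fastforce+
    have sub: "sublist_mset us us" for us by (induction us) auto
    have forms: "has_form ?X (inv' a) ls Closed" "has_form ?X b ms Closed"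
      using category_form[OF cls, of ls Closed] category_form[OF cms, of ms Closed] sub by auto
    have odd: "mset [2] \<subseteq># mset us \<or> mset [1, 1] \<subseteq># mset us \<or> mset [3, 3] \<subseteq># mset us"
      if "us \<in> set (even_types 6)" "us \<noteq> [5, 1]" for us
      using that unfolding even_types_six by auto
    obtain ra where ra: "ra permutes ?X" "\<not> evenperm ra" "twist ra (inv' a) = inv' a"
      using odd_centraliser[OF a(1) X(1) ls(2) odd[OF ls(1)]] 2(2) by auto
    obtain rb where rb: "rb permutes ?X" "\<not> evenperm rb" "twist rb b = b"
      using odd_centraliser[OF b(1) X(1) ms(2) odd[OF ms(1)]] 2(2) by auto
    \<comment> \<open>\<open>ra\<close> was obtained for \<open>inv' a\<close>, whose type is the
      one under consideration.\<close>
    have "twist ra a = a"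
    proof -
      have "ra (inv' a x) = inv' a (ra x)" for x using twist_apply[OF ra(1), of "inv' a" x] ra(3) by simp
      then have "ra (a x) = a (ra x)" for x using ab(1) by (metis Diff_iff mem_Collect_eq permutes_inverses)
      then show ?thesis using ra(1) by (auto simp: twist_def fun_eq_iff permutes_inverses)
    qed
    let ?W = "set (map (\<lambda>v. label_profile 6 (gamma ls Closed ms (fst v))) vs)"
    show ?thesis
    proof (rule eta_ge_five_cycles[OF _ _ ra(1,2) \<open>twist ra a = a\<close> rb])
      have "distinct (map (\<lambda>v. label_profile 6 (gamma ls Closed ms (fst v))) vs)"
        using ok(1,3) unfolding exact_ok_def Let_def by simp
      then show "4 \<le> card ?W" using distinct_card ok(2) by fastforce
      show "\<exists>g \<in> Alt 6. fix_profile ?X (a \<circ> twist g b) = w" if w: "w \<in> ?W" for w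
      proof -
        obtain v where v: "v \<in> set vs" "w = label_profile 6 (gamma ls Closed ms (fst v))" using w by auto
        have "card ?X = sum_list ls" using ok(3) X(2) by simp
        from attained_exact[OF X(1) a(1) b(1) forms this ok(1) v(1)]
        obtain g where "g \<in> Alt 6" "profile_at ?X (inv' a) b g = w" using v(2) ok(3) by auto
        then show ?thesis using ab(1) permutes_inv_inv[of a ?X] by (auto simp: profile_at_def)
      qed
    qed (use ab ok(4) in auto)
  qed
qed

theorem corollary1:
  fixes n :: nat
  assumes "n \<ge> 6"
  shows "min_eta n =
    (if n mod 4 = 0 then 2
     else if n mod 4 = 1 then 4
     else 5)"
proof -
  let ?v = "if n mod 4 = 0 then 2 else if n mod 4 = 1 then 4 else 5"
  have lower: "?v \<le> eta (alt_group n) (class_prod n a b)" if "a \<in> Alt n - {id}" "b \<in> Alt n - {id}" for a b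
  proof (cases "n = 6")
    case True
    then show ?thesis using eta_ge_six that by simp
  next
    case False
    then show ?thesis using many_values[OF that] eta_ge_many[of a n b ?v] that assms by auto
  qed
  have c3: "cycle_of_list [1, 2, 3] \<in> Alt n - {id}"
  proof -
    have "cycle_of_list [1, 2, 3] \<in> Alt n" by (rule cycle3_Alt) (use assms in auto)
    moreover have "cycle_of_list [1, 2, 3] (1 :: nat) \<noteq> id 1" by (simp add: transpose_def)
    ultimately show ?thesis by (metis Diff_iff singletonD)
  qed
  show ?thesis
  proof (cases "n mod 4 = 3")
    case True
    then have "n \<ge> 7" using assms by (cases "n = 6") auto
    from min_etaI[OF lower c3 c3] eta_three_cycles[OF this] True show ?thesis by simp
  next
    case False
    \<comment> \<open>The involution is even only if the number \<open>m\<close> of its 2-cycles is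
      even. The largest such \<open>m\<close> leaves \<open>n mod 4\<close> fixed points, here at
      most two.\<close>
    define m f where "m = 2 * (n div 4)" and "f = n mod 4"
    have nf: "n = 2 * m + f" "f \<le> 2" "even m" using False by (auto simp: m_def f_def)
    have "pairing m permutes {1..n}" by (rule pairing_permutes) (use nf in simp)
    moreover have "m \<ge> 1" using nf assms by simp
    then have "pairing m 1 \<noteq> id 1" by (simp add: pairing_def)
    then have "pairing m \<noteq> id" by metis
    ultimately have p: "pairing m \<in> Alt n - {id}" using nf(3) by (simp add: evenperm_pairing)
    have "eta (alt_group n) (class_prod n (pairing m) (cycle_of_list [1, 2, 3])) \<le> ?v"
      using eta_pairing[OF nf assms] unfolding f_def .
    from min_etaI[OF lower p c3 this] show ?thesis .
  qed
qed

end
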